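(* Assume $\beta_1\in L_1(\mathbb R_+)$ (together with the standing assumptions in the context), $\beta_2(t)=\frac{t^{\alpha-1}}{\Gamma(\alpha)}\in L_{1,\mathrm{loc}}(\mathbb R_+)$ with $0<\alpha<1$, and $c>0$. Let $u$ be the solution of $$u'(t)+\sum_{q=1}^2\int_0^t\beta_q(t-s)\mathbf B_qu(s)\,ds=f(t),\ t>0,\qquad u(0)=u_0,$$ and let $U^n$ be the solution of the scheme $$\delta_tU^1+\sum_{q=1}^2\widetilde Q^{(q)}_1(\mathbf B_qU)=f^1,\qquad \delta_t^{(2)}U^n+\sum_{q=1}^2\widetilde Q^{(q)}_n(\mathbf B_qU)=f^n\ (n\ge2),\qquad U^0=u_0 .$$ Then $$\begin{aligned}\|U^n-u(t_n)\|_A\le\frac{4k}{1-e^{-c}}\Bigg[&\frac8c\int_0^{2k}\|u_{tt}(\zeta)\|d\zeta+k\sum_{n=2}^\infty e^{-\frac c2n}\int_{t_{n-1}}^{t_n}\|u_{ttt}(\zeta)\|d\zeta\\&+\|\beta_1\|_{L_1(0,\infty)}\sum_{n=1}^\infty e^{-\frac c2n}\Big(2\int_0^k\|\mathbf B_1u_t(\zeta)\|d\zeta+k\int_k^{t_n}\|\mathbf B_1u_{tt}(\zeta)\|d\zeta\Big)\\&+\sum_{n=1}^\infty e^{-\frac c2n}\Big(k^2t_n^{\alpha-1}\|\mathbf B_2u_t(0)\|+k^{\alpha+1}\int_{t_{n-1}}^{t_n}\|\mathbf B_2u_{tt}(\zeta)\|d\zeta+k^2\int_0^{t_{n-1}}(t_n-\zeta)^{\alpha-1}\|\mathbf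 B_2u_{tt}(\zeta)\|d\zeta\Big)\Bigg].\end{aligned}$$
   Context: $H$ is a real Hilbert space (such as $L^2(\Omega)$) with norm $\|\cdot\|$; $f:[0,\infty)\to H$. Standing assumptions: each $\mathbf B_q$ is a positive self-adjoint linear operator on a dense subspace $\mathcal D(\mathbf B_q)\subset H$; each $\beta_q$ is real-valued and of positive type on $(0,\infty)$ (i.e. $\int_0^T\varphi(t)\int_0^t\beta_q(t-s)\varphi(s)\,ds\,dt\ge0$ for all $T>0$ and continuous real $\varphi$), with $\int_0^1\beta_q\,dt<\infty$ and $0\le\beta_q(\infty)<\beta_q(0^+)\le\infty$. All $U^n$ lie in $\mathcal D(\mathbf B_1)\cap\mathcal D(\mathbf B_2)$, and $u$ is regular enough for the quantities in the estimate to be defined. Notation: $k>0$ is the time step, $t_n=nk$, $f^n=f(t_n)$, $\delta_tv^n=(v^n-v^{n-1})/k$, $\delta_t^{(2)}v^n=\frac32\delta_tv^n-\frac12\delta_tv^{n-1}$ ($n\ge2$), and for a sequence $(v^n)_{n\ge0}$ in $H$, $\|v^n\|_A=\sqrt{\sum_{n=0}^\infty e^{-cn}\|v^n\|^2}$ (here $v^n=U^n-u(t_n)$, $v^0=0$). Quadrature for $\beta_1$ (interpolation quadrature): with $h(t)=\max(1-|t|,0)$, $$\chi^{(1)}_{n,0}=\int_0^k\beta_1(t_n-\zeta)h(\zeta/k)\,d\zeta\ (n\ge1),\quad w^{(1)}_n=\int_{-k}^{\min(k,t_n)}\beta_1(t_n-\zeta)h(\zeta/k)\,d\zeta\ (n\ge0),\quad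 \widetilde Q^{(1)}_n(\varphi)=\chi^{(1)}_{n,0}\varphi^0+\sum_{l=1}^nw^{(1)}_{n-l}\varphi^l .$$ Quadrature for $\beta_2$ (second-order convolution quadrature): the weights $\omega_n^{(2)}$ are given by $\left[\frac{(3-\zeta)(1-\zeta)}2\right]^{-\alpha}=\sum_{n=0}^\infty\omega_n^{(2)}\zeta^n$, and $$\widetilde Q^{(2)}_n(\varphi)=\varpi^{(2)}_{n,0}\varphi^0+k^\alpha\sum_{p=1}^n\omega^{(2)}_{n-p}\varphi^p,\qquad \varpi^{(2)}_{n,0}=(\beta_2*1)(t_n)-k^\alpha\sum_{p=1}^n\omega^{(2)}_{n-p}\quad(n\ge1),$$ where $(\beta_2*1)(t)=\int_0^t\beta_2(s)\,ds$. *)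

theory Defs
  imports "HOL-Analysis.Analysis"
begin

text \<open>
  An unbounded operator is a total function \<open>B\<close> together with its domain \<open>D\<close>; the values of
  \<open>B\<close> outside \<open>D\<close> are irrelevant.
\<close>

definition adjoint_graph :: "'a::real_inner set \<Rightarrow> ('a \<Rightarrow> 'a) \<Rightarrow> ('a \<times> 'a) set" where
  "adjoint_graph D B = {(y, z). \<forall>x\<in>D. B x \<bullet> y = x \<bullet> z}"

text \<open>The graph equation expresses \<open>B\<^sup>* = B\<close>, including equality of the domains.\<close>

definition positive_selfadjoint :: "'a::real_inner set \<Rightarrow> ('a \<Rightarrow> 'a) \<Rightarrow> bool" where
  "positive_selfadjoint D B \<longleftrightarrow>
     subspace D \<and> closure D = UNIV \<and>
     (\<forall>x\<in>D. \<forall>y\<in>D. B (x + y) = B x + B y) \<and>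
     (\<forall>a. \<forall>x\<in>D. B (a *\<^sub>R x) = a *\<^sub>R B x) \<and>
     adjoint_graph D B = {(y, B y) |y. y \<in> D} \<and>
     (\<forall>x\<in>D. 0 \<le> B x \<bullet> x)"

definition positive_type :: "(real \<Rightarrow> real) \<Rightarrow> bool" where
  "positive_type \<beta> \<longleftrightarrow>
     (\<forall>T>0. \<forall>\<phi>. continuous_on {0..T} \<phi> \<longrightarrow>
        0 \<le> integral {0..T} (\<lambda>t. \<phi> t * integral {0..t} (\<lambda>s. \<beta> (t - s) * \<phi> s)))"

text \<open>The limit at \<open>\<infinity>\<close> is finite, the limit at \<open>0\<close> may be infinite.\<close>

definition memory_kernel :: "(real \<Rightarrow> real) \<Rightarrow> bool" where
  "memory_kernel \<beta> \<longleftrightarrow>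
     positive_type \<beta> \<and> \<beta> absolutely_integrable_on {0<..<1} \<and>
     (\<exists>b0 binf. ((\<lambda>t. ereal (\<beta> t)) \<longlongrightarrow> b0) (at_right 0) \<and> (\<beta> \<longlongrightarrow> binf) at_top \<and>
        0 \<le> binf \<and> ereal binf < b0)"

text \<open>
  \<open>u'\<close> is the time derivative of \<open>u\<close>. The memory integrals are gauge integrals, which need no
  separability of the space.
\<close>

definition evolution_solution ::
  "'a::{real_inner,complete_space} set \<Rightarrow> ('a \<Rightarrow> 'a) \<Rightarrow> (real \<Rightarrow> real) \<Rightarrow>
   'a set \<Rightarrow> ('a \<Rightarrow> 'a) \<Rightarrow> (real \<Rightarrow> real) \<Rightarrow>
   (real \<Rightarrow> 'a) \<Rightarrow> 'a \<Rightarrow> (real \<Rightarrow> 'a) \<Rightarrow> (real \<Rightarrow> 'a) \<Rightarrow> bool" where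
  "evolution_solution D1 B1 \<beta>1 D2 B2 \<beta>2 f u0 u u' \<longleftrightarrow>
     u 0 = u0 \<and>
     (\<forall>t\<ge>0. u t \<in> D1 \<inter> D2 \<and> (u has_vector_derivative u' t) (at t within {0..})) \<and>
     (\<forall>t>0. (\<lambda>s. \<beta>1 (t - s) *\<^sub>R B1 (u s)) integrable_on {0..t} \<and>
            (\<lambda>s. \<beta>2 (t - s) *\<^sub>R B2 (u s)) integrable_on {0..t} \<and>
            u' t + (integral {0..t} (\<lambda>s. \<beta>1 (t - s) *\<^sub>R B1 (u s)) +
                    integral {0..t} (\<lambda>s. \<beta>2 (t - s) *\<^sub>R B2 (u s))) = f t)"

definition bdiff :: "real \<Rightarrow> (nat \<Rightarrow> 'a::real_vector) \<Rightarrow> nat \<Rightarrow> 'a" where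
  "bdiff k v n = (v n - v (n - 1)) /\<^sub>R k"

definition bdiff2 :: "real \<Rightarrow> (nat \<Rightarrow> 'a::real_vector) \<Rightarrow> nat \<Rightarrow> 'a" where
  "bdiff2 k v n = (3/2) *\<^sub>R bdiff k v n - (1/2) *\<^sub>R bdiff k v (n - 1)"

definition hat :: "real \<Rightarrow> real" where
  "hat t = max (1 - \<bar>t\<bar>) 0"

definition iq_start :: "real \<Rightarrow> (real \<Rightarrow> real) \<Rightarrow> nat \<Rightarrow> real" where
  "iq_start k \<beta> n = integral {0..k} (\<lambda>\<zeta>. \<beta> (real n * k - \<zeta>) * hat (\<zeta> / k))"

definition iq_weight :: "real \<Rightarrow> (real \<Rightarrow> real) \<Rightarrow> nat \<Rightarrow> real" where
  "iq_weight k \<beta> n =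
     integral {- k..min k (real n * k)} (\<lambda>\<zeta>. \<beta> (real n * k - \<zeta>) * hat (\<zeta> / k))"

definition interp_quad ::
  "real \<Rightarrow> (real \<Rightarrow> real) \<Rightarrow> nat \<Rightarrow> (nat \<Rightarrow> 'a::real_vector) \<Rightarrow> 'a" where
  "interp_quad k \<beta> n \<phi> =
     iq_start k \<beta> n *\<^sub>R \<phi> 0 + (\<Sum>l=1..n. iq_weight k \<beta> (n - l) *\<^sub>R \<phi> l)"

text \<open>
  \<open>\<omega>\<close> is the coefficient sequence of the power \<open>-\<alpha>\<close> of the generating polynomial
  \<open>(3 - \<zeta>)(1 - \<zeta>)/2\<close>, which is positive for real \<open>\<zeta>\<close> with \<open>\<bar>\<zeta>\<bar> < 1\<close>.
\<close>

definition cq_weights :: "real \<Rightarrow> (nat \<Rightarrow> real) \<Rightarrow> bool" where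
  "cq_weights \<alpha> \<omega> \<longleftrightarrow>
     (\<forall>\<zeta>::real. \<bar>\<zeta>\<bar> < 1 \<longrightarrow> (\<lambda>n. \<omega> n * \<zeta> ^ n) sums (((3 - \<zeta>) * (1 - \<zeta>) / 2) powr (- \<alpha>)))"

definition cq_start :: "real \<Rightarrow> real \<Rightarrow> (real \<Rightarrow> real) \<Rightarrow> (nat \<Rightarrow> real) \<Rightarrow> nat \<Rightarrow> real" where
  "cq_start k \<alpha> \<beta> \<omega> n = integral {0..real n * k} \<beta> - k powr \<alpha> * (\<Sum>p=1..n. \<omega> (n - p))"

definition conv_quad ::
  "real \<Rightarrow> real \<Rightarrow> (real \<Rightarrow> real) \<Rightarrow> (nat \<Rightarrow> real) \<Rightarrow> nat \<Rightarrow> (nat \<Rightarrow> 'a::real_vector) \<Rightarrow> 'a" where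
  "conv_quad k \<alpha> \<beta> \<omega> n \<phi> =
     cq_start k \<alpha> \<beta> \<omega> n *\<^sub>R \<phi> 0 + (k powr \<alpha>) *\<^sub>R (\<Sum>p=1..n. \<omega> (n - p) *\<^sub>R \<phi> p)"

definition scheme_solution ::
  "real \<Rightarrow> real \<Rightarrow> (nat \<Rightarrow> real) \<Rightarrow>
   'a::{real_inner,complete_space} set \<Rightarrow> ('a \<Rightarrow> 'a) \<Rightarrow> (real \<Rightarrow> real) \<Rightarrow>
   'a set \<Rightarrow> ('a \<Rightarrow> 'a) \<Rightarrow> (real \<Rightarrow> real) \<Rightarrow>
   (real \<Rightarrow> 'a) \<Rightarrow> 'a \<Rightarrow> (nat \<Rightarrow> 'a) \<Rightarrow> bool" where
  "scheme_solution k \<alpha> \<omega> D1 B1 \<beta>1 D2 B2 \<beta>2 f u0 U \<longleftrightarrow>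
     U 0 = u0 \<and> (\<forall>n. U n \<in> D1 \<inter> D2) \<and>
     bdiff k U 1 + (interp_quad k \<beta>1 1 (\<lambda>l. B1 (U l)) + conv_quad k \<alpha> \<beta>2 \<omega> 1 (\<lambda>l. B2 (U l))) = f k \<and>
     (\<forall>n\<ge>2. bdiff2 k U n +
        (interp_quad k \<beta>1 n (\<lambda>l. B1 (U l)) + conv_quad k \<alpha> \<beta>2 \<omega> n (\<lambda>l. B2 (U l))) = f (real n * k))"

text \<open>Meaningful only for square-summable weighted sequences; otherwise the sum is \<open>0\<close> by convention.\<close>

definition normA :: "real \<Rightarrow> (nat \<Rightarrow> 'a::real_normed_vector) \<Rightarrow> real" where
  "normA c v = sqrt (\<Sum>\<^sub>\<infinity>n. exp (- c * real n) * (norm (v n))\<^sup>2)"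

end

theory Submission
  imports Defs
begin

text \<open>
  The error \<open>v\<^sup>n = U\<^sup>n - u(t\<^sub>n)\<close> solves the scheme with right-hand side the residual \<open>r\<^sup>n\<close> of the exact
  solution. Taking the inner product with \<open>e\<^bsup>-cn\<^esup> v\<^sup>n\<close> and summing, the memory terms are nonnegative and
  the BDF2 difference telescopes up to the factor \<open>1 - e\<^bsup>-c\<^esup>\<close>, so that
  \<open>\<parallel>v\<parallel>\<^sub>A\<close> is bounded by the weighted \<open>l\<^sup>1\<close> norm of \<open>r\<close>.

  Positivity: the interpolation weights are the kernel \<open>\<beta>\<^sub>1\<close> tested with step functions; the generating
  function of the \<open>\<omega>\<^sub>n\<close> has nonnegative real part in the unit disc. A positive
  quadratic form in scalars passes to the operators by Schur's product theorem, and Abel summation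
  inserts the decreasing weights \<open>e\<^bsup>-cn\<^esup>\<close>.

  Consistency: since \<open>B u\<close> need not be differentiable, its residual is tested with elements of the dense domain
  of \<open>B\<close>, moving \<open>B\<close> to the test element. By Taylor expansion the error of the convolution quadrature
  reduces to its error on the ramps \<open>(t - \<zeta>)\<^sub>+\<close>. The factorisation
  \<open>[(3 - \<zeta>)(1 - \<zeta>)/2]\<^bsup>-\<alpha>\<^esup> = [(3 - \<zeta>)/2]\<^bsup>-\<alpha>\<^esup> (1 - \<zeta>)\<^bsup>-\<alpha>\<^esup>\<close> exhibits the \<open>\<omega>\<^sub>n\<close> as averages of backward Euler weights
  over random shifts of mean \<open>\<alpha>/2\<close>, and on a ramp these average \<open>\<Gamma>(m + 1 + \<alpha>)/\<Gamma>(m)\<close>, whose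
  expansion \<open>m\<^bsup>1+\<alpha>\<^esup> + \<alpha>(1 + \<alpha>)/2 m\<^bsup>\<alpha>\<^esup> + O(m\<^bsup>\<alpha>-1\<^esup>)\<close> has its second term cancelled by the shift.
\<close>

section \<open>Coefficients of the convolution quadrature\<close>

text \<open>The explicit constants of the estimate shape the proof. The stability bound weighs the
  residual by 5/8 at the first step and by 1/2 afterwards, while the \<open>\<beta>2\<close> terms
  enter the final bracket with factor 1. So the convolution quadrature may have error constant 1 at
  n = 1 and 2 for n >= 2, and on ramps its error must be at most 2 x^(\<alpha>-1) for all x >= 1 and
  all \<alpha> in (0,1). Hence the Gamma quotients get two-sided bounds with explicit remainders,
  and the closing inequality \<open>ramp_const_bound\<close> has a slack of only about 0.1. The
  second obstacle is regularity. u'' may be singular at 0, and u''' and \<open>B1 u''\<close> are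
  integrable only from time k on. Residuals near 0 are therefore bounded by lower derivatives: u''
  for the first two difference quotients, \<open>B1 u'\<close> for the first interpolation
  cell.\<close>

lemma powser_coeffs_zero:
  fixes a :: "nat \<Rightarrow> 'a::{real_normed_field,banach}"
  assumes "0 < s" and sums: "\<And>x. norm x < s \<Longrightarrow> (\<lambda>n. a n * x ^ n) sums 0"
  shows "a n = 0"
proof (induction n rule: less_induct)
  case (less n)
  \<comment> \<open>The earlier coefficients vanish by induction, so x^n divides out for nonzero x;
    letting x tend to 0 isolates \<open>a n\<close>.\<close>
  have "(\<lambda>i. a (i + n) * x ^ i) sums 0" if "x \<noteq> 0" "norm x < s" for x
  proof -
    have "(\<lambda>i. a (i + n) * x ^ (i + n)) sums 0"
      using sums[OF that(2)] less
      by (subst sums_zero_iff_shift) auto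
    hence "(\<lambda>i. (x ^ n) * (a (i + n) * x ^ i)) sums 0"
      by (simp add: power_add mult_ac)
    thus ?thesis
      using that(1) by (metis div_0 power_not_zero sums_mult_D)
  qed
  from powser_limit_0_strong[OF \<open>0 < s\<close> this]
  have "((\<lambda>x::'a. 0) \<longlongrightarrow> a n) (at 0)" by simp
  thus ?case by (simp add: tendsto_const_iff)
qed

text \<open>These are the Taylor coefficients of (1 - z)^(-a). For a = \<alpha> they are the
  backward Euler convolution quadrature weights with unit step.\<close>

definition nb_coeff :: "real \<Rightarrow> nat \<Rightarrow> real" where
  "nb_coeff a n = pochhammer a n / fact n"

lemma nb_coeff_0 [simp]: "nb_coeff a 0 = 1"
  by (simp add: nb_coeff_def)

lemma nb_coeff_nonneg: "0 < a \<Longrightarrow> 0 \<le> nb_coeff a n"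
  by (simp add: nb_coeff_def pochhammer_nonneg)

lemma nb_coeff_Suc: "real (Suc n) * nb_coeff a (Suc n) = a * nb_coeff (a + 1) n"
  by (simp add: nb_coeff_def pochhammer_rec del: of_nat_Suc)

text \<open>Taking partial sums multiplies (1 - z)^(-a) by 1/(1 - z), which raises the parameter by
  one.\<close>

lemma sum_nb_coeff: "(\<Sum>j\<le>n. nb_coeff a j) = nb_coeff (a + 1) n"
proof (induction n)
  case (Suc n)
  have "nb_coeff (a + 1) n + nb_coeff a (Suc n) = nb_coeff (a + 1) (Suc n)"
    using nb_coeff_Suc[of n a]
    by (simp add: nb_coeff_def pochhammer_rec' pochhammer_rec[of a] divide_simps) (simp add: algebra_simps)
  with Suc show ?case by simp
qed simp

text \<open>A ramp sum is a double partial sum, so the parameter rises by two. This gives the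
  backward Euler quadrature of a ramp in closed form.\<close>

lemma sum_nb_coeff_weighted:
  "(\<Sum>j<Suc n. nb_coeff a j * (real (Suc n) - real j)) = nb_coeff (a + 2) n"
proof -
  have "(\<Sum>j<Suc n. nb_coeff a j * (real (Suc n) - real j)) = (\<Sum>m\<le>n. \<Sum>j\<le>m. nb_coeff a j)"
  proof (induction n)
    case (Suc n)
    have "(\<Sum>j<Suc (Suc n). nb_coeff a j * (real (Suc (Suc n)) - real j)) =
        (\<Sum>j<Suc (Suc n). nb_coeff a j * (real (Suc n) - real j)) + (\<Sum>j\<le>Suc n. nb_coeff a j)"
      unfolding lessThan_Suc_atMost sum.distrib[symmetric] by (intro sum.cong) (auto simp: algebra_simps)
    also have "(\<Sum>j<Suc (Suc n). nb_coeff a j * (real (Suc n) - real j)) =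
        (\<Sum>j<Suc n. nb_coeff a j * (real (Suc n) - real j))"
      by (subst sum.lessThan_Suc) simp
    finally show ?case using Suc by simp
  qed simp
  thus ?thesis
    by (simp add: sum_nb_coeff[of a] sum_nb_coeff[of "a + 1", simplified add.assoc])
qed

lemma nb_coeff_sums_complex:
  fixes z :: complex
  assumes "norm z < 1"
  shows "(\<lambda>n. of_real (nb_coeff a n) * z ^ n) sums ((1 - z) powr of_real (- a))"
proof -
  have "((of_real (- a)) gchoose n) * (- z) ^ n = of_real (nb_coeff a n) * z ^ n" for n
  proof -
    have "(of_real (- a) :: complex) gchoose n = (-1) ^ n * of_real (nb_coeff a n)"
      by (simp add: gbinomial_pochhammer nb_coeff_def pochhammer_of_real)
    thus ?thesis by (simp add: power_minus')
  qed
  with gen_binomial_complex[of "- z" "of_real (- a)"] assms show ?thesis by simp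
qed

lemma nb_coeff_sums:
  fixes z :: real
  assumes "\<bar>z\<bar> < 1"
  shows "(\<lambda>n. nb_coeff a n * z ^ n) sums ((1 - z) powr (- a))"
proof -
  have "((- a) gchoose n) * (- z) ^ n = nb_coeff a n * z ^ n" for n
    by (simp add: gbinomial_pochhammer nb_coeff_def power_minus')
  with gen_binomial_real[of "- z" "- a"] assms show ?thesis by simp
qed

text \<open>Taylor coefficients of ((3 - z)/2)^(-\<alpha>). As a probability law on the shifts this
  is the negative binomial distribution with parameter \<alpha> and success probability 2/3.\<close>

definition shifted_weight :: "real \<Rightarrow> nat \<Rightarrow> real" where
  "shifted_weight \<alpha> n = (2/3) powr \<alpha> * nb_coeff \<alpha> n / 3 ^ n"

lemma shifted_weight_nonneg: "0 < \<alpha> \<Longrightarrow> 0 \<le> shifted_weight \<alpha> n"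
  by (simp add: shifted_weight_def nb_coeff_nonneg)

lemma shifted_weight_sums:
  fixes z :: real
  assumes "\<bar>z\<bar> < 3"
  shows "(\<lambda>n. shifted_weight \<alpha> n * z ^ n) sums (((3 - z) / 2) powr (- \<alpha>))"
proof -
  have "(\<lambda>n. (2/3) powr \<alpha> * (nb_coeff \<alpha> n * (z/3) ^ n)) sums ((2/3) powr \<alpha> * ((1 - z/3) powr (- \<alpha>)))"
    by (intro sums_mult nb_coeff_sums) (use assms in auto)
  moreover have "(2/3) powr \<alpha> * ((1 - z/3) powr (- \<alpha>)) = ((3 - z) / 2) powr (- \<alpha>)"
  proof -
    have "(2/3::real) powr \<alpha> = (3/2) powr (- \<alpha>)"
      by (simp add: powr_minus powr_divide divide_simps)
    moreover have "(3/2) powr (- \<alpha>) * ((1 - z/3) powr (- \<alpha>)) = ((3/2) * (1 - z/3)) powr (- \<alpha>)"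
      by (rule powr_mult[symmetric])
    moreover have "(3/2) * (1 - z/3) = (3 - z) / 2" by (simp add: field_simps)
    ultimately show ?thesis by (simp only:)
  qed
  ultimately show ?thesis
    by (simp add: shifted_weight_def power_divide mult_ac)
qed

lemma shifted_weight_sums_1: "shifted_weight \<alpha> sums 1"
  using shifted_weight_sums[of 1 \<alpha>] by simp

text \<open>\<open>nb_coeff_Suc\<close> turns n times the n-th coefficient into a coefficient for
  \<alpha> + 1, so the mean is again a binomial series, at z = 1/3.\<close>

lemma shifted_weight_moment1: "(\<lambda>n. real n * shifted_weight \<alpha> n) sums (\<alpha> / 2)"
proof -
  have "(\<lambda>n. (2/3) powr \<alpha> * (\<alpha> / 3) * (nb_coeff (\<alpha> + 1) n * (1/3) ^ n)) sums
      ((2/3) powr \<alpha> * (\<alpha> / 3) * ((1 - 1/3) powr (- (\<alpha> + 1))))"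
    by (intro sums_mult nb_coeff_sums) auto
  moreover have "(2/3) powr \<alpha> * (\<alpha> / 3) * ((1 - 1/3) powr (- (\<alpha> + 1))) = \<alpha> / 2"
  proof -
    have "(2/3::real) powr \<alpha> * (2/3) powr (- (\<alpha> + 1)) = 3/2"
      by (simp add: powr_add[symmetric] powr_minus)
    moreover have "(2/3) powr \<alpha> * (\<alpha> / 3) * ((1 - 1/3) powr (- (\<alpha> + 1))) =
        (\<alpha> / 3) * ((2/3) powr \<alpha> * (2/3) powr (- (\<alpha> + 1)))"
      by (simp add: mult_ac)
    ultimately show ?thesis by (simp only:)
  qed
  moreover have "(2/3) powr \<alpha> * (\<alpha> / 3) * (nb_coeff (\<alpha> + 1) n * (1/3) ^ n) =
      real (Suc n) * shifted_weight \<alpha> (Suc n)" for n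
    using nb_coeff_Suc[of n \<alpha>] unfolding shifted_weight_def
    by (simp add: power_divide divide_simps mult_ac del: of_nat_Suc)
  ultimately have "(\<lambda>n. real (Suc n) * shifted_weight \<alpha> (Suc n)) sums (\<alpha> / 2)"
    by (simp only:)
  thus ?thesis by (subst (asm) sums_Suc_iff) simp
qed

text \<open>Two applications of \<open>nb_coeff_Suc\<close> give the factorial moment
  \<alpha>(\<alpha> + 1)/4; adding the mean yields the second moment.\<close>

lemma shifted_weight_moment2:
  "(\<lambda>n. (real n)\<^sup>2 * shifted_weight \<alpha> n) sums (\<alpha> * (\<alpha> + 3) / 4)"
proof -
  define h where "h = shifted_weight \<alpha>"
  have "(\<lambda>n. (2/3) powr \<alpha> * (\<alpha> * (\<alpha> + 1) / 9) * (nb_coeff (\<alpha> + 2) n * (1/3) ^ n)) sums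
      ((2/3) powr \<alpha> * (\<alpha> * (\<alpha> + 1) / 9) * ((1 - 1/3) powr (- (\<alpha> + 2))))"
    by (intro sums_mult nb_coeff_sums) auto
  moreover have "(2/3) powr \<alpha> * (\<alpha> * (\<alpha> + 1) / 9) * ((1 - 1/3) powr (- (\<alpha> + 2))) = \<alpha> * (\<alpha> + 1) / 4"
  proof -
    have "(2/3::real) powr \<alpha> * (2/3) powr (- (\<alpha> + 2)) = 9/4"
      by (simp add: powr_add[symmetric] powr_minus power2_eq_square)
    moreover have "(2/3) powr \<alpha> * (\<alpha> * (\<alpha> + 1) / 9) * ((1 - 1/3) powr (- (\<alpha> + 2))) =
        (\<alpha> * (\<alpha> + 1) / 9) * ((2/3) powr \<alpha> * (2/3) powr (- (\<alpha> + 2)))"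
      by (simp add: mult_ac)
    ultimately show ?thesis by (simp only:)
  qed
  moreover have "(2/3) powr \<alpha> * (\<alpha> * (\<alpha> + 1) / 9) * (nb_coeff (\<alpha> + 2) n * (1/3) ^ n) =
      real (n + 2) * (real (n + 2) - 1) * h (n + 2)" for n
  proof -
    have "real (Suc (Suc n)) * real (Suc n) * nb_coeff \<alpha> (Suc (Suc n)) =
        \<alpha> * (real (Suc n) * nb_coeff (\<alpha> + 1) (Suc n))"
      using nb_coeff_Suc[of "Suc n" \<alpha>] by (simp add: mult_ac del: of_nat_Suc)
    also have "\<dots> = \<alpha> * (\<alpha> + 1) * nb_coeff (\<alpha> + 2) n"
      using nb_coeff_Suc[of n "\<alpha> + 1"] by (simp add: add.assoc del: of_nat_Suc)
    finally have "real (n + 2) * (real (n + 2) - 1) * nb_coeff \<alpha> (n + 2) =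
        \<alpha> * (\<alpha> + 1) * nb_coeff (\<alpha> + 2) n"
      by (simp add: algebra_simps)
    hence "(2/3) powr \<alpha> * (\<alpha> * (\<alpha> + 1) / 9) * (nb_coeff (\<alpha> + 2) n * (1/3) ^ n) =
        (2/3) powr \<alpha> / 9 * (1/3) ^ n * (real (n + 2) * (real (n + 2) - 1) * nb_coeff \<alpha> (n + 2))"
      by simp
    also have "\<dots> = real (n + 2) * (real (n + 2) - 1) * h (n + 2)"
      unfolding h_def shifted_weight_def by (simp add: power_add power_divide)
    finally show ?thesis .
  qed
  ultimately have "(\<lambda>n. real (n + 2) * (real (n + 2) - 1) * h (n + 2)) sums (\<alpha> * (\<alpha> + 1) / 4)"
    by (simp only:)
  hence "(\<lambda>n. real n * (real n - 1) * h n) sums (\<alpha> * (\<alpha> + 1) / 4)"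
    by (subst (asm) sums_zero_iff_shift) (auto simp: numeral_2_eq_2 less_Suc_eq)
  from sums_add[OF this shifted_weight_moment1[of \<alpha>]]
  have "(\<lambda>n. (real n)\<^sup>2 * shifted_weight \<alpha> n) sums (\<alpha> * (\<alpha> + 1) / 4 + \<alpha> / 2)"
    by (simp add: h_def algebra_simps power2_eq_square)
  moreover have "\<alpha> * (\<alpha> + 1) / 4 + \<alpha> / 2 = \<alpha> * (\<alpha> + 3) / 4" by (simp add: field_simps)
  ultimately show ?thesis by simp
qed

text \<open>Cauchy product of the two factors of the generating function, combined with uniqueness
  of power series coefficients.\<close>

lemma cq_weights_eq:
  assumes "cq_weights \<alpha> \<omega>"
  shows "\<omega> n = (\<Sum>i\<le>n. shifted_weight \<alpha> i * nb_coeff \<alpha> (n - i))"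
proof -
  define c where "c n = (\<Sum>i\<le>n. shifted_weight \<alpha> i * nb_coeff \<alpha> (n - i))" for n
  have "(\<lambda>n. c n * z ^ n) sums (((3 - z) * (1 - z) / 2) powr (- \<alpha>))" if z: "norm z < 1" for z :: real
  proof -
    have z': "\<bar>z\<bar> < 1" using z by simp
    \<comment> \<open>Convergence at a point s between |z| and 1 gives the absolute convergence at z
      that the Cauchy product requires.\<close>
    define s where "s = (1 + \<bar>z\<bar>) / 2"
    have s: "\<bar>z\<bar> < \<bar>s\<bar>" "\<bar>s\<bar> < 1" using z' by (auto simp: s_def)
    have "summable (\<lambda>n. norm (shifted_weight \<alpha> n * z ^ n))" "summable (\<lambda>n. norm (nb_coeff \<alpha> n * z ^ n))"
      using powser_insidea[OF sums_summable[OF shifted_weight_sums[of s \<alpha>]], of z]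
        powser_insidea[OF sums_summable[OF nb_coeff_sums[of s \<alpha>]], of z] s by auto
    from Cauchy_product_sums[OF this]
    have "(\<lambda>n. \<Sum>i\<le>n. (shifted_weight \<alpha> i * z ^ i) * (nb_coeff \<alpha> (n - i) * z ^ (n - i))) sums
        (((3 - z) / 2) powr (- \<alpha>) * ((1 - z) powr (- \<alpha>)))"
      using shifted_weight_sums[of z \<alpha>] nb_coeff_sums[of z \<alpha>] z' by (simp add: sums_iff)
    moreover have "(\<Sum>i\<le>n. (shifted_weight \<alpha> i * z ^ i) * (nb_coeff \<alpha> (n - i) * z ^ (n - i))) = c n * z ^ n" for n
      unfolding c_def sum_distrib_right
      by (intro sum.cong refl) (simp add: power_add[symmetric] mult_ac)
    moreover have "((3 - z) / 2) powr (- \<alpha>) * ((1 - z) powr (- \<alpha>)) = ((3 - z) * (1 - z) / 2) powr (- \<alpha>)"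
      using z' by (subst powr_mult[symmetric]) (auto simp: field_simps)
    ultimately show ?thesis by simp
  qed
  with assms have "(\<lambda>n. (\<omega> n - c n) * z ^ n) sums 0" if "norm z < 1" for z :: real
    using that sums_diff[of "\<lambda>n. \<omega> n * z ^ n" _ "\<lambda>n. c n * z ^ n"]
    by (fastforce simp: cq_weights_def algebra_simps)
  from powser_coeffs_zero[OF zero_less_one this] show ?thesis by (simp add: c_def)
qed

text \<open>Young's inequality for p and 1 with weights a and 1 - a.\<close>

lemma Bernoulli_powr_le:
  fixes p a :: real
  assumes "0 \<le> a" "a \<le> 1" "0 \<le> p"
  shows "p powr a \<le> 1 + a * (p - 1)"
proof (cases "p = 0")
  case False
  with Youngs_inequality_0[of a "1 - a" p 1] assms show ?thesis by (simp add: algebra_simps)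
qed (use assms in auto)

text \<open>The concave case, applied to \<open>p powr a\<close> with exponent 1/a.\<close>

lemma Bernoulli_powr_ge:
  fixes p a :: real
  assumes "1 \<le> a" "0 \<le> p"
  shows "1 + a * (p - 1) \<le> p powr a"
proof -
  have "(p powr a) powr (1 / a) \<le> 1 + (1 / a) * (p powr a - 1)"
    using assms by (intro Bernoulli_powr_le) auto
  thus ?thesis using assms by (auto simp: powr_powr field_simps)
qed

text \<open>The signs of the fourth derivative turn the cubic Taylor polynomial at \<open>1\<close> into a bound.\<close>

lemma powr_cubic_Taylor:
  fixes y a :: real
  assumes y: "0 < y"
  obtains t where "0 < t"
    "y powr a = 1 + a * (y - 1) + a * (a - 1) / 2 * (y - 1)\<^sup>2 + a * (a - 1) * (a - 2) / 6 * (y - 1) ^ 3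
       + a * (a - 1) * (a - 2) * (a - 3) / 24 * t powr (a - 4) * (y - 1) ^ 4"
proof (cases "y = 1")
  case True
  thus ?thesis using that[of 1] by simp
next
  case False
  define d where "d m x = (\<Prod>i<m. a - real i) * x powr (a - real m)" for m :: nat and x :: real
  have "DERIV (d m) t :> d (Suc m) t" if "t > 0" for m t
    unfolding d_def using that
    by (auto intro!: derivative_eq_intros simp: algebra_simps)
  moreover have "d 0 x = x powr a" for x by (simp add: d_def)
  ultimately have "\<exists>t. (if y < 1 then y < t \<and> t < 1 else 1 < t \<and> t < y) \<and>
      y powr a = (\<Sum>m<4. d m 1 / fact m * (y - 1) ^ m) + d 4 t / fact 4 * (y - 1) ^ 4"
    using False y by (intro Taylor[where a = "min y 1" and b = "max y 1"]) (auto simp: fun_eq_iff)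
  then obtain t where t: "if y < 1 then y < t \<and> t < 1 else 1 < t \<and> t < y"
    "y powr a = (\<Sum>m<4. d m 1 / fact m * (y - 1) ^ m) + d 4 t / fact 4 * (y - 1) ^ 4" by blast
  have "0 < t" using t(1) y by (auto split: if_splits)
  moreover have "y powr a = 1 + a * (y - 1) + a * (a - 1) / 2 * (y - 1)\<^sup>2 + a * (a - 1) * (a - 2) / 6 * (y - 1) ^ 3
       + a * (a - 1) * (a - 2) * (a - 3) / 24 * t powr (a - 4) * (y - 1) ^ 4"
    unfolding t(2) by (simp add: d_def eval_nat_numeral fact_numeral field_simps)
  ultimately show ?thesis using that by blast
qed

section \<open>Gamma function quotients\<close>

text \<open>Read probabilistically: \<open>Gamma (m + a) / Gamma m\<close> is the moment of order a
  of a Gamma(m) variable T. Pointwise polynomial bounds on powers thereby become bounds on Gamma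
  quotients.\<close>

lemma Gamma_integral_powr_mult:
  assumes "0 < m" "0 \<le> a"
  shows "((\<lambda>t::real. t powr a * (t powr (m - 1) / exp t)) has_integral Gamma (m + a)) {0..}"
proof -
  have "((\<lambda>t::real. t powr (m + a - 1) / exp t) has_integral Gamma (m + a)) {0..}"
    by (rule Gamma_integral_real) (use assms in auto)
  moreover have "t powr (m + a - 1) / exp t = t powr a * (t powr (m - 1) / exp t)" for t :: real
    by (simp add: powr_add[symmetric] algebra_simps)
  ultimately show ?thesis by simp
qed

lemma Gamma_integral_poly:
  assumes m: "0 < m"
  shows "((\<lambda>t::real. (c0 + c1 * t + c2 * t\<^sup>2 + c3 * t ^ 3) * (t powr (m - 1) / exp t)) has_integral
      (c0 + c1 * m + c2 * (m * (m + 1)) + c3 * (m * (m + 1) * (m + 2))) * Gamma m) {0..}"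
proof -
  have G: "Gamma (m + 1) = m * Gamma m" "Gamma (m + 2) = (m + 1) * m * Gamma m"
    "Gamma (m + 3) = (m + 2) * (m + 1) * m * Gamma m"
    using Gamma_plus1[of m] Gamma_plus1[of "m + 1"] Gamma_plus1[of "m + 2"] m
    by (auto simp: nonpos_Ints_def add.assoc)
  have "((\<lambda>t::real. c0 * (t powr 0 * (t powr (m - 1) / exp t)) + c1 * (t powr 1 * (t powr (m - 1) / exp t))
      + c2 * (t powr 2 * (t powr (m - 1) / exp t)) + c3 * (t powr 3 * (t powr (m - 1) / exp t))) has_integral
      c0 * Gamma (m + 0) + c1 * Gamma (m + 1) + c2 * Gamma (m + 2) + c3 * Gamma (m + 3)) {0..}"
    by (intro has_integral_add has_integral_mult_right Gamma_integral_powr_mult m) auto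
  also have "c0 * Gamma (m + 0) + c1 * Gamma (m + 1) + c2 * Gamma (m + 2) + c3 * Gamma (m + 3) =
      (c0 + c1 * m + c2 * (m * (m + 1)) + c3 * (m * (m + 1) * (m + 2))) * Gamma m"
    unfolding G by (simp add: algebra_simps)
  finally show ?thesis
    by (rule has_integral_spike[of "{0}", rotated 2]) (auto simp: distrib_right mult.assoc add_divide_distrib)
qed

text \<open>The scale m and the Gamma parameter n are kept apart: the lower bound below uses n = m,
  the upper bound n = m + 1.\<close>

lemma Gamma_integral_cubic:
  fixes n m a q r :: real
  assumes n: "0 < n" and m: "m \<noteq> 0"
  shows "((\<lambda>t. (1 + a * (t / m - 1) + q * (t / m - 1)\<^sup>2 + r * (t / m - 1) ^ 3) * (t powr (n - 1) / exp t))
    has_integral ((1 - a + q - r) + (a - 2 * q + 3 * r) * (n / m) + (q - 3 * r) * (n * (n + 1) / m\<^sup>2)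
      + r * (n * (n + 1) * (n + 2) / m ^ 3)) * Gamma n) {0..}"
proof -
  have "1 + a * (y - 1) + q * (y - 1)\<^sup>2 + r * (y - 1) ^ 3 =
      (1 - a + q - r) + (a - 2 * q + 3 * r) * y + (q - 3 * r) * y\<^sup>2 + r * y ^ 3" for y
    by (simp add: algebra_simps power2_eq_square power3_eq_cube)
  hence "1 + a * (t / m - 1) + q * (t / m - 1)\<^sup>2 + r * (t / m - 1) ^ 3 =
      (1 - a + q - r) + (a - 2 * q + 3 * r) / m * t + (q - 3 * r) / m\<^sup>2 * t\<^sup>2 + r / m ^ 3 * t ^ 3" for t
    by (simp only: power_divide times_divide_eq_right times_divide_eq_left)
  thus ?thesis
    using Gamma_integral_poly[OF n, of "1 - a + q - r" "(a - 2 * q + 3 * r) / m" "(q - 3 * r) / m\<^sup>2" "r / m ^ 3"]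
    by (simp only: times_divide_eq_right times_divide_eq_left)
qed

lemma powr_cubic_lower:
  fixes y a :: real
  assumes "0 < y" "1 \<le> a" "a \<le> 2"
  shows "1 + a * (y - 1) + a * (a - 1) / 2 * (y - 1)\<^sup>2 + a * (a - 1) * (a - 2) / 6 * (y - 1) ^ 3 \<le> y powr a"
proof -
  obtain t where t: "y powr a = 1 + a * (y - 1) + a * (a - 1) / 2 * (y - 1)\<^sup>2 + a * (a - 1) * (a - 2) / 6 * (y - 1) ^ 3
       + a * (a - 1) * (a - 2) * (a - 3) / 24 * t powr (a - 4) * (y - 1) ^ 4"
    using powr_cubic_Taylor[OF assms(1)] by metis
  have "0 \<le> a * (a - 1) * ((a - 2) * (a - 3))"
    using assms by (intro mult_nonneg_nonneg mult_nonpos_nonpos) auto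
  hence "0 \<le> a * (a - 1) * (a - 2) * (a - 3)" by (simp only: mult.assoc)
  hence "0 \<le> a * (a - 1) * (a - 2) * (a - 3) / 24 * t powr (a - 4) * (y - 1) ^ 4"
    by (rule mult_nonneg_nonneg[OF mult_nonneg_nonneg[OF divide_nonneg_nonneg]]) auto
  thus ?thesis unfolding t by linarith
qed

lemma powr_cubic_upper:
  fixes y a :: real
  assumes "0 < y" "0 \<le> a" "a \<le> 1"
  shows "y powr a \<le> 1 + a * (y - 1) + a * (a - 1) / 2 * (y - 1)\<^sup>2 + a * (a - 1) * (a - 2) / 6 * (y - 1) ^ 3"
proof -
  obtain t where t: "y powr a = 1 + a * (y - 1) + a * (a - 1) / 2 * (y - 1)\<^sup>2 + a * (a - 1) * (a - 2) / 6 * (y - 1) ^ 3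
       + a * (a - 1) * (a - 2) * (a - 3) / 24 * t powr (a - 4) * (y - 1) ^ 4"
    using powr_cubic_Taylor[OF assms(1)] by metis
  have "a * (a - 1) * ((a - 2) * (a - 3)) \<le> 0"
    using assms by (intro mult_nonpos_nonneg mult_nonneg_nonpos mult_nonpos_nonpos) auto
  hence "a * (a - 1) * (a - 2) * (a - 3) \<le> 0" by (simp only: mult.assoc)
  hence "a * (a - 1) * (a - 2) * (a - 3) / 24 * t powr (a - 4) * (y - 1) ^ 4 \<le> 0"
    by (rule mult_nonpos_nonneg[OF mult_nonpos_nonneg[OF divide_nonpos_nonneg]]) auto
  thus ?thesis unfolding t by linarith
qed

text \<open>The quotient is the mean of T^(1+\<alpha>). The cubic Taylor polynomial in T/m lies
  below the power, and the first three central moments of T/m are 0, 1/m and 2/m^2, whence the three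
  terms.\<close>

lemma Gamma_ratio_lower:
  assumes m: "0 < m" and \<alpha>: "0 \<le> \<alpha>" "\<alpha> \<le> 1"
  shows "m powr (1 + \<alpha>) + \<alpha> * (1 + \<alpha>) / 2 * m powr \<alpha> - \<alpha> * (1 - \<alpha>) * (1 + \<alpha>) / 3 * m powr (\<alpha> - 1)
    \<le> Gamma (m + 1 + \<alpha>) / Gamma (m::real)"
proof -
  define a where "a = 1 + \<alpha>"
  define q where "q = a * (a - 1) / 2"
  define r where "r = a * (a - 1) * (a - 2) / 6"
  define p where "p y = 1 + a * (y - 1) + q * (y - 1)\<^sup>2 + r * (y - 1) ^ 3" for y
  define c where "c = (1 - a + q - r) + (a - 2 * q + 3 * r) * (m / m) + (q - 3 * r) * (m * (m + 1) / m\<^sup>2)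
      + r * (m * (m + 1) * (m + 2) / m ^ 3)"
  have le: "p (t / m) * (t powr (m - 1) / exp t) \<le> inverse (m powr a) * (t powr a * (t powr (m - 1) / exp t))"
    if "t \<in> {0..}" for t
  proof (cases "t = 0")
    case False
    with that have t: "0 < t" by simp
    have "p (t / m) \<le> (t / m) powr a"
      unfolding p_def q_def r_def using powr_cubic_lower[of "t / m" a] t m \<alpha> by (simp add: a_def)
    also have "\<dots> = inverse (m powr a) * t powr a"
      using t m by (simp add: powr_divide divide_simps)
    finally have "p (t / m) * (t powr (m - 1) / exp t) \<le> inverse (m powr a) * t powr a * (t powr (m - 1) / exp t)"
      by (rule mult_right_mono) simp
    thus ?thesis by (simp only: mult.assoc)
  qed auto
  have "((\<lambda>t. p (t / m) * (t powr (m - 1) / exp t)) has_integral c * Gamma m) {0..}"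
    unfolding p_def c_def using m by (intro Gamma_integral_cubic) auto
  moreover have "((\<lambda>t. inverse (m powr a) * (t powr a * (t powr (m - 1) / exp t))) has_integral
      inverse (m powr a) * Gamma (m + a)) {0..}"
    using m \<alpha> by (intro has_integral_mult_right Gamma_integral_powr_mult) (auto simp: a_def)
  ultimately have "c * Gamma m \<le> inverse (m powr a) * Gamma (m + a)"
    using le by (rule has_integral_le)
  also have "c = 1 + q / m + 2 * r / m\<^sup>2"
  proof -
    have "m / m = 1" "m * (m + 1) / m\<^sup>2 = 1 + 1 / m" "m * (m + 1) * (m + 2) / m ^ 3 = 1 + 3 / m + 2 / m\<^sup>2"
      using m by (simp_all add: field_simps power2_eq_square power3_eq_cube)
    thus ?thesis unfolding c_def by (simp add: algebra_simps)
  qed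
  finally have "m powr a * (1 + q / m + 2 * r / m\<^sup>2) \<le> Gamma (m + a) / Gamma m"
    using m Gamma_real_pos[OF m] by (simp add: field_simps)
  moreover have "m powr (1 + \<alpha>) + q * m powr \<alpha> + 2 * r * m powr (\<alpha> - 1) =
      m powr a * (1 + q / m + 2 * r / m\<^sup>2)"
    using m by (simp add: a_def powr_add powr_diff field_simps power2_eq_square)
  moreover have "q = \<alpha> * (1 + \<alpha>) / 2" "2 * r = - (\<alpha> * (1 - \<alpha>) * (1 + \<alpha>) / 3)"
    by (simp_all add: q_def r_def a_def field_simps)
  ultimately show ?thesis by (simp add: a_def add.assoc)
qed

text \<open>For the exponent 1 + \<alpha> the cubic polynomial lies below, so one factor T is moved
  into the weight: \<open>Gamma (m + 1 + \<alpha>)\<close> is a moment of order \<alpha> for the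
  parameter m + 1, and for exponents in [0,1] the polynomial lies above. The expansion point stays
  m.\<close>

lemma Gamma_ratio_upper:
  assumes m: "2 \<le> m" and \<alpha>: "0 \<le> \<alpha>" "\<alpha> \<le> 1"
  shows "Gamma (m + 1 + \<alpha>) / Gamma (m::real)
    \<le> m powr (1 + \<alpha>) + \<alpha> * (1 + \<alpha>) / 2 * m powr \<alpha> + 5 / 3 * \<alpha> * (1 - \<alpha>) * m powr (\<alpha> - 1)"
proof -
  have m0: "0 < m" using m by simp
  define q where "q = \<alpha> * (\<alpha> - 1) / 2"
  define r where "r = \<alpha> * (\<alpha> - 1) * (\<alpha> - 2) / 6"
  define p where "p y = 1 + \<alpha> * (y - 1) + q * (y - 1)\<^sup>2 + r * (y - 1) ^ 3" for y
  define c where "c = (1 - \<alpha> + q - r) + (\<alpha> - 2 * q + 3 * r) * ((m + 1) / m)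
      + (q - 3 * r) * ((m + 1) * (m + 1 + 1) / m\<^sup>2) + r * ((m + 1) * (m + 1 + 1) * (m + 1 + 2) / m ^ 3)"
  have le: "inverse (m powr \<alpha>) * (t powr \<alpha> * (t powr (m + 1 - 1) / exp t)) \<le> p (t / m) * (t powr (m + 1 - 1) / exp t)"
    if "t \<in> {0..}" for t
  proof (cases "t = 0")
    case False
    with that have t: "0 < t" by simp
    have "inverse (m powr \<alpha>) * t powr \<alpha> = (t / m) powr \<alpha>"
      using t m by (simp add: powr_divide divide_simps)
    also have "\<dots> \<le> p (t / m)"
      unfolding p_def q_def r_def using powr_cubic_upper[of "t / m" \<alpha>] t m \<alpha> by simp
    finally have "inverse (m powr \<alpha>) * t powr \<alpha> * (t powr (m + 1 - 1) / exp t) \<le> p (t / m) * (t powr (m + 1 - 1) / exp t)"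
      by (rule mult_right_mono) simp
    thus ?thesis by (simp only: mult.assoc)
  qed auto
  have poly: "((\<lambda>t. p (t / m) * (t powr (m + 1 - 1) / exp t)) has_integral c * Gamma (m + 1)) {0..}"
    unfolding p_def c_def using m by (intro Gamma_integral_cubic) auto
  have "((\<lambda>t. inverse (m powr \<alpha>) * (t powr \<alpha> * (t powr (m + 1 - 1) / exp t))) has_integral
      inverse (m powr \<alpha>) * Gamma (m + 1 + \<alpha>)) {0..}"
    using m \<alpha> by (intro has_integral_mult_right Gamma_integral_powr_mult) auto
  hence "inverse (m powr \<alpha>) * Gamma (m + 1 + \<alpha>) \<le> c * Gamma (m + 1)"
    using poly le by (rule has_integral_le)
  also have "Gamma (m + 1) = m * Gamma m"
    using m by (intro Gamma_plus1) (auto simp: nonpos_Ints_def)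
  also have "c = 1 + (\<alpha> + q) / m + (5 * r + 2 * q) / m\<^sup>2 + 6 * r / m ^ 3"
  proof -
    have "(m + 1) / m = 1 + 1 / m" "(m + 1) * (m + 1 + 1) / m\<^sup>2 = 1 + 3 / m + 2 / m\<^sup>2"
      "(m + 1) * (m + 1 + 1) * (m + 1 + 2) / m ^ 3 = 1 + 6 / m + 11 / m\<^sup>2 + 6 / m ^ 3"
      using m0 by (simp_all add: field_simps power2_eq_square power3_eq_cube)
    thus ?thesis unfolding c_def by (simp only:) (simp add: algebra_simps diff_divide_distrib add_divide_distrib)
  qed
  also have "\<dots> * (m * Gamma m) \<le> (1 + (\<alpha> + q) / m + (5 / 3 * \<alpha> * (1 - \<alpha>)) / m\<^sup>2) * (m * Gamma m)"
  proof (rule mult_right_mono)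
    have "0 \<le> \<alpha> * ((1 - \<alpha>) * (2 - \<alpha>)) / 6"
      using \<alpha> by (intro divide_nonneg_nonneg mult_nonneg_nonneg) auto
    also have "\<dots> = r" by (simp add: r_def algebra_simps)
    \<comment> \<open>Here m >= 2 enters: it absorbs the 1/m^3 term into the 1/m^2 term.\<close>
    finally have "6 * r \<le> 3 * r * m" using mult_left_mono[OF m, of "3 * r"] by simp
    hence "6 * r / m ^ 3 \<le> 3 * r * m / m ^ 3"
      using m0 by (intro divide_right_mono) auto
    also have "\<dots> = 3 * r / m\<^sup>2"
      using m0 by (simp add: power2_eq_square power3_eq_cube)
    finally have "6 * r / m ^ 3 \<le> 3 * r / m\<^sup>2" .
    \<comment> \<open>Origin of 5/3: the left side equals \<alpha>(1 - \<alpha>)(5/3 -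
      4\<alpha>/3).\<close>
    moreover have "5 * r + 2 * q + 3 * r \<le> 5 / 3 * \<alpha> * (1 - \<alpha>)"
    proof -
      have "5 / 3 * \<alpha> * (1 - \<alpha>) - (5 * r + 2 * q + 3 * r) = 4 / 3 * \<alpha>\<^sup>2 * (1 - \<alpha>)"
        by (simp add: r_def q_def field_simps power2_eq_square)
      moreover have "0 \<le> 4 / 3 * \<alpha>\<^sup>2 * (1 - \<alpha>)" using \<alpha> by simp
      ultimately show ?thesis by linarith
    qed
    hence "(5 * r + 2 * q + 3 * r) / m\<^sup>2 \<le> (5 / 3 * \<alpha> * (1 - \<alpha>)) / m\<^sup>2"
      by (rule divide_right_mono) simp
    hence "(5 * r + 2 * q) / m\<^sup>2 + 3 * r / m\<^sup>2 \<le> (5 / 3 * \<alpha> * (1 - \<alpha>)) / m\<^sup>2"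
      by (simp only: add_divide_distrib)
    ultimately show "1 + (\<alpha> + q) / m + (5 * r + 2 * q) / m\<^sup>2 + 6 * r / m ^ 3 \<le>
        1 + (\<alpha> + q) / m + (5 / 3 * \<alpha> * (1 - \<alpha>)) / m\<^sup>2" by linarith
  qed (use m0 Gamma_real_pos[OF m0] in auto)
  finally have "Gamma (m + 1 + \<alpha>) / Gamma m \<le> m powr \<alpha> * m * (1 + (\<alpha> + q) / m + (5 / 3 * \<alpha> * (1 - \<alpha>)) / m\<^sup>2)"
    using m0 Gamma_real_pos[OF m0] by (simp add: divide_simps mult_ac)
  also have "\<dots> = m powr (1 + \<alpha>) + (\<alpha> + q) * m powr \<alpha> + 5 / 3 * \<alpha> * (1 - \<alpha>) * m powr (\<alpha> - 1)"
    using m0 by (simp add: powr_add powr_diff field_simps power2_eq_square)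
  also have "\<alpha> + q = \<alpha> * (1 + \<alpha>) / 2" by (simp add: q_def field_simps)
  finally show ?thesis .
qed

text \<open>Log-convexity together with Gamma(1) = Gamma(2) = 1: the point 1 + \<alpha> lies between
  1 and 2, and 2 lies between 1 and 2 + \<alpha>.\<close>

lemma Gamma_bounds_1_2:
  assumes \<alpha>: "0 < (\<alpha>::real)" "\<alpha> < 1"
  shows "Gamma (1 + \<alpha>) \<le> 1" "1 \<le> Gamma (2 + \<alpha>)"
proof -
  note conv = log_convex_Gamma_real
  have "(ln \<circ> Gamma) ((1 - \<alpha>) *\<^sub>R 1 + \<alpha> *\<^sub>R 2) \<le> (1 - \<alpha>) * (ln \<circ> Gamma) 1 + \<alpha> * (ln \<circ> Gamma) (2::real)"
    using \<alpha> by (intro convex_onD[OF conv]) auto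
  thus "Gamma (1 + \<alpha>) \<le> 1"
    using \<alpha> Gamma_real_pos[of "1 + \<alpha>"] by (simp add: Gamma_numeral algebra_simps)
  define t where "t = 1 / (1 + \<alpha>)"
  have t: "0 < t" "t < 1" using \<alpha> by (auto simp: t_def)
  have "(1 - t) *\<^sub>R 1 + t *\<^sub>R (2 + \<alpha>) = (2::real)"
  proof -
    have "t * (1 + \<alpha>) = 1" using \<alpha> by (simp add: t_def)
    thus ?thesis by (simp add: algebra_simps)
  qed
  moreover have "(ln \<circ> Gamma) ((1 - t) *\<^sub>R 1 + t *\<^sub>R (2 + \<alpha>)) \<le> (1 - t) * (ln \<circ> Gamma) 1 + t * (ln \<circ> Gamma) (2 + \<alpha>)"
    using \<alpha> t by (intro convex_onD[OF conv]) auto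
  ultimately have "(ln \<circ> Gamma) (2::real) \<le> (1 - t) * (ln \<circ> Gamma) 1 + t * (ln \<circ> Gamma) (2 + \<alpha>)"
    by (simp only:)
  hence "0 \<le> t * ln (Gamma (2 + \<alpha>))" by (simp add: Gamma_numeral)
  hence "0 \<le> ln (Gamma (2 + \<alpha>))" using t by (simp add: zero_le_mult_iff)
  thus "1 \<le> Gamma (2 + \<alpha>)" using Gamma_real_pos[of "2 + \<alpha>"] \<alpha> by simp
qed

section \<open>The convolution quadrature on ramp functions\<close>

text \<open>Reordering over the triangle i + l < m leaves, for each shift i, a backward Euler ramp
  sum that is known in closed form.\<close>

lemma cq_weights_ramp_sum:
  assumes \<omega>: "cq_weights \<alpha> \<omega>"
  shows "(\<Sum>j<m. \<omega> j * (real m - real j)) =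
    (\<Sum>i<m. shifted_weight \<alpha> i * nb_coeff (\<alpha> + 2) (m - i - 1))"
proof -
  define F where "F i l = shifted_weight \<alpha> i * nb_coeff \<alpha> l * (real m - real (i + l))" for i l
  have "(\<Sum>j<m. \<omega> j * (real m - real j)) = (\<Sum>j<m. \<Sum>i\<le>j. F i (j - i))"
    unfolding F_def cq_weights_eq[OF \<omega>] sum_distrib_right by (intro sum.cong) auto
  also have "\<dots> = (\<Sum>(i, l)\<in>{(i, l). i + l < m}. F i l)"
    by (rule sum.triangle_reindex[symmetric])
  also have "{(i, l). i + l < m} = (SIGMA i:{..<m}. {..<m - i})" by auto
  also have "(\<Sum>(i, l)\<in>(SIGMA i:{..<m}. {..<m - i}). F i l) = (\<Sum>i<m. \<Sum>l<m - i. F i l)"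
    by (rule sum.Sigma[symmetric]) auto
  also have "\<dots> = (\<Sum>i<m. shifted_weight \<alpha> i * nb_coeff (\<alpha> + 2) (m - i - 1))"
  proof (rule sum.cong[OF refl])
    fix i assume "i \<in> {..<m}"
    then obtain d where d: "m = i + Suc d" using less_imp_Suc_add by auto
    have "(\<Sum>l<m - i. F i l) = shifted_weight \<alpha> i * (\<Sum>l<Suc d. nb_coeff \<alpha> l * (real (Suc d) - real l))"
      unfolding F_def d sum_distrib_left by (intro sum.cong) (auto simp: algebra_simps)
    also have "\<dots> = shifted_weight \<alpha> i * nb_coeff (\<alpha> + 2) d"
      by (simp only: sum_nb_coeff_weighted)
    finally show "(\<Sum>l<m - i. F i l) = shifted_weight \<alpha> i * nb_coeff (\<alpha> + 2) (m - i - 1)"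
      using d by simp
  qed
  finally show ?thesis .
qed

lemma nb_coeff_Gamma:
  assumes "0 < \<alpha>" "0 < m"
  shows "Gamma (2 + \<alpha>) * nb_coeff (\<alpha> + 2) (m - 1) = Gamma (real m + 1 + \<alpha>) / Gamma (real m)"
proof -
  obtain d where d: "m = Suc d" using assms(2) gr0_implies_Suc by blast
  have "\<alpha> + 2 \<notin> \<int>\<^sub>\<le>\<^sub>0" using assms(1) by (auto simp: nonpos_Ints_def)
  hence "pochhammer (\<alpha> + 2) d = Gamma (\<alpha> + 2 + real d) / Gamma (\<alpha> + 2)"
    by (rule pochhammer_Gamma)
  moreover have "Gamma (real m) = fact d" using Gamma_fact[of d] by (simp add: d add.commute)
  moreover have "0 < Gamma (\<alpha> + 2)" by (rule Gamma_real_pos) (use assms(1) in simp)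
  ultimately show ?thesis by (simp add: nb_coeff_def d add_ac)
qed

text \<open>The general bound starts at m = 2. At m = 1 the quotient is (1 + \<alpha>) Gamma(1 +
  \<alpha>) <= 1 + \<alpha>, which is smaller than the right side.\<close>

lemma Gamma_ratio_upper_nat:
  assumes m: "0 < (m::nat)" and \<alpha>: "0 < \<alpha>" "\<alpha> < 1"
  shows "Gamma (real m + 1 + \<alpha>) / Gamma (real m)
    \<le> real m powr (1 + \<alpha>) + \<alpha> * (1 + \<alpha>) / 2 * real m powr \<alpha> + 5 / 3 * \<alpha> * (1 - \<alpha>) * real m powr (\<alpha> - 1)"
proof (cases "m = 1")
  case True
  have "Gamma (2 + \<alpha>) = (1 + \<alpha>) * Gamma (1 + \<alpha>)"
    using Gamma_plus1[of "1 + \<alpha>"] \<alpha> by (auto simp: nonpos_Ints_def add_ac)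
  also have "\<dots> \<le> (1 + \<alpha>) * 1"
    using \<alpha> Gamma_bounds_1_2(1)[OF \<alpha>] by (intro mult_left_mono) auto
  also have "\<dots> = 1 + \<alpha> * (1 + \<alpha>) / 2 + 5 / 3 * \<alpha> * (1 - \<alpha>) - 7 / 6 * (\<alpha> * (1 - \<alpha>))"
    by (simp add: field_simps)
  also have "\<dots> \<le> 1 + \<alpha> * (1 + \<alpha>) / 2 + 5 / 3 * \<alpha> * (1 - \<alpha>)"
    using \<alpha> by simp
  finally show ?thesis using True by simp
qed (use Gamma_ratio_upper[of "real m" \<alpha>] m \<alpha> in auto)

text \<open>From m <= (m - i)(1 + i) and Bernoulli. The loss is linear in i, so averaging over the
  shift costs only its mean.\<close>

lemma powr_sub_le:
  assumes "i < m" "0 < \<alpha>" "\<alpha> < 1"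
  shows "real (m - i) powr (\<alpha> - 1) \<le> (1 + (1 - \<alpha>) * real i) * real m powr (\<alpha> - 1)"
proof -
  have "real m \<le> real (m - i) * (1 + real i)"
  proof -
    have "m - i + i * 1 \<le> m - i + i * (m - i)" using assms(1) by (intro add_left_mono mult_left_mono) auto
    hence "m \<le> (m - i) * (1 + i)" using assms(1) by (simp add: algebra_simps)
    thus ?thesis by (metis of_nat_1 of_nat_add of_nat_le_iff of_nat_mult)
  qed
  hence "real m / (1 + real i) \<le> real (m - i)" by (simp add: field_simps)
  hence "real (m - i) powr (\<alpha> - 1) \<le> (real m / (1 + real i)) powr (\<alpha> - 1)"
    using assms by (intro powr_mono2') auto
  also have "\<dots> = (1 + real i) powr (1 - \<alpha>) * real m powr (\<alpha> - 1)"
    using assms by (simp add: powr_divide powr_diff field_simps)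
  also have "\<dots> \<le> (1 + (1 - \<alpha>) * real i) * real m powr (\<alpha> - 1)"
    using Bernoulli_powr_le[of "1 - \<alpha>" "1 + real i"] assms by (intro mult_right_mono) auto
  finally show ?thesis .
qed

context
  fixes \<alpha> :: real and \<omega> :: "nat \<Rightarrow> real"
  assumes \<alpha>: "0 < \<alpha>" "\<alpha> < 1" and \<omega>: "cq_weights \<alpha> \<omega>"
begin

text \<open>The finite sum is padded by zeros to a series over all shifts, so that it can be
  compared termwise with polynomials in i, whose averages are the full moments.\<close>

lemma ramp_sum_sums:
  "(\<lambda>i. shifted_weight \<alpha> i * (if i < m then Gamma (real (m - i) + 1 + \<alpha>) / Gamma (real (m - i)) else 0))
     sums (Gamma (2 + \<alpha>) * (\<Sum>j<m. \<omega> j * (real m - real j)))"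
proof -
  have "Gamma (2 + \<alpha>) * (\<Sum>j<m. \<omega> j * (real m - real j)) =
      (\<Sum>i<m. shifted_weight \<alpha> i * (Gamma (2 + \<alpha>) * nb_coeff (\<alpha> + 2) (m - i - 1)))"
    unfolding cq_weights_ramp_sum[OF \<omega>] sum_distrib_left by (simp add: mult_ac)
  also have "\<dots> = (\<Sum>i<m. shifted_weight \<alpha> i *
      (if i < m then Gamma (real (m - i) + 1 + \<alpha>) / Gamma (real (m - i)) else 0))"
  proof (rule sum.cong[OF refl])
    fix i assume "i \<in> {..<m}"
    with nb_coeff_Gamma[OF \<alpha>(1), of "m - i"]
    show "shifted_weight \<alpha> i * (Gamma (2 + \<alpha>) * nb_coeff (\<alpha> + 2) (m - i - 1)) = shifted_weight \<alpha> i *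
      (if i < m then Gamma (real (m - i) + 1 + \<alpha>) / Gamma (real (m - i)) else 0)"
      by simp
  qed
  finally show ?thesis
    using sums_finite[of "{..<m}" "\<lambda>i. shifted_weight \<alpha> i *
      (if i < m then Gamma (real (m - i) + 1 + \<alpha>) / Gamma (real (m - i)) else 0)"] by simp
qed

lemma moment_sums:
  "(\<lambda>i. shifted_weight \<alpha> i * (c0 + c1 * real i + c2 * (real i)\<^sup>2)) sums
     (c0 + c1 * (\<alpha> / 2) + c2 * (\<alpha> * (\<alpha> + 3) / 4))"
proof -
  have "(\<lambda>i. c0 * shifted_weight \<alpha> i + c1 * (real i * shifted_weight \<alpha> i) + c2 * ((real i)\<^sup>2 * shifted_weight \<alpha> i))
      sums (c0 * 1 + c1 * (\<alpha> / 2) + c2 * (\<alpha> * (\<alpha> + 3) / 4))"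
    by (intro sums_add sums_mult shifted_weight_sums_1 shifted_weight_moment1 shifted_weight_moment2)
  thus ?thesis by (simp add: algebra_simps)
qed

text \<open>
  Bounds the second moment \<open>\<alpha>(\<alpha> + 3)/4\<close> of the shift plus the remainder of the Gamma quotient, which the
  average over the shift inflates by at most \<open>9/8\<close>.
\<close>

definition ramp_const :: real where
  "ramp_const = \<alpha> + 15 / 8 * \<alpha> * (1 - \<alpha>)"

lemma ramp_sum_upper:
  assumes m: "0 < m"
  shows "Gamma (2 + \<alpha>) * (\<Sum>j<m. \<omega> j * (real m - real j)) \<le> real m powr (1 + \<alpha>) + ramp_const * real m powr (\<alpha> - 1)"
proof -
  define M where "M = real m"
  define s where "s = \<alpha> * (1 + \<alpha>) / 2"
  define c where "c = 5 / 3 * \<alpha> * (1 - \<alpha>)"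
  \<comment> \<open>A majorant quadratic in i, so that averaging uses only the first two moments of
    the shift.\<close>
  define R where "R i = M powr (1 + \<alpha>) - (1 + \<alpha>) * i * M powr \<alpha> + s * M powr \<alpha> +
    (i\<^sup>2 + c * (1 + (1 - \<alpha>) * i)) * M powr (\<alpha> - 1)" for i :: real
  have M: "0 < M" and s: "0 \<le> s" and c: "0 \<le> c" using m \<alpha> by (auto simp: M_def s_def c_def)
  have MM: "M powr \<alpha> = M * M powr (\<alpha> - 1)" "M powr (1 + \<alpha>) = M * M * M powr (\<alpha> - 1)"
    using M by (simp_all add: powr_add powr_diff)
  have le: "(if i < m then Gamma (real (m - i) + 1 + \<alpha>) / Gamma (real (m - i)) else 0) \<le> R (real i)" for i
  proof (cases "i < m")
    case True
    define d where "d = real (m - i)"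
    have d: "0 < d" "d \<le> M" "d = M - real i" using True by (auto simp: d_def M_def)
    have "d powr (1 + \<alpha>) \<le> M powr (1 + \<alpha>) - (1 + \<alpha>) * real i * M powr \<alpha> + (real i)\<^sup>2 * M powr (\<alpha> - 1)"
    proof -
      have "(d / M) powr \<alpha> \<le> 1 + \<alpha> * (d / M - 1)"
        using d M \<alpha> by (intro Bernoulli_powr_le) auto
      moreover have "M powr \<alpha> * (d / M) powr \<alpha> = d powr \<alpha>"
        using d(1) M by (simp add: powr_divide)
      ultimately have "d powr \<alpha> \<le> M powr \<alpha> * (1 + \<alpha> * (d / M - 1))"
        by (metis mult_left_mono powr_ge_zero)
      also have "\<dots> = M powr (\<alpha> - 1) * (M - \<alpha> * real i)"
        unfolding d(3) using M by (simp add: MM field_simps)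
      finally have "d * d powr \<alpha> \<le> d * (M powr (\<alpha> - 1) * (M - \<alpha> * real i))"
        using d by (intro mult_left_mono) auto
      also have "\<dots> = M powr (1 + \<alpha>) - (1 + \<alpha>) * real i * M powr \<alpha> + \<alpha> * (real i)\<^sup>2 * M powr (\<alpha> - 1)"
        by (simp add: MM d(3) algebra_simps power2_eq_square)
      also have "\<alpha> * (real i)\<^sup>2 * M powr (\<alpha> - 1) \<le> 1 * (real i)\<^sup>2 * M powr (\<alpha> - 1)"
        using \<alpha> by (intro mult_right_mono) auto
      finally show ?thesis using d by (simp add: powr_add)
    qed
    moreover have "s * d powr \<alpha> \<le> s * M powr \<alpha>"
      using s d \<alpha> by (intro mult_left_mono powr_mono2) auto
    moreover have "c * d powr (\<alpha> - 1) \<le> c * ((1 + (1 - \<alpha>) * real i) * M powr (\<alpha> - 1))"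
      using c powr_sub_le[OF True \<alpha>] unfolding d_def M_def by (intro mult_left_mono)
    moreover have "Gamma (d + 1 + \<alpha>) / Gamma d \<le> d powr (1 + \<alpha>) + s * d powr \<alpha> + c * d powr (\<alpha> - 1)"
      unfolding d_def s_def c_def using Gamma_ratio_upper_nat[of "m - i" \<alpha>] True \<alpha> by simp
    ultimately have "Gamma (d + 1 + \<alpha>) / Gamma d \<le> R (real i)"
      by (simp add: R_def algebra_simps)
    thus ?thesis using True unfolding d_def by simp
  next
    \<comment> \<open>Shifts beyond m contribute 0, so R has to stay nonnegative there; this follows
      from M^2 - (1 + \<alpha>) i M + i^2 >= (M - i)^2.\<close>
    case False
    hence "M \<le> real i" by (simp add: M_def)
    have "\<alpha> * (M * real i) \<le> 1 * (M * real i)" using \<alpha> M by (intro mult_right_mono) auto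
    moreover have "0 \<le> (M - real i)\<^sup>2" by simp
    ultimately have "0 \<le> M * M - (1 + \<alpha>) * real i * M + (real i)\<^sup>2"
      by (simp add: power2_eq_square algebra_simps)
    hence "0 \<le> (M * M - (1 + \<alpha>) * real i * M + (real i)\<^sup>2) * M powr (\<alpha> - 1)" by simp
    moreover have "0 \<le> s * M powr \<alpha> + c * (1 + (1 - \<alpha>) * real i) * M powr (\<alpha> - 1)"
      using s c \<alpha> by (intro add_nonneg_nonneg mult_nonneg_nonneg) auto
    ultimately have "0 \<le> R (real i)" by (simp add: R_def MM algebra_simps)
    thus ?thesis using False by simp
  qed
  have "R i = (M powr (1 + \<alpha>) + s * M powr \<alpha> + c * M powr (\<alpha> - 1)) +
      (c * (1 - \<alpha>) * M powr (\<alpha> - 1) - (1 + \<alpha>) * M powr \<alpha>) * i + M powr (\<alpha> - 1) * i\<^sup>2" for i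
    by (simp add: R_def algebra_simps)
  hence "(\<lambda>i. shifted_weight \<alpha> i * R (real i)) sums ((M powr (1 + \<alpha>) + s * M powr \<alpha> + c * M powr (\<alpha> - 1)) +
      (c * (1 - \<alpha>) * M powr (\<alpha> - 1) - (1 + \<alpha>) * M powr \<alpha>) * (\<alpha> / 2) + M powr (\<alpha> - 1) * (\<alpha> * (\<alpha> + 3) / 4))"
    by (simp only: moment_sums)
  from sums_le[OF _ ramp_sum_sums[of m] this]
  have "Gamma (2 + \<alpha>) * (\<Sum>j<m. \<omega> j * (real m - real j)) \<le> (M powr (1 + \<alpha>) + s * M powr \<alpha> + c * M powr (\<alpha> - 1)) +
      (c * (1 - \<alpha>) * M powr (\<alpha> - 1) - (1 + \<alpha>) * M powr \<alpha>) * (\<alpha> / 2) + M powr (\<alpha> - 1) * (\<alpha> * (\<alpha> + 3) / 4)"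
    using le shifted_weight_nonneg[OF \<alpha>(1)] by (simp add: mult_left_mono)
  \<comment> \<open>The \<open>M powr \<alpha>\<close> terms cancel since s is exactly 1 + \<alpha>
    times the mean \<alpha>/2 of the shift: this is the second-order accuracy.\<close>
  also have "\<dots> = M powr (1 + \<alpha>) + (\<alpha> * (\<alpha> + 3) / 4 + c * (1 + \<alpha> * (1 - \<alpha>) / 2)) * M powr (\<alpha> - 1)"
    by (simp add: s_def field_simps)
  also have "\<dots> \<le> M powr (1 + \<alpha>) + ramp_const * M powr (\<alpha> - 1)"
  proof (intro add_left_mono mult_right_mono)
    have "\<alpha> * (\<alpha> + 3) / 4 \<le> \<alpha>" using \<alpha> mult_left_mono[of "\<alpha> + 3" 4 \<alpha>] by simp
    moreover have "c * (1 + \<alpha> * (1 - \<alpha>) / 2) \<le> c * (9 / 8)"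
    proof (rule mult_left_mono[OF _ c])
      have "0 \<le> (2 * \<alpha> - 1)\<^sup>2" by simp
      thus "1 + \<alpha> * (1 - \<alpha>) / 2 \<le> 9 / 8" by (simp add: power2_eq_square algebra_simps)
    qed
    ultimately show "\<alpha> * (\<alpha> + 3) / 4 + c * (1 + \<alpha> * (1 - \<alpha>) / 2) \<le> ramp_const"
      by (simp add: ramp_const_def c_def)
  qed auto
  finally show ?thesis by (simp add: M_def)
qed

lemma ramp_sum_lower:
  assumes m: "0 < m"
  shows "real m powr (1 + \<alpha>) - ramp_const * real m powr (\<alpha> - 1) \<le> Gamma (2 + \<alpha>) * (\<Sum>j<m. \<omega> j * (real m - real j))"
proof -
  define M where "M = real m"
  define s where "s = \<alpha> * (1 + \<alpha>) / 2"
  define c where "c = \<alpha> * (1 - \<alpha>) * (1 + \<alpha>) / 3"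
  \<comment> \<open>A minorant linear in i: \<open>d powr (1 + \<alpha>)\<close> is bounded below by
    its tangent at M, \<open>d powr \<alpha>\<close> by its chord from 0 to M.\<close>
  define R where "R i = M powr (1 + \<alpha>) - (1 + \<alpha>) * i * M powr \<alpha> + s * M powr \<alpha> -
    (s * i + c * (1 + (1 - \<alpha>) * i)) * M powr (\<alpha> - 1)" for i :: real
  have M: "0 < M" and s: "0 \<le> s" and c: "0 \<le> c" using m \<alpha> by (auto simp: M_def s_def c_def)
  have MM: "M powr \<alpha> = M * M powr (\<alpha> - 1)" "M powr (1 + \<alpha>) = M * M * M powr (\<alpha> - 1)"
    using M by (simp_all add: powr_add powr_diff)
  have le: "R (real i) \<le> (if i < m then Gamma (real (m - i) + 1 + \<alpha>) / Gamma (real (m - i)) else 0)" for i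
  proof (cases "i < m")
    case True
    define d where "d = real (m - i)"
    have d: "0 < d" "d \<le> M" "d = M - real i" using True by (auto simp: d_def M_def)
    have "M powr (1 + \<alpha>) - (1 + \<alpha>) * real i * M powr \<alpha> \<le> d powr (1 + \<alpha>)"
    proof -
      have "1 + (1 + \<alpha>) * (d / M - 1) \<le> (d / M) powr (1 + \<alpha>)"
        using d M \<alpha> by (intro Bernoulli_powr_ge) auto
      moreover have "M powr (1 + \<alpha>) * (d / M) powr (1 + \<alpha>) = d powr (1 + \<alpha>)"
        using d(1) M by (simp add: powr_divide)
      ultimately have "M powr (1 + \<alpha>) * (1 + (1 + \<alpha>) * (d / M - 1)) \<le> d powr (1 + \<alpha>)"
        by (metis mult_left_mono powr_ge_zero)
      moreover have "M powr (1 + \<alpha>) * (1 + (1 + \<alpha>) * (d / M - 1)) = M powr (1 + \<alpha>) - (1 + \<alpha>) * real i * M powr \<alpha>"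
        using M by (simp add: MM d(3) field_simps)
      ultimately show ?thesis by simp
    qed
    moreover have "s * M powr \<alpha> - s * real i * M powr (\<alpha> - 1) \<le> s * d powr \<alpha>"
    proof -
      have "(d / M) powr 1 \<le> (d / M) powr \<alpha>"
        using d M \<alpha> by (intro powr_mono') auto
      moreover have "M powr \<alpha> * (d / M) powr \<alpha> = d powr \<alpha>" "(d / M) powr 1 = d / M"
        using d(1) M by (simp_all add: powr_divide)
      ultimately have "M powr \<alpha> * (d / M) \<le> d powr \<alpha>"
        by (metis mult_left_mono powr_ge_zero)
      moreover have "M powr \<alpha> * (d / M) = M powr \<alpha> - real i * M powr (\<alpha> - 1)"
        using M by (simp add: MM d(3) field_simps)
      ultimately show ?thesis using mult_left_mono[OF _ s, of "M powr \<alpha> - real i * M powr (\<alpha> - 1)" "d powr \<alpha>"]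
        by (simp add: algebra_simps)
    qed
    moreover have "c * d powr (\<alpha> - 1) \<le> c * ((1 + (1 - \<alpha>) * real i) * M powr (\<alpha> - 1))"
      using c powr_sub_le[OF True \<alpha>] unfolding d_def M_def by (intro mult_left_mono)
    moreover have "d powr (1 + \<alpha>) + s * d powr \<alpha> - c * d powr (\<alpha> - 1) \<le> Gamma (d + 1 + \<alpha>) / Gamma d"
      unfolding s_def c_def using Gamma_ratio_lower[of d \<alpha>] d \<alpha> by simp
    ultimately have "R (real i) \<le> Gamma (d + 1 + \<alpha>) / Gamma d"
      by (simp add: R_def algebra_simps)
    thus ?thesis using True unfolding d_def by simp
  next
    case False
    have i: "M \<le> real i" using False by (simp add: M_def)
    have "0 \<le> \<alpha> * real i" using \<alpha> by simp
    hence "M \<le> (1 + \<alpha>) * real i" using i by (simp add: distrib_right)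
    hence "M * M - (1 + \<alpha>) * real i * M \<le> 0" using M mult_right_mono[of M "(1 + \<alpha>) * real i" M] by simp
    hence "(M * M - (1 + \<alpha>) * real i * M) * M powr (\<alpha> - 1) \<le> 0" by (simp add: mult_nonpos_nonneg)
    moreover have "s * (M - real i) * M powr (\<alpha> - 1) \<le> 0"
      using s i by (intro mult_nonpos_nonneg mult_nonneg_nonpos) auto
    moreover have "0 \<le> c * (1 + (1 - \<alpha>) * real i) * M powr (\<alpha> - 1)"
      using c \<alpha> by (intro mult_nonneg_nonneg add_nonneg_nonneg) auto
    ultimately have "R (real i) \<le> 0" by (simp add: R_def MM algebra_simps)
    thus ?thesis using False by simp
  qed
  have "R i = (M powr (1 + \<alpha>) + s * M powr \<alpha> - c * M powr (\<alpha> - 1)) +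
      (- (c * (1 - \<alpha>) + s) * M powr (\<alpha> - 1) - (1 + \<alpha>) * M powr \<alpha>) * i + 0 * i\<^sup>2" for i
    by (simp add: R_def algebra_simps)
  hence "(\<lambda>i. shifted_weight \<alpha> i * R (real i)) sums ((M powr (1 + \<alpha>) + s * M powr \<alpha> - c * M powr (\<alpha> - 1)) +
      (- (c * (1 - \<alpha>) + s) * M powr (\<alpha> - 1) - (1 + \<alpha>) * M powr \<alpha>) * (\<alpha> / 2) + 0 * (\<alpha> * (\<alpha> + 3) / 4))"
    by (simp only: moment_sums)
  from sums_le[OF _ this ramp_sum_sums[of m]]
  have "(M powr (1 + \<alpha>) + s * M powr \<alpha> - c * M powr (\<alpha> - 1)) +
      (- (c * (1 - \<alpha>) + s) * M powr (\<alpha> - 1) - (1 + \<alpha>) * M powr \<alpha>) * (\<alpha> / 2)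
      \<le> Gamma (2 + \<alpha>) * (\<Sum>j<m. \<omega> j * (real m - real j))"
    using le shifted_weight_nonneg[OF \<alpha>(1)] by (simp add: mult_left_mono)
  moreover have "(M powr (1 + \<alpha>) + s * M powr \<alpha> - c * M powr (\<alpha> - 1)) +
      (- (c * (1 - \<alpha>) + s) * M powr (\<alpha> - 1) - (1 + \<alpha>) * M powr \<alpha>) * (\<alpha> / 2)
      = M powr (1 + \<alpha>) - (s * \<alpha> / 2 + c * (1 + \<alpha> * (1 - \<alpha>) / 2)) * M powr (\<alpha> - 1)"
    by (simp add: s_def field_simps)
  moreover have "(s * \<alpha> / 2 + c * (1 + \<alpha> * (1 - \<alpha>) / 2)) * M powr (\<alpha> - 1) \<le> ramp_const * M powr (\<alpha> - 1)"
  proof (rule mult_right_mono)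
    have "s \<le> 1" using \<alpha> mult_mono[of \<alpha> 1 "1 + \<alpha>" 2] by (simp add: s_def)
    hence "s * \<alpha> \<le> 1 * \<alpha>" using \<alpha> by (intro mult_right_mono) auto
    moreover have "c * (1 + \<alpha> * (1 - \<alpha>) / 2) \<le> c * (9 / 8)"
    proof (rule mult_left_mono[OF _ c])
      have "0 \<le> (2 * \<alpha> - 1)\<^sup>2" by simp
      thus "1 + \<alpha> * (1 - \<alpha>) / 2 \<le> 9 / 8" by (simp add: power2_eq_square algebra_simps)
    qed
    moreover have "\<alpha> * (1 - \<alpha>) * (1 + \<alpha>) \<le> \<alpha> * (1 - \<alpha>) * 2"
      using \<alpha> by (intro mult_left_mono) auto
    hence "c \<le> 2 / 3 * (\<alpha> * (1 - \<alpha>))" by (simp add: c_def)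
    moreover have "0 \<le> \<alpha> * (1 - \<alpha>)" using \<alpha> by simp
    moreover have "ramp_const = \<alpha> + 15 / 8 * (\<alpha> * (1 - \<alpha>))" by (simp add: ramp_const_def)
    ultimately show "s * \<alpha> / 2 + c * (1 + \<alpha> * (1 - \<alpha>) / 2) \<le> ramp_const"
      using \<alpha> by linarith
  qed simp
  ultimately show ?thesis by (simp add: M_def)
qed

text \<open>The three ingredients are the error at grid points, the interpolation error \<alpha>/2
  between them, and the factor 2 - \<alpha> for passing from the floor of x to x. In t = 1 -
  \<alpha> the difference is a cubic, displayed as squares with nonnegative coefficients plus a
  positive constant.\<close>

lemma ramp_const_bound: "(ramp_const + \<alpha> / 2) * (2 - \<alpha>) \<le> 2"
proof -
  define t where "t = 1 - \<alpha>"
  have t: "0 \<le> t" using \<alpha> by (simp add: t_def)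
  have "2 - (ramp_const + \<alpha> / 2) * (2 - \<alpha>) = 1/2 - 15/8 * t + 3/2 * t\<^sup>2 + 15/8 * (t * t\<^sup>2)"
    unfolding ramp_const_def t_def by (simp add: field_simps power2_eq_square)
  also have "\<dots> = 15/8 * (t * (t - 2/5)\<^sup>2) + 3 * (t - 29/80)\<^sup>2 + (1/2 - 3 * (29/80)\<^sup>2)"
    by (simp add: field_simps power2_eq_square)
  also have "\<dots> \<ge> 0"
    using t by (intro add_nonneg_nonneg mult_nonneg_nonneg zero_le_power2) (auto simp: power2_eq_square)
  finally show ?thesis by simp
qed

text \<open>Convexity: the tangent at the inner point gives the sign, the tangents at both ends give
  \<theta>(1 - \<theta>) times the increment of the derivative. Then \<theta>(1 - \<theta>) <= 1/4,
  1 + \<alpha> <= 2, and the increment of y^\<alpha> is at most \<alpha> m^(\<alpha>-1).\<close>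

lemma powr_interp_bounds:
  assumes m: "0 < m" and \<theta>: "0 \<le> \<theta>" "\<theta> \<le> 1"
  defines "D \<equiv> (1 - \<theta>) * m powr (1 + \<alpha>) + \<theta> * (m + 1) powr (1 + \<alpha>) - (m + \<theta>) powr (1 + \<alpha>)"
  shows "0 \<le> D" "D \<le> \<alpha> / 2 * m powr (\<alpha> - 1)"
proof -
  have tangent: "x powr (1 + \<alpha>) + (1 + \<alpha>) * x powr \<alpha> * (y - x) \<le> y powr (1 + \<alpha>)" if "0 < x" "0 \<le> y" for x y :: real
  proof -
    have "1 + (1 + \<alpha>) * (y / x - 1) \<le> (y / x) powr (1 + \<alpha>)"
      using that \<alpha> by (intro Bernoulli_powr_ge) auto
    moreover have "x powr (1 + \<alpha>) * (y / x) powr (1 + \<alpha>) = y powr (1 + \<alpha>)"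
      using that by (simp add: powr_divide)
    ultimately have "x powr (1 + \<alpha>) * (1 + (1 + \<alpha>) * (y / x - 1)) \<le> y powr (1 + \<alpha>)"
      by (metis mult_left_mono powr_ge_zero)
    moreover have "x powr (1 + \<alpha>) * (1 + (1 + \<alpha>) * (y / x - 1)) = x powr (1 + \<alpha>) + (1 + \<alpha>) * x powr \<alpha> * (y - x)"
      using that by (simp add: powr_add field_simps)
    ultimately show ?thesis by simp
  qed
  define x where "x = m + \<theta>"
  have x: "0 < x" "m - x = - \<theta>" "m + 1 - x = 1 - \<theta>" using m \<theta> by (auto simp: x_def)
  have "(1 - \<theta>) * (x powr (1 + \<alpha>) + (1 + \<alpha>) * x powr \<alpha> * (m - x)) \<le> (1 - \<theta>) * m powr (1 + \<alpha>)"
    using tangent[of x m] x(1) m \<theta> by (intro mult_left_mono) auto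
  moreover have "\<theta> * (x powr (1 + \<alpha>) + (1 + \<alpha>) * x powr \<alpha> * (m + 1 - x)) \<le> \<theta> * (m + 1) powr (1 + \<alpha>)"
    using tangent[of x "m + 1"] x(1) m \<theta> by (intro mult_left_mono) auto
  ultimately show "0 \<le> D" unfolding D_def x_def[symmetric] x(2,3) by (simp add: algebra_simps)
  have "(1 - \<theta>) * (m powr (1 + \<alpha>) + (1 + \<alpha>) * m powr \<alpha> * (x - m)) \<le> (1 - \<theta>) * x powr (1 + \<alpha>)"
    using tangent[of m x] x m \<theta> by (intro mult_left_mono) auto
  moreover have "\<theta> * ((m + 1) powr (1 + \<alpha>) + (1 + \<alpha>) * (m + 1) powr \<alpha> * (x - (m + 1))) \<le> \<theta> * x powr (1 + \<alpha>)"
    using tangent[of "m + 1" x] x m \<theta> by (intro mult_left_mono) auto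
  moreover have "x - m = \<theta>" "x - (m + 1) = - (1 - \<theta>)" by (auto simp: x_def)
  ultimately have "D \<le> (\<theta> * (1 - \<theta>)) * ((1 + \<alpha>) * ((m + 1) powr \<alpha> - m powr \<alpha>))"
    unfolding D_def x_def[symmetric] by (simp add: algebra_simps)
  also have "\<dots> \<le> 1 / 4 * (2 * (\<alpha> * m powr (\<alpha> - 1)))"
  proof (intro mult_mono)
    have "0 \<le> (2 * \<theta> - 1)\<^sup>2" by simp
    thus "\<theta> * (1 - \<theta>) \<le> 1 / 4" by (simp add: power2_eq_square algebra_simps)
    have "((m + 1) / m) powr \<alpha> \<le> 1 + \<alpha> * ((m + 1) / m - 1)"
      using m \<alpha> by (intro Bernoulli_powr_le) auto
    moreover have "m powr \<alpha> * ((m + 1) / m) powr \<alpha> = (m + 1) powr \<alpha>"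
      using m by (simp add: powr_divide)
    ultimately have "(m + 1) powr \<alpha> \<le> m powr \<alpha> * (1 + \<alpha> * ((m + 1) / m - 1))"
      by (metis mult_left_mono powr_ge_zero)
    also have "\<dots> = m powr \<alpha> + \<alpha> * m powr (\<alpha> - 1)"
      using m by (simp add: powr_diff field_simps)
    finally show "(m + 1) powr \<alpha> - m powr \<alpha> \<le> \<alpha> * m powr (\<alpha> - 1)" by simp
    show "0 \<le> (m + 1) powr \<alpha> - m powr \<alpha>"
      using m \<alpha> powr_mono2[of \<alpha> m "m + 1"] by simp
    thus "0 \<le> (1 + \<alpha>) * ((m + 1) powr \<alpha> - m powr \<alpha>)" using \<alpha> by simp
  qed (use \<alpha> in auto)
  finally show "D \<le> \<alpha> / 2 * m powr (\<alpha> - 1)" by simp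
qed

text \<open>As a function of x the quadrature value is piecewise linear with integer breakpoints,
  hence interpolates its grid values. The error splits into the grid errors and the interpolation
  error of the exact value.\<close>

lemma cq_kernel_error:
  assumes x: "1 \<le> x" "x \<le> real n"
  shows "\<bar>x powr (1 + \<alpha>) / Gamma (2 + \<alpha>) - (\<Sum>j<n. \<omega> j * max (x - real j) 0)\<bar> \<le> 2 * x powr (\<alpha> - 1)"
proof -
  define G where "G = Gamma (2 + \<alpha>)"
  have G: "1 \<le> G" unfolding G_def by (rule Gamma_bounds_1_2[OF \<alpha>])
  define m where "m = nat \<lfloor>x\<rfloor>"
  define \<theta> where "\<theta> = x - real m"
  have m: "0 < m" "real m \<le> x" "x < real m + 1"
    using x(1) by (auto simp: m_def le_nat_iff)
  have \<theta>: "0 \<le> \<theta>" "\<theta> \<le> 1" "real m + \<theta> = x" using m by (auto simp: \<theta>_def)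
  \<comment> \<open>One term more than in the statement, since the right node \<open>Suc m\<close>
    can be n + 1; the extra term vanishes at x <= n.\<close>
  define S where "S y = (\<Sum>j<Suc n. \<omega> j * max (y - real j) 0)" for y
  have S_nat: "S (real l) = (\<Sum>j<l. \<omega> j * (real l - real j))" if "l \<le> Suc n" for l
  proof -
    have "(\<Sum>j<l. \<omega> j * (real l - real j)) = (\<Sum>j<l. \<omega> j * max (real l - real j) 0)"
      by (intro sum.cong) auto
    also have "\<dots> = S (real l)"
      unfolding S_def using that by (intro sum.mono_neutral_left) auto
    finally show ?thesis by simp
  qed
  have "S x = (1 - \<theta>) * S (real m) + \<theta> * S (real (Suc m))"
  proof -
    have "max (x - real j) 0 = (1 - \<theta>) * max (real m - real j) 0 + \<theta> * max (real (Suc m) - real j) 0" for j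
    proof (cases j m rule: linorder_cases)
      case less
      hence "1 \<le> real m - real j" by linarith
      thus ?thesis using \<theta> by (simp add: max_absorb1 algebra_simps)
    next
      case greater
      hence "real m + 1 \<le> real j" by linarith
      thus ?thesis using \<theta> by (simp add: max_absorb2)
    qed (use \<theta> in auto)
    note eq = this
    have "\<omega> j * max (x - real j) 0 =
        (1 - \<theta>) * (\<omega> j * max (real m - real j) 0) + \<theta> * (\<omega> j * max (real (Suc m) - real j) 0)" for j
      unfolding eq[of j] by (simp add: distrib_left mult.left_commute)
    thus ?thesis unfolding S_def sum_distrib_left sum.distrib[symmetric] by (intro sum.cong refl)
  qed
  hence Sx: "G * S x = (1 - \<theta>) * (G * S (real m)) + \<theta> * (G * S (real (Suc m)))"
    by (simp only: distrib_left mult.left_commute)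
  have "m \<le> n" using m(2) x(2) by linarith
  hence l: "m \<le> Suc n" "Suc m \<le> Suc n" by auto
  define p where "p = real m powr (\<alpha> - 1)"
  have C: "0 \<le> ramp_const" using \<alpha> by (simp add: ramp_const_def)
  have "real (Suc m) powr (\<alpha> - 1) \<le> p"
    unfolding p_def using m \<alpha> by (intro powr_mono2') auto
  hence Cp: "ramp_const * real (Suc m) powr (\<alpha> - 1) \<le> ramp_const * p" by (rule mult_left_mono[OF _ C])
  have b1: "\<bar>G * S (real m) - real m powr (1 + \<alpha>)\<bar> \<le> ramp_const * p"
    using ramp_sum_upper[OF m(1)] ramp_sum_lower[OF m(1)] unfolding S_nat[OF l(1)] G_def p_def by linarith
  have b2: "\<bar>G * S (real (Suc m)) - real (Suc m) powr (1 + \<alpha>)\<bar> \<le> ramp_const * p"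
    using ramp_sum_upper[of "Suc m"] ramp_sum_lower[of "Suc m"] Cp unfolding S_nat[OF l(2)] G_def by linarith
  have "(1 - \<theta>) * \<bar>G * S (real m) - real m powr (1 + \<alpha>)\<bar> + \<theta> * \<bar>G * S (real (Suc m)) - real (Suc m) powr (1 + \<alpha>)\<bar>
      \<le> (1 - \<theta>) * (ramp_const * p) + \<theta> * (ramp_const * p)"
    using b1 b2 \<theta> by (intro add_mono mult_left_mono) auto
  moreover have "\<bar>(1 - \<theta>) * (G * S (real m) - real m powr (1 + \<alpha>)) + \<theta> * (G * S (real (Suc m)) - real (Suc m) powr (1 + \<alpha>))\<bar>
      \<le> (1 - \<theta>) * \<bar>G * S (real m) - real m powr (1 + \<alpha>)\<bar> + \<theta> * \<bar>G * S (real (Suc m)) - real (Suc m) powr (1 + \<alpha>)\<bar>"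
    using \<theta> by (intro order.trans[OF abs_triangle_ineq]) (simp add: abs_mult)
  ultimately have "\<bar>(1 - \<theta>) * (G * S (real m) - real m powr (1 + \<alpha>)) + \<theta> * (G * S (real (Suc m)) - real (Suc m) powr (1 + \<alpha>))\<bar>
      \<le> ramp_const * p" by (simp add: algebra_simps)
  moreover have "0 \<le> (1 - \<theta>) * real m powr (1 + \<alpha>) + \<theta> * (real m + 1) powr (1 + \<alpha>) - x powr (1 + \<alpha>)"
    "(1 - \<theta>) * real m powr (1 + \<alpha>) + \<theta> * (real m + 1) powr (1 + \<alpha>) - x powr (1 + \<alpha>) \<le> \<alpha> / 2 * p"
    using powr_interp_bounds[of "real m" \<theta>] m(1) \<theta> by (simp_all add: p_def)
  ultimately have "\<bar>x powr (1 + \<alpha>) - G * S x\<bar> \<le> ramp_const * p + \<alpha> / 2 * p"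
    unfolding Sx by (simp add: algebra_simps)
  also have "\<dots> = (ramp_const + \<alpha> / 2) * p" by (simp add: algebra_simps)
  \<comment> \<open>From x <= 2m and 2^(1-\<alpha>) <= 2 - \<alpha>.\<close>
  also have "p \<le> (2 - \<alpha>) * x powr (\<alpha> - 1)"
  proof -
    have "1 \<le> real m" using m(1) by simp
    hence "x / 2 \<le> real m" using m(3) by linarith
    hence "p \<le> (x / 2) powr (\<alpha> - 1)"
      unfolding p_def using x \<alpha> by (intro powr_mono2') linarith+
    also have "\<dots> = 2 powr (1 - \<alpha>) * x powr (\<alpha> - 1)"
      using x by (simp add: powr_divide powr_diff field_simps)
    also have "\<dots> \<le> (2 - \<alpha>) * x powr (\<alpha> - 1)"
      using Bernoulli_powr_le[of "1 - \<alpha>" 2] \<alpha> by (intro mult_right_mono) auto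
    finally show ?thesis .
  qed
  hence "(ramp_const + \<alpha> / 2) * p \<le> (ramp_const + \<alpha> / 2) * ((2 - \<alpha>) * x powr (\<alpha> - 1))"
    using C \<alpha> by (intro mult_left_mono) auto
  also have "\<dots> \<le> 2 * x powr (\<alpha> - 1)"
    using mult_right_mono[OF ramp_const_bound, of "x powr (\<alpha> - 1)"] by (simp add: mult.assoc)
  finally have "\<bar>x powr (1 + \<alpha>) - G * S x\<bar> \<le> 2 * x powr (\<alpha> - 1)" .
  moreover have "\<bar>x powr (1 + \<alpha>) / G - S x\<bar> \<le> \<bar>x powr (1 + \<alpha>) - G * S x\<bar>"
  proof -
    have "x powr (1 + \<alpha>) - G * S x = G * (x powr (1 + \<alpha>) / G - S x)"
      using G by (simp add: field_simps)
    hence "\<bar>x powr (1 + \<alpha>) - G * S x\<bar> = G * \<bar>x powr (1 + \<alpha>) / G - S x\<bar>"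
      using G by (simp add: abs_mult)
    thus ?thesis using mult_right_mono[OF G, of "\<bar>x powr (1 + \<alpha>) / G - S x\<bar>"] by simp
  qed
  moreover have "S x = (\<Sum>j<n. \<omega> j * max (x - real j) 0)"
    unfolding S_def using x(2) by (simp add: max_absorb2)
  ultimately show ?thesis unfolding G_def by simp
qed

text \<open>On the first cell only \<open>\<omega> 0\<close> = (2/3)^\<alpha> acts; exact and
  quadrature value both lie in [0,1].\<close>

lemma cq_kernel_error_start:
  assumes x: "0 \<le> x" "x \<le> 1" and n: "0 < n"
  shows "\<bar>x powr (1 + \<alpha>) / Gamma (2 + \<alpha>) - (\<Sum>j<n. \<omega> j * max (x - real j) 0)\<bar> \<le> 1"
proof -
  have G: "1 \<le> Gamma (2 + \<alpha>)" by (rule Gamma_bounds_1_2[OF \<alpha>])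
  have "(\<Sum>j<n. \<omega> j * max (x - real j) 0) = (\<Sum>j\<in>{0}. \<omega> j * max (x - real j) 0)"
    using n x by (intro sum.mono_neutral_right) (auto simp: max_def)
  also have "\<dots> = (2/3) powr \<alpha> * x"
    using x cq_weights_eq[OF \<omega>, of 0] by (simp add: shifted_weight_def)
  finally have eq: "(\<Sum>j<n. \<omega> j * max (x - real j) 0) = (2/3) powr \<alpha> * x" .
  have "x powr (1 + \<alpha>) \<le> 1" using x \<alpha> by (intro powr_le1) auto
  hence "x powr (1 + \<alpha>) / Gamma (2 + \<alpha>) \<le> 1" "0 \<le> x powr (1 + \<alpha>) / Gamma (2 + \<alpha>)"
    using G by (auto simp: divide_le_eq)
  moreover have "(2/3) powr \<alpha> \<le> (1::real)" using \<alpha> by (intro powr_le1) auto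
  hence "(2/3) powr \<alpha> * x \<le> 1 * 1" using x by (intro mult_mono) auto
  moreover have "0 \<le> (2/3) powr \<alpha> * x" using x by simp
  ultimately show ?thesis unfolding eq by linarith
qed

end

section \<open>Positivity of the discrete convolutions\<close>

definition positive_weights :: "(nat \<Rightarrow> real) \<Rightarrow> bool" where
  "positive_weights w \<longleftrightarrow> (\<forall>N a. 0 \<le> (\<Sum>n<N. \<Sum>l\<le>n. w (n - l) * (a l * a n)))"

text \<open>
  Schur's product theorem by elimination: the rank-one form \<open>M\<^sub>i\<^sub>p M\<^sub>p\<^sub>j / M\<^sub>p\<^sub>p\<close> is split off
  from \<open>M\<close>, and the Schur complement is again positive semidefinite.
\<close>

lemma schur_product_nonneg:
  fixes K M :: "'i \<Rightarrow> 'i \<Rightarrow> real"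
  assumes "finite I"
    and sym: "\<And>i j. i \<in> I \<Longrightarrow> j \<in> I \<Longrightarrow> M i j = M j i"
    and M: "\<And>a. 0 \<le> (\<Sum>i\<in>I. \<Sum>j\<in>I. M i j * (a i * a j))"
    and K: "\<And>a. 0 \<le> (\<Sum>i\<in>I. \<Sum>j\<in>I. K i j * (a i * a j))"
  shows "0 \<le> (\<Sum>i\<in>I. \<Sum>j\<in>I. K i j * M i j)"
  using assms
proof (induction I arbitrary: M rule: finite_induct)
  case (insert p J)
  note sym = insert.prems(1) and M = insert.prems(2) and K = insert.prems(3)
  have expand: "(\<Sum>i\<in>insert p J. \<Sum>j\<in>insert p J. f i j) =
      f p p + (\<Sum>j\<in>J. f p j) + (\<Sum>i\<in>J. f i p) + (\<Sum>i\<in>J. \<Sum>j\<in>J. f i j)" for f :: "'i \<Rightarrow> 'i \<Rightarrow> real"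
    using insert.hyps by (simp add: sum.distrib)
  have upd: "(\<Sum>i\<in>insert p J. \<Sum>j\<in>insert p J. L i j * ((a(p := x)) i * (a(p := x)) j)) =
      L p p * x\<^sup>2 + x * (\<Sum>j\<in>J. (L p j + L j p) * a j) + (\<Sum>i\<in>J. \<Sum>j\<in>J. L i j * (a i * a j))"
    for L :: "'i \<Rightarrow> 'i \<Rightarrow> real" and a x
  proof -
    have "(\<Sum>j\<in>J. L p j * (x * (a(p := x)) j)) = (\<Sum>j\<in>J. L p j * (x * a j))"
      "(\<Sum>i\<in>J. L i p * ((a(p := x)) i * x)) = (\<Sum>i\<in>J. L i p * (a i * x))"
      "(\<Sum>i\<in>J. \<Sum>j\<in>J. L i j * ((a(p := x)) i * (a(p := x)) j)) = (\<Sum>i\<in>J. \<Sum>j\<in>J. L i j * (a i * a j))"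
      using insert.hyps by (intro sum.cong refl; auto)+
    thus ?thesis
      unfolding expand by (simp add: sum_distrib_left sum.distrib algebra_simps power2_eq_square)
  qed
  have symJ: "M p j + M j p = 2 * M p j" if "j \<in> J" for j using sym[of p j] that by simp
  have form: "0 \<le> M p p * x\<^sup>2 + 2 * x * (\<Sum>j\<in>J. M p j * a j) + (\<Sum>i\<in>J. \<Sum>j\<in>J. M i j * (a i * a j))" for a x
  proof -
    have "(\<Sum>j\<in>J. (M p j + M j p) * a j) = 2 * (\<Sum>j\<in>J. M p j * a j)"
      unfolding sum_distrib_left by (intro sum.cong) (simp_all add: symJ)
    thus ?thesis using M[of "a(p := x)"] unfolding upd by simp
  qed
  have KJ: "0 \<le> (\<Sum>i\<in>J. \<Sum>j\<in>J. K i j * (a i * a j))" for a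
    using K[of "a(p := 0)"] unfolding upd by simp
  have Mpp: "0 \<le> M p p" using form[of 1 "\<lambda>_. 0"] by simp
  \<comment> \<open>Division by 0 yields 0, so for a vanishing pivot nothing is split off and M' is
    M.\<close>
  define c where "c = 1 / M p p"
  define M' where "M' i j = M i j - c * (M p i * M p j)" for i j
  have sym': "M' i j = M' j i" if "i \<in> J" "j \<in> J" for i j
    using sym[of i j] that by (simp add: M'_def)
  have zero: "M p j = 0" if "M p p = 0" "j \<in> J" for j
  proof (rule ccontr)
    assume nz: "M p j \<noteq> 0"
    define a :: "'i \<Rightarrow> real" where "a i = (if i = j then 1 else 0)" for i
    have "(\<Sum>l\<in>J. M p l * a l) = M p j"
      unfolding a_def using insert.hyps that by (simp add: if_distrib cong: if_cong)
    moreover have "(\<Sum>i\<in>J. \<Sum>l\<in>J. M i l * (a i * a l)) = M j j"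
    proof -
      have "(\<Sum>l\<in>J. M i l * (a i * a l)) = (\<Sum>l\<in>J. if l = j then a i * M i j else 0)" for i
        unfolding a_def by (intro sum.cong) auto
      hence "(\<Sum>i\<in>J. \<Sum>l\<in>J. M i l * (a i * a l)) = (\<Sum>i\<in>J. if i = j then M j j else 0)"
        using insert.hyps that by (intro sum.cong) (auto simp: a_def)
      thus ?thesis using insert.hyps that by simp
    qed
    ultimately have "0 \<le> 2 * x * M p j + M j j" for x
      using form[of x a] that by simp
    \<comment> \<open>With zero pivot the form is affine in x; this x gives it the value -1.\<close>
    from this[of "(- 1 - M j j) / (2 * M p j)"] nz show False by (simp add: field_simps)
  qed
  have M': "0 \<le> (\<Sum>i\<in>J. \<Sum>j\<in>J. M' i j * (a i * a j))" for a
  proof -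
    define s where "s = (\<Sum>j\<in>J. M p j * a j)"
    have "(\<Sum>i\<in>J. \<Sum>j\<in>J. (M p i * M p j) * (a i * a j)) = s\<^sup>2"
      unfolding s_def power2_eq_square sum_product by (simp add: mult_ac)
    moreover have "(\<Sum>i\<in>J. \<Sum>j\<in>J. M' i j * (a i * a j)) =
        (\<Sum>i\<in>J. \<Sum>j\<in>J. M i j * (a i * a j)) - c * (\<Sum>i\<in>J. \<Sum>j\<in>J. (M p i * M p j) * (a i * a j))"
      unfolding sum_distrib_left sum_subtractf[symmetric]
      by (intro sum.cong refl) (simp add: M'_def algebra_simps)
    ultimately have "(\<Sum>i\<in>J. \<Sum>j\<in>J. M' i j * (a i * a j)) = (\<Sum>i\<in>J. \<Sum>j\<in>J. M i j * (a i * a j)) - c * s\<^sup>2"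
      by simp
    also have "\<dots> \<ge> 0"
    proof (cases "M p p = 0")
      case True
      thus ?thesis using form[of 0 a] by (simp add: c_def)
    next
      case False
      have "M p p * (- s / M p p)\<^sup>2 + 2 * (- s / M p p) * s = - (c * s\<^sup>2)"
        using False by (simp add: c_def field_simps power2_eq_square)
      thus ?thesis using form[of "- s / M p p" a] unfolding s_def[symmetric] by simp
    qed
    finally show ?thesis .
  qed
  have row: "M p j = c * (M p p * M p j)" "M j p = c * (M p j * M p p)" if "j \<in> J" for j
    using zero[of j] sym[of j p] that by (auto simp: c_def)
  have row0: "M p p = c * (M p p * M p p)" by (auto simp: c_def)
  have "(\<Sum>i\<in>insert p J. \<Sum>j\<in>insert p J. K i j * M i j) =
      c * (\<Sum>i\<in>insert p J. \<Sum>j\<in>insert p J. K i j * (M p i * M p j)) + (\<Sum>i\<in>J. \<Sum>j\<in>J. K i j * M' i j)"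
  proof -
    have "(\<Sum>j\<in>J. K p j * M p j) = c * (\<Sum>j\<in>J. K p j * (M p p * M p j))"
      unfolding sum_distrib_left
      by (intro sum.cong refl trans[OF arg_cong[OF row(1), of _ "times (K p j)" for j] mult.left_commute])
    moreover have "(\<Sum>i\<in>J. K i p * M i p) = c * (\<Sum>i\<in>J. K i p * (M p i * M p p))"
      unfolding sum_distrib_left
      by (intro sum.cong refl trans[OF arg_cong[OF row(2), of _ "times (K j p)" for j] mult.left_commute])
    moreover have "K p p * M p p = c * (K p p * (M p p * M p p))"
      by (rule trans[OF arg_cong[OF row0, of "times (K p p)"] mult.left_commute])
    moreover have "(\<Sum>i\<in>J. \<Sum>j\<in>J. K i j * M i j) =
        c * (\<Sum>i\<in>J. \<Sum>j\<in>J. K i j * (M p i * M p j)) + (\<Sum>i\<in>J. \<Sum>j\<in>J. K i j * M' i j)"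
      unfolding sum_distrib_left sum.distrib[symmetric]
      by (intro sum.cong refl) (simp add: M'_def algebra_simps)
    ultimately show ?thesis unfolding expand by (simp only: distrib_left)
  qed
  also have "\<dots> \<ge> 0"
    using insert.IH[of M', OF sym' M' KJ] K[of "M p"] Mpp by (simp add: c_def)
  finally show ?case .
qed simp

text \<open>The Gram matrix of \<open>B (v l) \<bullet> v n\<close> is symmetric and positive
  semidefinite and plays the role of M. The weights, padded by zero above the diagonal, are the
  nonsymmetric factor K.\<close>

lemma positive_weights_form_nonneg:
  fixes D :: "'a::real_inner set"
  assumes w: "positive_weights w" and B: "positive_selfadjoint D B" and v: "\<And>n. v n \<in> D"
  shows "0 \<le> (\<Sum>n<N. \<Sum>l\<le>n. w (n - l) * (B (v l) \<bullet> v n))"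
proof -
  have D: "subspace D" and add: "\<And>x y. x \<in> D \<Longrightarrow> y \<in> D \<Longrightarrow> B (x + y) = B x + B y"
    and scale: "\<And>a x. x \<in> D \<Longrightarrow> B (a *\<^sub>R x) = a *\<^sub>R B x" and pos: "\<And>x. x \<in> D \<Longrightarrow> 0 \<le> B x \<bullet> x"
    using B unfolding positive_selfadjoint_def by blast+
  have sym: "B x \<bullet> y = x \<bullet> B y" if "x \<in> D" "y \<in> D" for x y
    using B that unfolding positive_selfadjoint_def adjoint_graph_def by blast
  have B0: "B 0 = 0" using scale[OF subspace_0[OF D], of 0] by simp
  have sum: "(\<Sum>i<n. a i *\<^sub>R v i) \<in> D \<and> B (\<Sum>i<n. a i *\<^sub>R v i) = (\<Sum>i<n. a i *\<^sub>R B (v i))" for a n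
    by (induction n) (auto simp: B0 add scale subspace_0[OF D] subspace_add[OF D] subspace_scale[OF D] v)
  define K where "K n l = (if l \<le> n then w (n - l) else 0)" for n l
  have K: "(\<Sum>n<N. \<Sum>l\<le>n. w (n - l) * f n l) = (\<Sum>n<N. \<Sum>l<N. K n l * f n l)" for f
  proof (rule sum.cong[OF refl])
    fix n assume "n \<in> {..<N}"
    thus "(\<Sum>l\<le>n. w (n - l) * f n l) = (\<Sum>l<N. K n l * f n l)"
      by (intro sum.mono_neutral_cong_left) (auto simp: K_def)
  qed
  have "0 \<le> (\<Sum>n<N. \<Sum>l<N. K n l * (B (v l) \<bullet> v n))"
  proof (rule schur_product_nonneg)
    show "0 \<le> (\<Sum>i<N. \<Sum>j<N. (B (v j) \<bullet> v i) * (a i * a j))" for a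
    proof -
      have "(\<Sum>i<N. \<Sum>j<N. (B (v j) \<bullet> v i) * (a i * a j)) = (\<Sum>j<N. a j *\<^sub>R B (v j)) \<bullet> (\<Sum>i<N. a i *\<^sub>R v i)"
        unfolding inner_sum_left inner_sum_right by (simp add: mult_ac)
      thus ?thesis using pos[of "\<Sum>i<N. a i *\<^sub>R v i"] sum[where n = N and a = a] by simp
    qed
    show "0 \<le> (\<Sum>i<N. \<Sum>j<N. K i j * (a i * a j))" for a
      using w unfolding positive_weights_def K[symmetric] by (simp add: mult.commute)
    show "B (v j) \<bullet> v i = B (v i) \<bullet> v j" for i j
      using sym[of "v j" "v i"] v by (simp add: inner_commute)
  qed simp
  thus ?thesis by (simp only: K)
qed

lemma Abel_sum_nonneg:
  fixes S :: "nat \<Rightarrow> real"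
  assumes S: "\<And>M. 0 \<le> (\<Sum>n<M. S n)" and q: "0 \<le> q" "q \<le> 1"
  shows "0 \<le> (\<Sum>n<N. q ^ n * S n)"
proof -
  \<comment> \<open>Strengthened for the induction: the weighted sum dominates its last weight times
    the plain partial sum.\<close>
  have "q ^ N * (\<Sum>n<N. S n) \<le> (\<Sum>n<N. q ^ n * S n)" for N
  proof (induction N)
    case (Suc N)
    have "q ^ Suc N * (\<Sum>n<Suc N. S n) \<le> q ^ N * (\<Sum>n<Suc N. S n)"
      using S[of "Suc N"] q by (intro mult_right_mono power_decreasing) auto
    also have "\<dots> \<le> (\<Sum>n<Suc N. q ^ n * S n)" using Suc by (simp add: distrib_left)
    finally show ?case .
  qed simp
  thus ?thesis using S[of N] q by (meson mult_nonneg_nonneg order_trans zero_le_power)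
qed

section \<open>Positivity from a generating function with nonnegative real part\<close>

lemma sum_move_inner:
  "(\<Sum>j\<in>J. \<Sum>m\<in>A. \<Sum>l\<in>B. \<Sum>n\<in>C. f j m l n) = (\<Sum>m\<in>A. \<Sum>l\<in>B. \<Sum>n\<in>C. \<Sum>j\<in>J. f j m l n)"
proof -
  have "(\<Sum>j\<in>J. \<Sum>m\<in>A. \<Sum>l\<in>B. \<Sum>n\<in>C. f j m l n) = (\<Sum>m\<in>A. \<Sum>j\<in>J. \<Sum>l\<in>B. \<Sum>n\<in>C. f j m l n)"
    by (rule sum.swap)
  also have "\<dots> = (\<Sum>m\<in>A. \<Sum>l\<in>B. \<Sum>j\<in>J. \<Sum>n\<in>C. f j m l n)"
    by (intro sum.cong refl sum.swap)
  also have "\<dots> = (\<Sum>m\<in>A. \<Sum>l\<in>B. \<Sum>n\<in>C. \<Sum>j\<in>J. f j m l n)"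
    by (intro sum.cong refl) (rule sum.swap)
  finally show ?thesis .
qed

text \<open>Orthogonality of the characters of the integers modulo M; |d| < M excludes nonzero
  multiples of M.\<close>

lemma sum_cis_roots:
  fixes d :: int
  assumes "0 < M" "\<bar>d\<bar> < int M"
  shows "(\<Sum>j<M. cis (2 * pi * real_of_int d / real M) ^ j) = (if d = 0 then of_nat M else 0)"
proof (cases "d = 0")
  case False
  let ?x = "cis (2 * pi * real_of_int d / real M)"
  have "?x ^ M = 1"
  proof -
    have "?x ^ M = cis (real M * (2 * pi * real_of_int d / real M))" by (simp only: Complex.DeMoivre)
    also have "real M * (2 * pi * real_of_int d / real M) = 2 * pi * real_of_int d" using assms(1) by simp
    finally show ?thesis using cis_multiple_2pi[of "real_of_int d"] by simp
  qed
  moreover have "?x \<noteq> 1"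
  proof
    assume "?x = 1"
    hence "cos (2 * pi * real_of_int d / real M) = 1" by (simp add: complex_eq_iff)
    then obtain n :: int where "2 * pi * real_of_int d / real M = real_of_int n * 2 * pi"
      using cos_one_2pi_int by auto
    hence "real_of_int d = real_of_int (n * int M)" using assms(1) by (simp add: field_simps)
    hence "d = n * int M" by (simp only: of_int_eq_iff)
    with False assms show False by (simp add: abs_mult)
  qed
  ultimately show ?thesis using False geometric_sum[of ?x M] by simp
qed simp

text \<open>Parseval on the circle of radius r < 1, with the integral replaced by an average over
  M-th roots of unity. The series is cut after K terms, M is too large for aliasing, the tail
  vanishes as K grows, and finally r tends to 1.\<close>

lemma positive_weights_if_Re_nonneg:
  fixes w :: "nat \<Rightarrow> real"
  assumes sums: "\<And>z::complex. norm z < 1 \<Longrightarrow> (\<lambda>n. of_real (w n) * z ^ n) sums F z"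
    and Re: "\<And>z. norm z < 1 \<Longrightarrow> 0 \<le> Re (F z)"
  shows "positive_weights w"
  unfolding positive_weights_def
proof (intro allI)
  fix N :: nat and a :: "nat \<Rightarrow> real"
  define A where "A = (\<Sum>n<N. \<bar>a n\<bar>)"
  have r_case: "0 \<le> (\<Sum>n<N. \<Sum>l\<le>n. w (n - l) * r ^ (n - l) * (a l * a n))" if r: "0 < r" "r < 1" for r
  proof -
    define c where "c m = w m * r ^ m" for m
    have summ: "summable (\<lambda>m. \<bar>c m\<bar>)"
    proof -
      define s where "s = (1 + r) / 2"
      have s: "r < s" "s < 1" using r by (auto simp: s_def)
      have "summable (\<lambda>n. norm (of_real (w n) * (of_real r :: complex) ^ n))"
        using s r by (intro powser_insidea[OF sums_summable[OF sums[of "of_real s"]]]) auto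
      thus ?thesis using r by (simp add: c_def norm_mult norm_power abs_mult)
    qed
    have key: "- (A\<^sup>2 * (\<Sum>m. \<bar>c (m + K)\<bar>)) \<le> (\<Sum>n<N. \<Sum>l\<le>n. c (n - l) * (a l * a n))" if K: "N \<le> K" for K
    proof -
      \<comment> \<open>All frequencies m + l - n lie strictly between -M and M, so only m + l = n
        survives the average.\<close>
      define M where "M = Suc (K + N)"
      define x where "x j d = cis (2 * pi * real_of_int d / real M) ^ j" for j :: nat and d :: int
      have x_add: "x j (d + e) = x j d * x j e" for j d e
        by (simp add: x_def power_mult_distrib[symmetric] cis_mult add_divide_distrib distrib_left)
      have x_cnj: "cnj (x j d) = x j (- d)" for j d by (simp add: x_def cis_cnj)
      have x_norm: "norm (x j d) = 1" for j d by (simp add: x_def norm_power)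
      have x_pow: "x j 1 ^ m = x j (int m)" for j m
      proof (induction m)
        case (Suc m)
        have "x j 1 ^ Suc m = x j (int m) * x j 1" using Suc by simp
        also have "\<dots> = x j (int m + 1)" by (rule x_add[symmetric])
        finally show ?case by (simp add: add.commute)
      qed (simp add: x_def)
      define FK where "FK j = (\<Sum>m<K. of_real (c m) * x j (int m))" for j
      define p where "p j = (\<Sum>n<N. of_real (a n) * x j (int n))" for j
      have "(\<Sum>j<M. FK j * (p j * cnj (p j))) = of_nat M * of_real (\<Sum>n<N. \<Sum>l\<le>n. c (n - l) * (a l * a n))"
      proof -
        have "FK j * (p j * cnj (p j)) =
            (\<Sum>m<K. \<Sum>l<N. \<Sum>n<N. of_real (c m * (a l * a n)) * x j (int m + int l - int n))" for j
        proof -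
          have split: "x j (int m + int l - int n) = x j (int m) * x j (int l) * x j (- int n)" for m l n
            by (simp add: x_add[symmetric])
          have cnj: "cnj (p j) = (\<Sum>n<N. of_real (a n) * x j (- int n))" by (simp add: p_def x_cnj)
          have "FK j * (p j * cnj (p j)) = (\<Sum>m<K. \<Sum>l<N. \<Sum>n<N. of_real (c m) * x j (int m) *
              ((of_real (a l) * x j (int l)) * (of_real (a n) * x j (- int n))))"
            unfolding cnj FK_def sum_distrib_right
            unfolding p_def sum_product unfolding sum_distrib_left by (rule refl)
          moreover have "of_real (c m) * x j (int m) * ((of_real (a l) * x j (int l)) * (of_real (a n) * x j (- int n))) =
              of_real (c m * (a l * a n)) * x j (int m + int l - int n)" for m l n
            by (simp add: split mult_ac)
          ultimately show ?thesis by (simp only:)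
        qed
        hence "(\<Sum>j<M. FK j * (p j * cnj (p j))) =
            (\<Sum>j<M. \<Sum>m<K. \<Sum>l<N. \<Sum>n<N. of_real (c m * (a l * a n)) * x j (int m + int l - int n))"
          by simp
        also have "\<dots> = (\<Sum>m<K. \<Sum>l<N. \<Sum>n<N. of_real (c m * (a l * a n)) * (\<Sum>j<M. x j (int m + int l - int n)))"
          unfolding sum_distrib_left by (rule sum_move_inner)
        also have "\<dots> = (\<Sum>m<K. \<Sum>l<N. \<Sum>n<N. if n = m + l then of_nat M * of_real (c m * (a l * a n)) else 0)"
        proof (intro sum.cong refl)
          fix m l n assume "m \<in> {..<K}" "l \<in> {..<N}" "n \<in> {..<N}"
          hence "\<bar>int m + int l - int n\<bar> < int M" by (auto simp: M_def)
          hence "(\<Sum>j<M. x j (int m + int l - int n)) = (if int m + int l - int n = 0 then of_nat M else 0)"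
            unfolding x_def by (intro sum_cis_roots) (auto simp: M_def)
          moreover have "int m + int l - int n = 0 \<longleftrightarrow> n = m + l" by linarith
          ultimately show "of_real (c m * (a l * a n)) * (\<Sum>j<M. x j (int m + int l - int n)) =
              (if n = m + l then of_nat M * of_real (c m * (a l * a n)) else 0)" by simp
        qed
        also have "\<dots> = (\<Sum>n<N. \<Sum>l<N. \<Sum>m<K. if n = m + l then of_nat M * of_real (c m * (a l * a n)) else 0)"
          by (rule trans[OF sum_move_inner[where A = "{..<N}" and B = "{..<N}" and C = "{()}", simplified] sum.swap])
        also have "\<dots> = (\<Sum>n<N. \<Sum>l\<le>n. of_nat M * of_real (c (n - l) * (a l * a n)))"
        proof (rule sum.cong[OF refl])
          fix n assume n: "n \<in> {..<N}"
          have "(\<Sum>l<N. \<Sum>m<K. if n = m + l then of_nat M * of_real (c m * (a l * a n)) else 0) =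
              (\<Sum>l<N. if l \<le> n then of_nat M * of_real (c (n - l) * (a l * a n)) else (0::complex))"
          proof (rule sum.cong[OF refl])
            fix l assume "l \<in> {..<N}"
            show "(\<Sum>m<K. if n = m + l then of_nat M * of_real (c m * (a l * a n)) else 0) =
              (if l \<le> n then of_nat M * of_real (c (n - l) * (a l * a n)) else (0::complex))"
            proof (cases "l \<le> n")
              case True
              hence "n = m + l \<longleftrightarrow> m = n - l" for m by auto
              thus ?thesis using True n K by (simp add: if_distrib cong: if_cong)
            qed auto
          qed
          also have "\<dots> = (\<Sum>l\<le>n. of_nat M * of_real (c (n - l) * (a l * a n)))"
            using n by (intro sum.mono_neutral_cong_right) auto
          finally show "(\<Sum>l<N. \<Sum>m<K. if n = m + l then of_nat M * of_real (c m * (a l * a n)) else 0) =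
              (\<Sum>l\<le>n. of_nat M * of_real (c (n - l) * (a l * a n)) :: complex)" .
        qed
        finally show ?thesis by (simp add: sum_distrib_left)
      qed
      hence "real M * (\<Sum>n<N. \<Sum>l\<le>n. c (n - l) * (a l * a n)) = Re (\<Sum>j<M. FK j * (p j * cnj (p j)))"
        by simp
      also have "\<dots> = (\<Sum>j<M. Re (FK j) * (norm (p j))\<^sup>2)"
        by (simp add: complex_norm_square[symmetric] del: of_real_power)
      also have "\<dots> \<ge> (\<Sum>j<M. - (A\<^sup>2 * (\<Sum>m. \<bar>c (m + K)\<bar>)))"
      proof (rule sum_mono)
        fix j
        define z where "z = of_real r * x j 1"
        have z: "norm z < 1" using r by (simp add: z_def norm_mult x_norm)
        define e where "e = (\<Sum>m. \<bar>c (m + K)\<bar>)"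
        have e: "0 \<le> e" unfolding e_def by (intro suminf_nonneg summable_ignore_initial_segment[OF summ]) auto
        have summand: "of_real (w m) * z ^ m = of_real (c m) * x j (int m)" for m
          by (simp add: z_def c_def power_mult_distrib x_pow)
        have summ': "summable (\<lambda>m. norm (of_real (w m) * z ^ m))"
          unfolding summand using summ by (simp add: norm_mult x_norm)
        have "F z = (\<Sum>m. of_real (w (m + K)) * z ^ (m + K)) + FK j"
          using suminf_split_initial_segment[OF summable_norm_cancel[OF summ'], of K] sums[OF z]
          unfolding FK_def by (simp add: sums_iff summand)
        moreover have "norm (\<Sum>m. of_real (w (m + K)) * z ^ (m + K)) \<le> (\<Sum>m. norm (of_real (w (m + K)) * z ^ (m + K)))"
          using summ' by (intro summable_norm) (simp add: summable_iff_shift[of "\<lambda>m. norm (of_real (w m) * z ^ m)"])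
        moreover have "norm (of_real (w (m + K)) * z ^ (m + K)) = \<bar>c (m + K)\<bar>" for m
          unfolding summand by (simp add: norm_mult x_norm)
        ultimately have "norm (F z - FK j) \<le> e" by (simp add: e_def)
        hence "Re (F z - FK j) \<le> e" by (meson complex_Re_le_cmod order_trans)
        hence FK: "- e \<le> Re (FK j)" using Re[OF z] by simp
        have "norm (p j) \<le> (\<Sum>n<N. norm (of_real (a n) * x j (int n)))" unfolding p_def by (rule norm_sum)
        hence "norm (p j) \<le> A" by (simp add: A_def norm_mult x_norm)
        hence "e * (norm (p j))\<^sup>2 \<le> e * A\<^sup>2" using e by (intro mult_left_mono power_mono) auto
        moreover have "- e * (norm (p j))\<^sup>2 \<le> Re (FK j) * (norm (p j))\<^sup>2" using FK by (intro mult_right_mono) auto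
        ultimately show "- (A\<^sup>2 * (\<Sum>m. \<bar>c (m + K)\<bar>)) \<le> Re (FK j) * (norm (p j))\<^sup>2"
          unfolding e_def[symmetric] by (simp add: mult.commute)
      qed
      finally have "real M * - (A\<^sup>2 * (\<Sum>m. \<bar>c (m + K)\<bar>)) \<le> real M * (\<Sum>n<N. \<Sum>l\<le>n. c (n - l) * (a l * a n))"
        by simp
      thus ?thesis by (subst (asm) mult_le_cancel_left_pos) (auto simp: M_def)
    qed
    have "(\<lambda>K. \<Sum>m. \<bar>c (m + K)\<bar>) \<longlonglongrightarrow> 0"
      by (rule suminf_exist_split2[OF summ])
    hence "(\<lambda>K. - (A\<^sup>2 * (\<Sum>m. \<bar>c (m + K)\<bar>))) \<longlonglongrightarrow> - (A\<^sup>2 * 0)" by (intro tendsto_intros)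
    hence "- (A\<^sup>2 * 0) \<le> (\<Sum>n<N. \<Sum>l\<le>n. c (n - l) * (a l * a n))"
      by (rule tendsto_upperbound) (use key in \<open>auto intro!: eventually_sequentiallyI[of N]\<close>)
    thus ?thesis by (simp add: c_def)
  qed
  \<comment> \<open>For fixed N the form is a polynomial in r, so nonnegativity passes to r =
    1.\<close>
  have "((\<lambda>r. \<Sum>n<N. \<Sum>l\<le>n. w (n - l) * r ^ (n - l) * (a l * a n)) \<longlongrightarrow>
      (\<Sum>n<N. \<Sum>l\<le>n. w (n - l) * 1 ^ (n - l) * (a l * a n))) (at_left 1)"
    by (intro tendsto_intros)
  moreover have "\<forall>\<^sub>F r in at_left (1::real). 0 \<le> (\<Sum>n<N. \<Sum>l\<le>n. w (n - l) * r ^ (n - l) * (a l * a n))"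
    using eventually_at_left_field[of _ "1::real"] r_case by (auto intro!: exI[of _ 0])
  ultimately show "0 \<le> (\<Sum>n<N. \<Sum>l\<le>n. w (n - l) * (a l * a n))"
    using tendsto_lowerbound[of _ _ "at_left (1::real)" 0] by simp
qed

text \<open>A-stability of BDF2: its symbol (3 - z)(1 - z)/2 has positive real part in the disc, so
  the power -\<alpha> has argument of size at most \<alpha> pi/2.\<close>

lemma cq_weights_positive:
  assumes \<alpha>: "0 < \<alpha>" "\<alpha> < 1" and \<omega>: "cq_weights \<alpha> \<omega>"
  shows "positive_weights \<omega>"
proof -
  define F where "F z = of_real ((2/3) powr \<alpha>) * ((1 - z / 3) powr of_real (- \<alpha>) * (1 - z) powr of_real (- \<alpha>))" for z :: complex
  show ?thesis
  proof (rule positive_weights_if_Re_nonneg)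
    fix z :: complex assume z: "norm z < 1"
    define s where "s = (1 + norm z) / 2"
    have s: "norm z < s" "s < 1" using z by (auto simp: s_def)
    have s0: "0 < s" using s(1) norm_ge_zero[of z] by linarith
    have h: "(\<lambda>n. of_real (shifted_weight \<alpha> n) * w ^ n) sums (of_real ((2/3) powr \<alpha>) * (1 - w / 3) powr of_real (- \<alpha>))"
      if "norm w < 1" for w :: complex
      using sums_mult[OF nb_coeff_sums_complex[of "w / 3" \<alpha>], of "of_real ((2/3) powr \<alpha>)"] that
      by (simp add: shifted_weight_def norm_divide power_divide mult_ac)
    have "summable (\<lambda>n. norm (of_real (shifted_weight \<alpha> n) * z ^ n))" "summable (\<lambda>n. norm (of_real (nb_coeff \<alpha> n) * z ^ n))"
      using powser_insidea[OF sums_summable[OF h[of "of_real s"]], of z]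
        powser_insidea[OF sums_summable[OF nb_coeff_sums_complex[of "of_real s" \<alpha>]], of z] s s0 by auto
    from Cauchy_product_sums[OF this]
    have "(\<lambda>n. \<Sum>i\<le>n. (of_real (shifted_weight \<alpha> i) * z ^ i) * (of_real (nb_coeff \<alpha> (n - i)) * z ^ (n - i))) sums F z"
      using h[OF z] nb_coeff_sums_complex[OF z, of \<alpha>] by (simp add: sums_iff F_def)
    moreover have "(\<Sum>i\<le>n. (of_real (shifted_weight \<alpha> i) * z ^ i) * (of_real (nb_coeff \<alpha> (n - i)) * z ^ (n - i))) =
        of_real (\<omega> n) * z ^ n" for n
      unfolding cq_weights_eq[OF \<omega>] of_real_sum sum_distrib_right
      by (intro sum.cong refl) (simp add: power_add[symmetric] mult_ac)
    ultimately show "(\<lambda>n. of_real (\<omega> n) * z ^ n) sums F z" by simp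
  next
    fix z :: complex assume z: "norm z < 1"
    define w1 w2 where "w1 = 1 - z / 3" and "w2 = 1 - z"
    have z2: "(Re z)\<^sup>2 + (Im z)\<^sup>2 < 1" using z by (simp add: cmod_def)
    have Rez: "\<bar>Re z\<bar> < 1" using abs_Re_le_cmod[of z] z by linarith
    have pos: "0 < Re w1" "0 < Re w2" using Rez by (auto simp: w1_def w2_def)
    hence nz: "w1 \<noteq> 0" "w2 \<noteq> 0" by auto
    have im: "\<bar>Im (Ln w1)\<bar> < pi / 2" "\<bar>Im (Ln w2)\<bar> < pi / 2" using pos Re_Ln_pos_lt_imp by auto
    \<comment> \<open>Both arguments are below pi/2 in size, so the principal logarithms add and the
      product of the two powers becomes a single exponential.\<close>
    have Ln: "Ln (w1 * w2) = Ln w1 + Ln w2"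
      using im nz by (intro Ln_times_simple) auto
    \<comment> \<open>For z = x + iy, inserting y^2 < 1 - x^2 bounds the real part strictly below by
      2/3 (1 - x)^2.\<close>
    have "0 < Re (w1 * w2)"
    proof -
      have "Re (w1 * w2) = 1 - 4/3 * Re z + ((Re z)\<^sup>2 - (Im z)\<^sup>2) / 3"
        by (simp add: w1_def w2_def algebra_simps power2_eq_square diff_divide_distrib add_divide_distrib)
      moreover have "0 \<le> 1 - 2 * Re z + (Re z)\<^sup>2"
        using zero_le_power2[of "1 - Re z"] by (simp add: power2_diff)
      hence "0 < 1 - 4/3 * Re z + ((Re z)\<^sup>2 - (Im z)\<^sup>2) / 3" using z2 by argo
      ultimately show ?thesis by (simp only:)
    qed
    hence "\<bar>Im (Ln w1 + Ln w2)\<bar> < pi / 2" using Re_Ln_pos_lt_imp Ln by metis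
    hence "\<alpha> * \<bar>Im (Ln w1 + Ln w2)\<bar> \<le> 1 * (pi / 2)" using \<alpha> by (intro mult_mono) auto
    hence ang: "\<bar>\<alpha> * Im (Ln w1 + Ln w2)\<bar> \<le> pi / 2" using \<alpha> by (simp add: abs_mult)
    have "w1 powr of_real (- \<alpha>) * w2 powr of_real (- \<alpha>) = exp (of_real (- \<alpha>) * (Ln w1 + Ln w2))"
      using nz by (simp add: powr_def exp_add[symmetric] distrib_left)
    hence "Re (w1 powr of_real (- \<alpha>) * w2 powr of_real (- \<alpha>)) =
        exp (- \<alpha> * Re (Ln w1 + Ln w2)) * cos (\<alpha> * Im (Ln w1 + Ln w2))"
      by (simp add: Re_exp)
    also have "\<dots> \<ge> 0"
      using ang by (intro mult_nonneg_nonneg cos_ge_zero) auto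
    finally show "0 \<le> Re (F z)" by (simp add: F_def w1_def w2_def)
  qed
qed

section \<open>Positivity of the interpolation weights from the kernel of positive type\<close>

lemma has_integral_reflect_shift:
  fixes f :: "real \<Rightarrow> 'a::real_normed_vector"
  assumes "(f has_integral I) {c - b..c - a}"
  shows "((\<lambda>x. f (c - x)) has_integral I) {a..b}"
proof -
  have "(f has_integral I) (cbox (c - b) (c - a))" using assms by simp
  from has_integral_affinity[OF this, of "-1" c]
  have "((\<lambda>x. f (c - x)) has_integral I) ((\<lambda>x. c - x) ` {c - b..c - a})" by (simp add: add.commute)
  thus ?thesis by (simp add: image_diff_atLeastAtMost)
qed

lemma integral_reflect_shift:
  fixes f :: "real \<Rightarrow> 'a::real_normed_vector"
  shows "integral {a..b} (\<lambda>x. f (c - x)) = integral {c - b..c - a} f"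
proof (cases "f integrable_on {c - b..c - a}")
  case True
  thus ?thesis by (intro integral_unique has_integral_reflect_shift integrable_integral)
next
  case False
  have "\<not> (\<lambda>x. f (c - x)) integrable_on {a..b}"
  proof
    assume "(\<lambda>x. f (c - x)) integrable_on {a..b}"
    then obtain I where "((\<lambda>x. f (c - x)) has_integral I) {c - (c - a)..c - (c - b)}" by auto
    from has_integral_reflect_shift[OF this] False show False by auto
  qed
  with False show ?thesis by (simp add: not_integrable_integral)
qed

text \<open>Fubini over the product of \<open>lborel\<close> with itself asks for Borel functions,
  while \<open>\<beta>\<close> is only Lebesgue measurable; a modification on a null set and
  extension by 0 repair this.\<close>

lemma abs_integrable_borel_version:
  fixes \<beta> :: "real \<Rightarrow> real"
  assumes \<beta>: "\<beta> absolutely_integrable_on {0<..}"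
  obtains B where "integrable lborel B" "\<And>x. x \<le> 0 \<Longrightarrow> B x = 0" "AE x in lborel. x \<in> {0<..} \<longrightarrow> \<beta> x = B x"
proof -
  define g where "g x = indicator {0<..} x * \<beta> x" for x
  have g: "integrable lebesgue g"
    using \<beta> by (simp add: set_integrable_def g_def[abs_def])
  obtain f where f: "f \<in> borel_measurable lborel" "AE x in lborel. g x = f x"
    using completion_ex_borel_measurable_real[of g lborel] g by auto
  define B where "B x = indicator {0<..} x * f x" for x
  have B: "B \<in> borel_measurable lborel" unfolding B_def[abs_def] using f(1) by measurable
  have ae: "AE x in lborel. g x = B x"
    using f(2) by eventually_elim (auto simp: g_def B_def indicator_def split: if_splits)
  have "integrable lebesgue B"
  proof (rule integrable_cong_AE_imp[OF g])
    show "B \<in> borel_measurable lebesgue" using B by (rule measurable_completion)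
    show "AE x in lebesgue. g x = B x" using ae by (rule AE_completion)
  qed
  hence "integrable lborel B" using B by (simp add: integrable_completion)
  moreover have "B x = 0" if "x \<le> 0" for x using that by (simp add: B_def)
  moreover have "AE x in lborel. x \<in> {0<..} \<longrightarrow> \<beta> x = B x"
    using ae by eventually_elim (auto simp: g_def)
  ultimately show ?thesis using that by blast
qed

lemma kernel_has_integral:
  fixes \<beta> B h :: "real \<Rightarrow> real"
  assumes B: "integrable lborel B" "\<And>x. x \<le> 0 \<Longrightarrow> B x = 0" "AE x in lborel. x \<in> {0<..} \<longrightarrow> \<beta> x = B x"
    and S: "S \<in> sets borel" "S \<subseteq> {0..}" and h: "h \<in> borel_measurable borel" "\<And>x. x \<in> S \<Longrightarrow> \<bar>h x\<bar> \<le> C"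
  shows "((\<lambda>x. \<beta> x * h x) has_integral (\<integral>x. B x * (indicator S x * h x) \<partial>lborel)) S"
proof -
  have [measurable]: "B \<in> borel_measurable borel" using B(1) by auto
  note [measurable] = h(1) S(1)
  have "integrable lborel (\<lambda>x. B x * (indicator S x * h x))"
  proof (rule Bochner_Integration.integrable_bound)
    show "integrable lborel (\<lambda>x. \<bar>C\<bar> * B x)" using B(1) by simp
    show "AE x in lborel. norm (B x * (indicator S x * h x)) \<le> norm (\<bar>C\<bar> * B x)"
    proof (rule AE_I2)
      fix x
      have "\<bar>indicator S x * h x\<bar> \<le> \<bar>C\<bar>" using h(2)[of x] by (auto simp: indicator_def)
      thus "norm (B x * (indicator S x * h x)) \<le> norm (\<bar>C\<bar> * B x)"
        using mult_left_mono[of "\<bar>indicator S x * h x\<bar>" "\<bar>C\<bar>" "\<bar>B x\<bar>"] by (simp add: abs_mult mult_ac)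
    qed
  qed measurable
  hence "((\<lambda>x. B x * (indicator S x * h x)) has_integral (\<integral>x. B x * (indicator S x * h x) \<partial>lborel)) UNIV"
    by (rule has_integral_integral_lborel)
  moreover have "AE x in lborel. x \<in> UNIV \<longrightarrow> B x * (indicator S x * h x) = (if x \<in> S then \<beta> x * h x else 0)"
    using B(3) AE_lborel_singleton[of 0]
    by eventually_elim (use S(2) in \<open>force simp: indicator_def\<close>)
  ultimately show ?thesis
    by (simp add: has_integral_AE has_integral_restrict_UNIV)
qed

text \<open>Fubini turns the quadratic form into the kernel integrated against the autocorrelation
  of the truncated test function; in this shape limits of test functions can be taken.\<close>

lemma kernel_double_integral:
  fixes \<beta> B \<phi> :: "real \<Rightarrow> real"
  assumes B: "integrable lborel B" "\<And>x. x \<le> 0 \<Longrightarrow> B x = 0" "AE x in lborel. x \<in> {0<..} \<longrightarrow> \<beta> x = B x"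
    and T: "0 < T" and \<phi>: "continuous_on UNIV \<phi>"
  defines "\<Phi> \<equiv> \<lambda>t. indicator {0..T} t * \<phi> t"
  shows "integral {0..T} (\<lambda>t. \<phi> t * integral {0..t} (\<lambda>s. \<beta> (t - s) * \<phi> s)) =
    (\<integral>x. B x * (\<integral>t. \<Phi> t * \<Phi> (t - x) \<partial>lborel) \<partial>lborel)"
proof -
  have "bounded (\<phi> ` {0..T})"
    using compact_continuous_image[of "{0..T}" \<phi>] \<phi> continuous_on_subset by (blast intro: compact_imp_bounded)
  then obtain C where "0 < C" "\<forall>t\<in>{0..T}. \<bar>\<phi> t\<bar> \<le> C" by (auto simp: bounded_pos)
  hence C: "\<And>t. t \<in> {0..T} \<Longrightarrow> \<bar>\<phi> t\<bar> \<le> C" "0 \<le> C" by auto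
  have [measurable]: "B \<in> borel_measurable borel" using B(1) by auto
  have [measurable]: "\<phi> \<in> borel_measurable borel" using \<phi> by (rule borel_measurable_continuous_onI)
  have [measurable]: "\<Phi> \<in> borel_measurable borel" unfolding \<Phi>_def by measurable
  have \<Phi>C: "\<bar>\<Phi> t\<bar> \<le> C" for t using C by (auto simp: \<Phi>_def indicator_def)
  have \<Phi>_int: "integrable lborel \<Phi>"
  proof (rule Bochner_Integration.integrable_bound)
    show "integrable lborel (\<lambda>t. C * indicator {0..T} t :: real)"
      by (intro integrable_mult_right integrable_real_indicator) (auto simp: emeasure_lborel_Icc_eq)
  qed (use C in \<open>auto simp: \<Phi>_def indicator_def\<close>)
  define f where "f x t = B x * (\<Phi> t * \<Phi> (t - x))" for x t
  have dom: "integrable (lborel \<Otimes>\<^sub>M lborel) (\<lambda>(x, t). \<bar>B x\<bar> * (C * \<bar>\<Phi> t\<bar>))"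
  proof (rule lborel_pair.Fubini_integrable)
    show "integrable lborel (\<lambda>x. \<integral>y. norm (case (x, y) of (x, t) \<Rightarrow> \<bar>B x\<bar> * (C * \<bar>\<Phi> t\<bar>)) \<partial>lborel)"
      using B(1) C(2) by (simp add: abs_mult)
  qed (use \<Phi>_int in auto)
  have f_int: "integrable (lborel \<Otimes>\<^sub>M lborel) (case_prod f)"
  proof (rule Bochner_Integration.integrable_bound[OF dom])
    show "case_prod f \<in> borel_measurable (lborel \<Otimes>\<^sub>M lborel)" unfolding f_def by measurable
    show "AE p in lborel \<Otimes>\<^sub>M lborel. norm (case_prod f p) \<le> norm (case p of (x, t) \<Rightarrow> \<bar>B x\<bar> * (C * \<bar>\<Phi> t\<bar>))"
      using \<Phi>C C(2) by (intro AE_I2) (auto simp: f_def abs_mult mult.commute[of C] intro!: mult_left_mono)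
  qed
  have inner: "integral {0..t} (\<lambda>s. \<beta> (t - s) * \<phi> s) = (\<integral>x. B x * \<Phi> (t - x) \<partial>lborel)" if t: "t \<in> {0..T}" for t
  proof -
    have "integral {0..t} (\<lambda>s. \<beta> (t - s) * \<phi> s) = integral {0..t} (\<lambda>x. \<beta> x * \<phi> (t - x))"
      using integral_reflect_shift[of 0 t "\<lambda>x. \<beta> x * \<phi> (t - x)" t] by simp
    also have "\<dots> = (\<integral>x. B x * (indicator {0..t} x * \<phi> (t - x)) \<partial>lborel)"
      using t C by (intro integral_unique kernel_has_integral[OF B, where C = C]) auto
    also have "\<dots> = (\<integral>x. B x * \<Phi> (t - x) \<partial>lborel)"
    proof (rule Bochner_Integration.integral_cong[OF refl])
      fix x show "B x * (indicator {0..t} x * \<phi> (t - x)) = B x * \<Phi> (t - x)"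
        using t B(2)[of x] by (cases "x \<le> 0") (auto simp: \<Phi>_def indicator_def)
    qed
    finally show ?thesis .
  qed
  define g where "g t = (\<integral>x. B x * \<Phi> (t - x) \<partial>lborel)" for t
  have snd: "(\<integral>x. f x t \<partial>lborel) = \<Phi> t * g t" for t
    unfolding f_def g_def by (subst Bochner_Integration.integral_mult_right_zero[symmetric]) (simp add: mult_ac)
  have "integrable lborel (\<lambda>t. \<integral>x. f x t \<partial>lborel)"
    by (rule lborel_pair.integrable_snd[OF f_int])
  hence "((\<lambda>t. \<Phi> t * g t) has_integral (\<integral>t. \<Phi> t * g t \<partial>lborel)) UNIV"
    unfolding snd by (rule has_integral_integral_lborel)
  moreover have "\<Phi> t * g t = (if t \<in> {0..T} then \<phi> t * integral {0..t} (\<lambda>s. \<beta> (t - s) * \<phi> s) else 0)" for t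
    using inner[of t] by (auto simp: g_def \<Phi>_def)
  ultimately have "((\<lambda>t. \<phi> t * integral {0..t} (\<lambda>s. \<beta> (t - s) * \<phi> s)) has_integral (\<integral>t. \<Phi> t * g t \<partial>lborel)) {0..T}"
    by (simp only: has_integral_restrict_UNIV)
  hence "integral {0..T} (\<lambda>t. \<phi> t * integral {0..t} (\<lambda>s. \<beta> (t - s) * \<phi> s)) = (\<integral>t. \<integral>x. f x t \<partial>lborel \<partial>lborel)"
    unfolding snd by (rule integral_unique)
  also have "\<dots> = (\<integral>x. \<integral>t. f x t \<partial>lborel \<partial>lborel)"
    by (rule lborel_pair.Fubini_integral[OF f_int])
  also have "\<dots> = (\<integral>x. B x * (\<integral>t. \<Phi> t * \<Phi> (t - x) \<partial>lborel) \<partial>lborel)"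
    unfolding f_def by simp
  finally show ?thesis .
qed

text \<open>\<open>positive_type\<close> speaks of continuous test functions. Step functions are
  reached as bounded pointwise limits, by dominated convergence first in the autocorrelation and
  then against the integrable B.\<close>

lemma positive_type_limit_nonneg:
  fixes \<beta> B g :: "real \<Rightarrow> real" and \<phi> :: "nat \<Rightarrow> real \<Rightarrow> real"
  assumes B: "integrable lborel B" "\<And>x. x \<le> 0 \<Longrightarrow> B x = 0" "AE x in lborel. x \<in> {0<..} \<longrightarrow> \<beta> x = B x"
    and pos: "positive_type \<beta>" and T: "0 < T" and \<phi>: "\<And>i. continuous_on UNIV (\<phi> i)"
    and bound: "\<And>i t. \<bar>\<phi> i t\<bar> \<le> A" and lim: "\<And>t. (\<lambda>i. \<phi> i t) \<longlonglongrightarrow> g t"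
    and supp: "\<And>t. t \<notin> {0..T} \<Longrightarrow> g t = 0"
  shows "0 \<le> (\<integral>x. B x * (\<integral>t. g t * g (t - x) \<partial>lborel) \<partial>lborel)"
proof -
  define \<Phi> where "\<Phi> i t = indicator {0..T} t * \<phi> i t" for i t
  have [measurable]: "B \<in> borel_measurable borel" using B(1) by auto
  have [measurable]: "\<phi> i \<in> borel_measurable borel" for i using \<phi> by (rule borel_measurable_continuous_onI)
  have [measurable]: "\<Phi> i \<in> borel_measurable borel" for i unfolding \<Phi>_def by measurable
  have [measurable]: "g \<in> borel_measurable borel"
    by (rule borel_measurable_LIMSEQ_real[where u = \<phi>]) (use lim in auto)
  have A: "0 \<le> A" using bound[of 0 0] by linarith
  have \<Phi>b: "\<bar>\<Phi> i t\<bar> \<le> A * indicator {0..T} t" "\<bar>\<Phi> i t\<bar> \<le> A" for i t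
    using bound[of i t] A by (auto simp: \<Phi>_def indicator_def)
  have \<Phi>lim: "(\<lambda>i. \<Phi> i t) \<longlonglongrightarrow> g t" for t
    using lim[of t] supp[of t] by (cases "t \<in> {0..T}") (auto simp: \<Phi>_def)
  have prod_b: "\<bar>\<Phi> i t * \<Phi> i (t - x)\<bar> \<le> A * A * indicator {0..T} t" for i t x
    using mult_mono[OF \<Phi>b(1)[of i t] \<Phi>b(2)[of i "t - x"]] A by (simp add: abs_mult mult_ac)
  have ind: "integrable lborel (\<lambda>t. A * A * indicator {0..T} t :: real)"
    by (intro integrable_mult_right integrable_real_indicator) (auto simp: emeasure_lborel_Icc_eq)
  define C where "C i x = (\<integral>t. \<Phi> i t * \<Phi> i (t - x) \<partial>lborel)" for i x
  define C0 where "C0 x = (\<integral>t. g t * g (t - x) \<partial>lborel)" for x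
  have [measurable]: "C i \<in> borel_measurable borel" "C0 \<in> borel_measurable borel" for i
    unfolding C_def C0_def by measurable
  have Clim: "(\<lambda>i. C i x) \<longlonglongrightarrow> C0 x" for x
    unfolding C_def C0_def
  proof (rule integral_dominated_convergence[where w = "\<lambda>t. A * A * indicator {0..T} t"])
    show "AE t in lborel. (\<lambda>i. \<Phi> i t * \<Phi> i (t - x)) \<longlonglongrightarrow> g t * g (t - x)"
      by (intro AE_I2 tendsto_mult \<Phi>lim)
    show "AE t in lborel. norm (\<Phi> i t * \<Phi> i (t - x)) \<le> A * A * indicator {0..T} t" for i
      using prod_b by (intro AE_I2) auto
  qed (use ind in auto)
  have Cb: "\<bar>C i x\<bar> \<le> A * A * T" for i x
  proof -
    have "norm (C i x) \<le> (\<integral>t. A * A * indicator {0..T} t \<partial>lborel)"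
      unfolding C_def
    proof (rule Bochner_Integration.integral_norm_bound_integral)
      show "integrable lborel (\<lambda>t. A * A * indicator {0..T} t :: real)" by (rule ind)
      show "integrable lborel (\<lambda>t. \<Phi> i t * \<Phi> i (t - x))"
        by (rule Bochner_Integration.integrable_bound[OF ind]) (use prod_b in \<open>auto intro!: AE_I2 order.trans[OF prod_b]\<close>)
    qed (use prod_b in auto)
    thus ?thesis using T by simp
  qed
  have "(\<lambda>i. \<integral>x. B x * C i x \<partial>lborel) \<longlonglongrightarrow> (\<integral>x. B x * C0 x \<partial>lborel)"
  proof (rule integral_dominated_convergence[where w = "\<lambda>x. (A * A * T) * \<bar>B x\<bar>"])
    show "AE x in lborel. (\<lambda>i. B x * C i x) \<longlonglongrightarrow> B x * C0 x"
      by (intro AE_I2 tendsto_mult tendsto_const Clim)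
    show "AE x in lborel. norm (B x * C i x) \<le> (A * A * T) * \<bar>B x\<bar>" for i
      using mult_left_mono[OF Cb abs_ge_zero] by (intro AE_I2) (simp add: abs_mult mult_ac)
  qed (use B(1) in auto)
  moreover have "0 \<le> (\<integral>x. B x * C i x \<partial>lborel)" for i
  proof -
    have "0 \<le> integral {0..T} (\<lambda>t. \<phi> i t * integral {0..t} (\<lambda>s. \<beta> (t - s) * \<phi> i s))"
      using pos T \<phi> continuous_on_subset[OF \<phi> subset_UNIV] unfolding positive_type_def by blast
    also have "\<dots> = (\<integral>x. B x * C i x \<partial>lborel)"
      unfolding C_def \<Phi>_def by (rule kernel_double_integral[OF B T \<phi>])
    finally show ?thesis .
  qed
  ultimately show ?thesis unfolding C0_def by (intro LIMSEQ_le_const) auto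
qed

text \<open>Continuous substitute for the indicator of (0,k) with ramps of slope i; taking the open
  interval makes the limit exact at every point.\<close>

definition trapezoid :: "real \<Rightarrow> nat \<Rightarrow> real \<Rightarrow> real" where
  "trapezoid k i t = max 0 (min 1 (min (real i * t) (real i * (k - t))))"

lemma trapezoid_bounds: "0 \<le> trapezoid k i t" "trapezoid k i t \<le> 1"
  by (auto simp: trapezoid_def)

lemma continuous_on_trapezoid: "continuous_on UNIV (\<lambda>t. trapezoid k i (t - c))"
  unfolding trapezoid_def by (intro continuous_intros)

lemma trapezoid_tendsto: "(\<lambda>i. trapezoid k i t) \<longlonglongrightarrow> indicator {0<..<k} t"
proof (cases "t \<in> {0<..<k}")
  case True
  define d where "d = min t (k - t)"
  have d: "0 < d" using True by (auto simp: d_def)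
  obtain n :: nat where n: "1 / d \<le> real n" using real_arch_simple by blast
  have "trapezoid k i t = 1" if "n \<le> i" for i
  proof -
    have "1 / d \<le> real i" using n that by linarith
    hence "1 \<le> real i * d" using d by (simp add: field_simps)
    moreover have "real i * d \<le> real i * t" "real i * d \<le> real i * (k - t)"
      by (auto intro!: mult_left_mono simp: d_def)
    ultimately show ?thesis by (simp add: trapezoid_def)
  qed
  hence "\<forall>\<^sub>F i in sequentially. trapezoid k i t = indicator {0<..<k} t"
    using True by (auto intro!: eventually_sequentiallyI[of n])
  thus ?thesis by (rule tendsto_eventually)
next
  case False
  hence "t \<le> 0 \<or> k - t \<le> 0" by auto
  hence "real i * t \<le> 0 \<or> real i * (k - t) \<le> 0" for i by (auto simp: mult_le_0_iff)
  hence "trapezoid k i t = 0" for i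
    unfolding trapezoid_def using max_absorb1 by (metis min.coboundedI1 min.coboundedI2)
  thus ?thesis using False by simp
qed

text \<open>The hat function is the autocorrelation of an interval indicator, which is why
  hat-shaped weights inherit positivity from the kernel.\<close>

lemma integral_interval_overlap:
  fixes k p q :: real
  assumes k: "0 < k"
  shows "(\<integral>t. indicator {p<..<p + k} t * indicator {q<..<q + k} t \<partial>lborel) = k * hat ((p - q) / k)"
proof -
  have "(\<integral>t. indicator {p<..<p + k} t * indicator {q<..<q + k} t \<partial>lborel) =
      (\<integral>t. (indicator {max p q<..<min p q + k} t :: real) \<partial>lborel)"
    by (intro Bochner_Integration.integral_cong) (auto simp: indicator_def)
  also have "\<dots> = max 0 (min p q + k - max p q)"
    by (simp add: measure_def max_def)
  also have "\<dots> = k * hat ((p - q) / k)"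
    using k by (auto simp: hat_def max_def min_def abs_if field_simps)
  finally show ?thesis .
qed

text \<open>Testing the kernel with the step function of values \<open>a n\<close> gives exactly k
  times the quadratic form of the weights, since translated indicators correlate to hats centred at
  multiples of k.\<close>

lemma iq_weight_positive:
  assumes \<beta>: "positive_type \<beta>" "\<beta> absolutely_integrable_on {0<..}" and k: "0 < k"
  shows "positive_weights (iq_weight k \<beta>)"
  unfolding positive_weights_def
proof (intro allI)
  fix N :: nat and a :: "nat \<Rightarrow> real"
  obtain B where B: "integrable lborel B" "\<And>x. x \<le> 0 \<Longrightarrow> B x = 0" "AE x in lborel. x \<in> {0<..} \<longrightarrow> \<beta> x = B x"
    using abs_integrable_borel_version[OF \<beta>(2)] by blast
  have [measurable]: "B \<in> borel_measurable borel" using B(1) by auto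
  have hat_b: "\<bar>hat t\<bar> \<le> 1" for t by (auto simp: hat_def)
  have hat_m: "(\<lambda>t. hat ((t - p) / k)) \<in> borel_measurable borel" for p
    unfolding hat_def by measurable
  define W where "W p = (\<integral>x. B x * hat ((x - p) / k) \<partial>lborel)" for p
  have B_hat: "integrable lborel (\<lambda>x. B x * hat ((x - p) / k))" for p
  proof (rule Bochner_Integration.integrable_bound[OF B(1)])
    show "AE x in lborel. norm (B x * hat ((x - p) / k)) \<le> norm (B x)"
      using mult_left_mono[OF hat_b abs_ge_zero] by (intro AE_I2) (simp add: abs_mult)
  qed (use hat_m in measurable)
  have W: "iq_weight k \<beta> d = W (real d * k)" for d
  proof -
    let ?S = "{real d * k - min k (real d * k)..real d * k - - k}"
    have S: "?S \<subseteq> {0..}" by auto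
    have "((\<lambda>x. \<beta> x * hat ((x - real d * k) / k)) has_integral
        (\<integral>x. B x * (indicator ?S x * hat ((x - real d * k) / k)) \<partial>lborel)) ?S"
      by (rule kernel_has_integral[OF B _ S hat_m hat_b]) auto
    also have "(\<integral>x. B x * (indicator ?S x * hat ((x - real d * k) / k)) \<partial>lborel) = W (real d * k)"
      unfolding W_def
    proof (intro Bochner_Integration.integral_cong refl)
      fix x
      show "B x * (indicator ?S x * hat ((x - real d * k) / k)) = B x * hat ((x - real d * k) / k)"
      proof (cases "x \<in> ?S \<or> x \<le> 0")
        case False
        hence "x < real d * k - k \<or> real d * k + k < x" by (auto simp: min_def split: if_splits)
        hence "hat ((x - real d * k) / k) = 0"
          using k by (auto simp: hat_def max_def field_simps abs_if)
        thus ?thesis by simp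
      qed (use B(2) in auto)
    qed
    finally have "((\<lambda>x. \<beta> x * hat ((x - real d * k) / k)) has_integral W (real d * k)) ?S" .
    from has_integral_reflect_shift[OF this]
    have "((\<lambda>\<zeta>. \<beta> (real d * k - \<zeta>) * hat (\<zeta> / k)) has_integral W (real d * k)) {- k..min k (real d * k)}"
      by (simp add: hat_def)
    thus ?thesis unfolding iq_weight_def by (rule integral_unique)
  qed
  \<comment> \<open>At negative lags the hat lives where B vanishes, so the full double sum
    collapses to its lower triangle.\<close>
  have W0: "W p = 0" if "p \<le> - k" for p
  proof -
    have "B x * hat ((x - p) / k) = 0" for x
    proof (cases "x \<le> 0")
      case False
      hence "hat ((x - p) / k) = 0" using k that by (auto simp: hat_def max_def field_simps abs_if)
      thus ?thesis by simp
    qed (use B(2) in auto)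
    note zero = this
    show ?thesis unfolding W_def zero by simp
  qed
  define I where "I n = {real n * k<..<real n * k + k}" for n :: nat
  define g where "g t = (\<Sum>n<N. a n * indicator (I n) t)" for t
  define T where "T = real N * k + k"
  have T: "0 < T" using k by (simp add: T_def add_nonneg_pos)
  have J: "0 \<le> (\<integral>x. B x * (\<integral>t. g t * g (t - x) \<partial>lborel) \<partial>lborel)" (is "_ \<le> ?J")
  proof (rule positive_type_limit_nonneg[OF B \<beta>(1) T])
    show "continuous_on UNIV (\<lambda>t. \<Sum>n<N. a n * trapezoid k i (t - real n * k))" for i
      by (intro continuous_intros continuous_on_trapezoid)
    show "\<bar>\<Sum>n<N. a n * trapezoid k i (t - real n * k)\<bar> \<le> (\<Sum>n<N. \<bar>a n\<bar>)" for i t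
      by (intro order.trans[OF sum_abs] sum_mono)
         (use trapezoid_bounds in \<open>auto simp: abs_mult intro!: mult_left_le\<close>)
    show "(\<lambda>i. \<Sum>n<N. a n * trapezoid k i (t - real n * k)) \<longlonglongrightarrow> g t" for t
    proof -
      have "indicator (I n) t = (indicator {0<..<k} (t - real n * k) :: real)" for n
        by (auto simp: I_def indicator_def)
      thus ?thesis unfolding g_def by (simp only:) (intro tendsto_intros trapezoid_tendsto)
    qed
    show "g t = 0" if "t \<notin> {0..T}" for t
    proof -
      have "t \<notin> I n" if "n < N" for n
      proof -
        have "real n * k \<le> real N * k" "0 \<le> real n * k" using that k by (auto intro!: mult_right_mono)
        hence "t \<in> I n \<Longrightarrow> 0 \<le> t \<and> t \<le> T"
          unfolding I_def T_def greaterThanLessThan_iff by linarith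
        thus ?thesis using \<open>t \<notin> {0..T}\<close> by auto
      qed
      thus ?thesis by (simp add: g_def)
    qed
  qed
  have corr: "(\<integral>t. g t * g (t - x) \<partial>lborel) = (\<Sum>n<N. \<Sum>l<N. a n * a l * (k * hat ((x - (real n - real l) * k) / k)))" for x
  proof -
    have ind: "integrable lborel (\<lambda>t. indicator (I n) t * indicator (I l) (t - x) :: real)" for n l
    proof (rule Bochner_Integration.integrable_bound)
      show "integrable lborel (\<lambda>t. indicator (I n) t :: real)"
        by (intro integrable_real_indicator) (use k in \<open>auto simp: I_def\<close>)
      show "(\<lambda>t. indicator (I n) t * indicator (I l) (t - x) :: real) \<in> borel_measurable lborel"
        unfolding I_def by measurable
    qed (auto simp: indicator_def)
    have "(\<integral>t. g t * g (t - x) \<partial>lborel) =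
        (\<integral>t. (\<Sum>n<N. \<Sum>l<N. a n * a l * (indicator (I n) t * indicator (I l) (t - x))) \<partial>lborel)"
      unfolding g_def sum_product by (simp add: mult_ac)
    also have "\<dots> = (\<Sum>n<N. \<Sum>l<N. a n * a l * (\<integral>t. indicator (I n) t * indicator (I l) (t - x) \<partial>lborel))"
      by (subst Bochner_Integration.integral_sum, (intro Bochner_Integration.integrable_sum integrable_mult_right ind)[1],
          intro sum.cong refl, subst Bochner_Integration.integral_sum, (intro integrable_mult_right ind)[1]) simp
    also have "\<dots> = (\<Sum>n<N. \<Sum>l<N. a n * a l * (k * hat ((x - (real n - real l) * k) / k)))"
    proof (intro sum.cong refl arg_cong2[where f = times])
      fix n l
      show "(\<integral>t. indicator (I n) t * indicator (I l) (t - x) \<partial>lborel) = k * hat ((x - (real n - real l) * k) / k)"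
      proof -
        have "(\<integral>t. indicator (I n) t * indicator (I l) (t - x) \<partial>lborel) =
            (\<integral>t. (indicator {real n * k<..<real n * k + k} t * indicator {real l * k + x<..<real l * k + x + k} t :: real) \<partial>lborel)"
          by (intro Bochner_Integration.integral_cong) (auto simp: I_def indicator_def)
        also have "\<dots> = k * hat ((real n * k - (real l * k + x)) / k)" by (rule integral_interval_overlap[OF k])
        also have "hat ((real n * k - (real l * k + x)) / k) = hat ((x - (real n - real l) * k) / k)"
          unfolding hat_def by (subst abs_minus_cancel[symmetric]) (simp add: algebra_simps diff_divide_distrib add_divide_distrib)
        finally show ?thesis .
      qed
    qed
    finally show ?thesis .
  qed
  have "?J = (\<Sum>n<N. \<Sum>l<N. a n * a l * (k * W ((real n - real l) * k)))"
  proof -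
    have "(\<integral>x. B x * (\<Sum>n<N. \<Sum>l<N. a n * a l * (k * hat ((x - (real n - real l) * k) / k))) \<partial>lborel) =
        (\<integral>x. (\<Sum>n<N. \<Sum>l<N. a n * a l * (k * (B x * hat ((x - (real n - real l) * k) / k)))) \<partial>lborel)"
      by (simp add: sum_distrib_left mult_ac)
    also have "\<dots> = (\<Sum>n<N. \<Sum>l<N. a n * a l * (k * W ((real n - real l) * k)))"
      unfolding W_def
      by (subst Bochner_Integration.integral_sum, (intro Bochner_Integration.integrable_sum integrable_mult_right B_hat)[1],
          intro sum.cong refl, subst Bochner_Integration.integral_sum, (intro integrable_mult_right B_hat)[1]) simp
    finally show ?thesis by (simp only: corr)
  qed
  also have "\<dots> = (\<Sum>n<N. \<Sum>l\<le>n. k * (iq_weight k \<beta> (n - l) * (a l * a n)))"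
  proof (rule sum.cong[OF refl])
    fix n assume n: "n \<in> {..<N}"
    show "(\<Sum>l<N. a n * a l * (k * W ((real n - real l) * k))) = (\<Sum>l\<le>n. k * (iq_weight k \<beta> (n - l) * (a l * a n)))"
    proof (rule sum.mono_neutral_cong_right)
      show "\<forall>l\<in>{..<N} - {..n}. a n * a l * (k * W ((real n - real l) * k)) = 0"
      proof
        fix l assume "l \<in> {..<N} - {..n}"
        hence "real n - real l \<le> - 1" by auto
        hence "(real n - real l) * k \<le> - 1 * k" using k by (intro mult_right_mono) auto
        thus "a n * a l * (k * W ((real n - real l) * k)) = 0" using W0 by simp
      qed
    qed (use n in \<open>auto simp: W of_nat_diff\<close>)
  qed
  also have "\<dots> = k * (\<Sum>n<N. \<Sum>l\<le>n. iq_weight k \<beta> (n - l) * (a l * a n))"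
    by (simp add: sum_distrib_left)
  finally have "?J = k * (\<Sum>n<N. \<Sum>l\<le>n. iq_weight k \<beta> (n - l) * (a l * a n))" .
  with J show "0 \<le> (\<Sum>n<N. \<Sum>l\<le>n. iq_weight k \<beta> (n - l) * (a l * a n))"
    using k by (simp add: zero_le_mult_iff)
qed

section \<open>Consistency of the difference quotients\<close>

text \<open>
  Stated for inner product spaces since the sort \<open>{real_inner, complete_space}\<close> is not below the
  class \<open>banach\<close> of the corresponding library lemma; testing with \<open>I\<close> reduces it to real integrals.
\<close>

lemma integral_norm_bound_finite:
  fixes f :: "real \<Rightarrow> 'a::real_inner"
  assumes f: "(f has_integral I) S" and g: "g integrable_on S" and N: "finite N"
    and le: "\<And>x. x \<in> S - N \<Longrightarrow> norm (f x) \<le> g x"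
  shows "norm I \<le> integral S g"
proof -
  have neg: "negligible N" using N by (rule negligible_finite)
  define h where "h x = (if x \<in> N then 0 else f x \<bullet> I)" for x
  define g' where "g' x = (if x \<in> N then 0 else g x)" for x
  have "((\<lambda>x. f x \<bullet> I) has_integral I \<bullet> I) S"
    using has_integral_linear[OF f bounded_linear_inner_left[of I]] by (simp add: o_def)
  hence h: "(h has_integral I \<bullet> I) S"
    by (rule has_integral_spike[OF neg, rotated]) (auto simp: h_def)
  have g': "(g' has_integral integral S g) S"
    by (rule has_integral_spike[OF neg _ integrable_integral[OF g]]) (auto simp: g'_def)
  have g'0: "0 \<le> g' x" if "x \<in> S" for x
    using le[of x] that order_trans[OF norm_ge_zero] by (auto simp: g'_def)
  have "I \<bullet> I \<le> norm I * integral S g"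
  proof (rule has_integral_le[OF h has_integral_mult_right[OF g']])
    fix x assume x: "x \<in> S"
    show "h x \<le> norm I * g' x"
    proof (cases "x \<in> N")
      case False
      have "f x \<bullet> I \<le> norm (f x) * norm I" by (rule norm_cauchy_schwarz)
      also have "\<dots> \<le> g x * norm I" using le x False by (intro mult_right_mono) auto
      finally show ?thesis using False by (simp add: h_def g'_def mult.commute)
    qed (simp add: h_def g'_def)
  qed
  hence "norm I * norm I \<le> norm I * integral S g"
    by (simp add: power2_norm_eq_inner[symmetric] power2_eq_square)
  moreover have "0 \<le> integral S g" by (rule has_integral_nonneg[OF g' g'0])
  ultimately show ?thesis by (cases "I = 0") auto
qed

lemma norm_diff_le_integral:
  fixes F :: "real \<Rightarrow> 'a::real_inner"
  assumes "a \<le> b" "continuous_on {a..b} F"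
    and "\<And>t. t \<in> {a<..<b} \<Longrightarrow> (F has_vector_derivative F' t) (at t)"
    and "\<And>t. t \<in> {a<..<b} \<Longrightarrow> norm (F' t) \<le> g t" and "g integrable_on {a..b}"
  shows "norm (F b - F a) \<le> integral {a..b} g"
  by (rule integral_norm_bound_finite[OF fundamental_theorem_of_calculus_interior[OF assms(1-3)] assms(5), of "{a, b}"])
     (use assms(4) in auto)

lemma integral_superset_eq:
  fixes f :: "real \<Rightarrow> 'a::banach"
  assumes "S \<subseteq> T" "\<And>x. x \<in> T - S \<Longrightarrow> f x = 0"
  shows "integral S f = integral T f"
proof -
  have "(\<lambda>x. if x \<in> S then f x else 0) = (\<lambda>x. if x \<in> T then f x else 0)"
    using assms by (auto simp: fun_eq_iff)
  hence "integral UNIV (\<lambda>x. if x \<in> S then f x else 0) = integral UNIV (\<lambda>x. if x \<in> T then f x else 0)" by simp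
  thus ?thesis using integral_restrict_UNIV[of S f] integral_restrict_UNIV[of T f] by simp
qed

text \<open>The second derivative may be singular at 0 as long as its norm is integrable; continuity
  of u' at 0 is then derived.\<close>

locale C1_orbit =
  fixes u u' u'' :: "real \<Rightarrow> 'a::real_inner" and k :: real
  assumes k: "0 < k"
    and deriv: "\<And>t. 0 \<le> t \<Longrightarrow> (u has_vector_derivative u' t) (at t within {0..})"
    and deriv2: "\<And>t. 0 < t \<Longrightarrow> (u' has_vector_derivative u'' t) (at t)"
    and int2: "(\<lambda>t. norm (u'' t)) integrable_on {0..2 * k}"
begin

lemma deriv_at: "0 < t \<Longrightarrow> (u has_vector_derivative u' t) (at t)"
  using deriv[of t] at_within_interior[of t "{0..}"] by (simp add: interior_real_atLeast)

lemma continuous_on_u: "continuous_on {0..} u"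
  by (auto simp: continuous_on_eq_continuous_within intro: has_vector_derivative_continuous deriv)

lemma continuous_on_pos: "0 < a \<Longrightarrow> continuous_on {a..b} u'"
  by (intro continuous_at_imp_continuous_on ballI has_vector_derivative_continuous[OF deriv2]) auto

lemma int2_sub: "0 \<le> a \<Longrightarrow> b \<le> 2 * k \<Longrightarrow> (\<lambda>t. norm (u'' t)) integrable_on {a..b}"
  using integrable_on_subinterval[OF int2] by auto

lemma u'_diff_0:
  assumes t: "0 < t" "t \<le> 2 * k"
  shows "norm (u' t - u' 0) \<le> integral {0..t} (\<lambda>s. norm (u'' s))"
proof (rule field_le_epsilon)
  fix e :: real assume e: "0 < e"
  define M where "M = integral {0..t} (\<lambda>s. norm (u'' s))"
  have near: "norm (u' s - u' t) \<le> M" if s: "0 < s" "s < t" for s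
  proof -
    have "norm (u' t - u' s) \<le> integral {s..t} (\<lambda>r. norm (u'' r))"
      using s t by (intro norm_diff_le_integral[where F' = u''] continuous_on_pos deriv2 int2_sub) auto
    also have "\<dots> \<le> M"
      unfolding M_def using s t by (intro integral_subset_le int2_sub) auto
    finally show ?thesis by (simp add: norm_minus_commute)
  qed
  have lin: "norm (u s - u 0 - s *\<^sub>R u' t) \<le> M * s" if s: "0 < s" "s < t" for s
  proof -
    have "norm ((u s - s *\<^sub>R u' t) - (u 0 - 0 *\<^sub>R u' t)) \<le> integral {0..s} (\<lambda>_. M)"
    proof (rule norm_diff_le_integral[where F' = "\<lambda>r. u' r - u' t"])
      show "continuous_on {0..s} (\<lambda>s. u s - s *\<^sub>R u' t)"
        by (intro continuous_intros continuous_on_subset[OF continuous_on_u]) auto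
      show "((\<lambda>s. u s - s *\<^sub>R u' t) has_vector_derivative u' r - u' t) (at r)" if "r \<in> {0<..<s}" for r
        using that by (auto intro!: derivative_eq_intros deriv_at)
    qed (use s near in auto)
    thus ?thesis using s by (simp add: algebra_simps)
  qed
  have "(u has_derivative (\<lambda>x. x *\<^sub>R u' 0)) (at 0 within {0..})"
    using deriv[of 0] by (simp add: has_vector_derivative_def)
  then obtain d where d: "0 < d" "\<And>y. y \<in> {0..} \<Longrightarrow> norm (y - 0) < d \<Longrightarrow> norm (u y - u 0 - (y - 0) *\<^sub>R u' 0) \<le> e * norm (y - 0)"
    using e unfolding has_derivative_within_alt by meson
  define s where "s = min (t / 2) (d / 2)"
  have s: "0 < s" "s < t" "s < d" using t d by (auto simp: s_def)
  have "s *\<^sub>R (u' t - u' 0) = (u s - u 0 - s *\<^sub>R u' 0) - (u s - u 0 - s *\<^sub>R u' t)" by (simp add: algebra_simps)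
  hence "norm (s *\<^sub>R (u' t - u' 0)) \<le> norm (u s - u 0 - s *\<^sub>R u' 0) + norm (u s - u 0 - s *\<^sub>R u' t)"
    by (simp only: norm_triangle_ineq4)
  also have "\<dots> \<le> e * s + M * s" using d(2)[of s] lin[of s] s by (intro add_mono) auto
  also have "norm (s *\<^sub>R (u' t - u' 0)) = s * norm (u' t - u' 0)" using s(1) by (simp only: norm_scaleR abs_of_pos)
  also have "e * s + M * s = s * (M + e)" by (simp add: algebra_simps)
  finally have "s * norm (u' t - u' 0) \<le> s * (M + e)" .
  hence "norm (u' t - u' 0) \<le> M + e" using s(1) by (rule mult_left_le_imp_le)
  thus "norm (u' t - u' 0) \<le> integral {0..t} (\<lambda>s. norm (u'' s)) + e" by (simp only: M_def)
qed

lemma continuous_on_u': "continuous_on {0..} u'"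
proof (rule continuous_on_eq_continuous_within[THEN iffD2], rule ballI)
  fix t :: real assume "t \<in> {0..}"
  show "continuous (at t within {0..}) u'"
  proof (cases "t = 0")
    case False
    with \<open>t \<in> {0..}\<close> show ?thesis
      by (auto intro: continuous_at_imp_continuous_at_within[OF has_vector_derivative_continuous[OF deriv2]])
  next
    case True
    have "continuous_on {0..2 * k} (\<lambda>x. integral {0..x} (\<lambda>s. norm (u'' s)))"
      by (rule indefinite_integral_continuous_1[OF int2])
    hence "((\<lambda>x. integral {0..x} (\<lambda>s. norm (u'' s))) \<longlongrightarrow> integral {0..0} (\<lambda>s. norm (u'' s))) (at 0 within {0..2 * k})"
      unfolding continuous_on_def by (rule bspec) (use k in simp)
    hence lim: "((\<lambda>x. integral {0..x} (\<lambda>s. norm (u'' s))) \<longlongrightarrow> 0) (at 0 within {0..2 * k})" by simp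
    have "((\<lambda>x. u' x - u' 0) \<longlongrightarrow> 0) (at 0 within {0..2 * k})"
    proof (rule Lim_null_comparison[OF _ lim])
      show "\<forall>\<^sub>F x in at 0 within {0..2 * k}. norm (u' x - u' 0) \<le> integral {0..x} (\<lambda>s. norm (u'' s))"
        unfolding eventually_at using u'_diff_0 k by (intro exI[of _ k]) (auto simp: less_le)
    qed
    hence "(u' \<longlongrightarrow> u' 0) (at 0 within {0..2 * k})" by (simp add: LIM_zero_iff)
    moreover have "at 0 within {0..2 * k} = at 0 within {0..}"
      by (rule at_within_nhd[of _ "{..<2 * k}"]) (use k in auto)
    ultimately show ?thesis using True by (simp add: continuous_within)
  qed
qed

lemma difference_error_1: "norm (u' k - (u k - u 0) /\<^sub>R k) \<le> integral {0..k} (\<lambda>t. norm (u'' t))"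
proof -
  have "norm ((k *\<^sub>R u' k - u k) - (0 *\<^sub>R u' 0 - u 0)) \<le> integral {0..k} (\<lambda>t. k * norm (u'' t))"
  proof (rule norm_diff_le_integral[where F' = "\<lambda>t. t *\<^sub>R u'' t"])
    show "continuous_on {0..k} (\<lambda>t. t *\<^sub>R u' t - u t)"
      by (intro continuous_intros continuous_on_subset[OF continuous_on_u] continuous_on_subset[OF continuous_on_u']) auto
    show "((\<lambda>t. t *\<^sub>R u' t - u t) has_vector_derivative t *\<^sub>R u'' t) (at t)" if "t \<in> {0<..<k}" for t
      using that by (auto intro!: derivative_eq_intros deriv_at deriv2)
  qed (use k int2_sub in \<open>auto intro!: mult_right_mono integrable_on_mult_right\<close>)
  also have "\<dots> = k * integral {0..k} (\<lambda>t. norm (u'' t))" by simp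
  also have "(k *\<^sub>R u' k - u k) - (0 *\<^sub>R u' 0 - u 0) = k *\<^sub>R (u' k - (u k - u 0) /\<^sub>R k)"
    using k by (simp add: algebra_simps)
  finally show ?thesis using k by simp
qed

lemma scaleR_step_cancel: "k *\<^sub>R (c *\<^sub>R (v /\<^sub>R k)) = c *\<^sub>R (v::'a)"
  using k by simp

text \<open>Peano kernel: k times the residual is the integral of u'' against -t/2 on [0,k] and 3t/2
  - 2k on [k,2k], both of size at most k. \<open>F1\<close> and \<open>F2\<close> are the primitives
  found by parts.\<close>

lemma difference_error_2:
  "norm (u' (2 * k) - ((3/2) *\<^sub>R ((u (2 * k) - u k) /\<^sub>R k) - (1/2) *\<^sub>R ((u k - u 0) /\<^sub>R k)))
     \<le> integral {0..2 * k} (\<lambda>t. norm (u'' t))"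
proof -
  define F1 where "F1 t = (1/2) *\<^sub>R u t - (t / 2) *\<^sub>R u' t" for t
  define F2 where "F2 t = (3 * t / 2 - 2 * k) *\<^sub>R u' t - (3/2) *\<^sub>R u t" for t
  have "norm (F1 k - F1 0) \<le> integral {0..k} (\<lambda>t. k * norm (u'' t))"
  proof (rule norm_diff_le_integral[where F' = "\<lambda>t. - (t / 2) *\<^sub>R u'' t"])
    show "continuous_on {0..k} F1" unfolding F1_def
      by (intro continuous_intros continuous_on_subset[OF continuous_on_u] continuous_on_subset[OF continuous_on_u']) auto
    show "(F1 has_vector_derivative - (t / 2) *\<^sub>R u'' t) (at t)" if "t \<in> {0<..<k}" for t
      unfolding F1_def using that by (auto intro!: derivative_eq_intros deriv_at deriv2)
    show "norm (- (t / 2) *\<^sub>R u'' t) \<le> k * norm (u'' t)" if "t \<in> {0<..<k}" for t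
      using that mult_right_mono[of "t / 2" k "norm (u'' t)"] by simp
  qed (use k int2_sub in \<open>auto intro!: integrable_on_mult_right\<close>)
  moreover have "norm (F2 (2 * k) - F2 k) \<le> integral {k..2 * k} (\<lambda>t. k * norm (u'' t))"
  proof (rule norm_diff_le_integral[where F' = "\<lambda>t. (3 * t / 2 - 2 * k) *\<^sub>R u'' t"])
    show "continuous_on {k..2 * k} F2" unfolding F2_def
      using k by (intro continuous_intros continuous_on_subset[OF continuous_on_u] continuous_on_subset[OF continuous_on_u']) auto
    show "(F2 has_vector_derivative (3 * t / 2 - 2 * k) *\<^sub>R u'' t) (at t)" if "t \<in> {k<..<2 * k}" for t
      unfolding F2_def using that k by (auto intro!: derivative_eq_intros deriv_at deriv2 simp: algebra_simps)
    show "norm ((3 * t / 2 - 2 * k) *\<^sub>R u'' t) \<le> k * norm (u'' t)" if "t \<in> {k<..<2 * k}" for t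
      using that by (auto intro!: mult_right_mono)
  qed (use k int2_sub in \<open>auto intro!: integrable_on_mult_right\<close>)
  moreover have "integral {0..k} (\<lambda>t. k * norm (u'' t)) + integral {k..2 * k} (\<lambda>t. k * norm (u'' t)) =
      integral {0..2 * k} (\<lambda>t. k * norm (u'' t))"
    using k int2 by (intro Henstock_Kurzweil_Integration.integral_combine integrable_on_mult_right) auto
  ultimately have "norm ((F1 k - F1 0) + (F2 (2 * k) - F2 k)) \<le> k * integral {0..2 * k} (\<lambda>t. norm (u'' t))"
    using norm_triangle_ineq[of "F1 k - F1 0" "F2 (2 * k) - F2 k"] by simp
  also have "(F1 k - F1 0) + (F2 (2 * k) - F2 k) =
      k *\<^sub>R (u' (2 * k) - ((3/2) *\<^sub>R ((u (2 * k) - u k) /\<^sub>R k) - (1/2) *\<^sub>R ((u k - u 0) /\<^sub>R k)))"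
  proof -
    have "(F1 k - F1 0) + (F2 (2 * k) - F2 k) = k *\<^sub>R u' (2 * k) - ((3/2) *\<^sub>R (u (2 * k) - u k) - (1/2) *\<^sub>R (u k - u 0))"
      unfolding F1_def F2_def by (simp add: algebra_simps flip: scaleR_add_left)
    also have "\<dots> = k *\<^sub>R (u' (2 * k) - ((3/2) *\<^sub>R ((u (2 * k) - u k) /\<^sub>R k) - (1/2) *\<^sub>R ((u k - u 0) /\<^sub>R k)))"
      by (simp only: scaleR_right_diff_distrib scaleR_step_cancel)
    finally show ?thesis .
  qed
  finally show ?thesis using k by simp
qed

text \<open>BDF2 is exact on quadratics, so the residual is an integral of u'''. With b and c the
  next two nodes, the kernel is (t - a)^2/4 up to b and (t - a)^2/4 - (t - b)^2 up to c, of size at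
  most k^2; a > 0 avoids a possible singularity at 0.\<close>

lemma difference_error_3:
  assumes a: "0 < a" and deriv3: "\<And>t. 0 < t \<Longrightarrow> (u'' has_vector_derivative u''' t) (at t)"
    and int3: "(\<lambda>t. norm (u''' t)) integrable_on {a..a + 2 * k}"
  shows "norm (u' (a + 2 * k) - ((3/2) *\<^sub>R ((u (a + 2 * k) - u (a + k)) /\<^sub>R k) - (1/2) *\<^sub>R ((u (a + k) - u a) /\<^sub>R k)))
     \<le> k * integral {a..a + 2 * k} (\<lambda>t. norm (u''' t))"
proof -
  define b c where "b = a + k" and "c = a + 2 * k"
  have abc: "0 < b" "a \<le> b" "b \<le> c" "b - a = k" "c - b = k" "c - a = 2 * k" using a k by (auto simp: b_def c_def)
  define F1 where "F1 t = ((t - a)\<^sup>2 / 4) *\<^sub>R u'' t - ((t - a) / 2) *\<^sub>R u' t + (1/2) *\<^sub>R u t" for t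
  define F2 where "F2 t = ((t - a)\<^sup>2 / 4 - (t - b)\<^sup>2) *\<^sub>R u'' t - ((t - a) / 2 - 2 * (t - b)) *\<^sub>R u' t - (3/2) *\<^sub>R u t" for t
  have cont: "continuous_on {x..y} u" "continuous_on {x..y} u'" "continuous_on {x..y} u''" if "0 < x" for x y
    using that by (auto intro!: continuous_at_imp_continuous_on
      has_vector_derivative_continuous[OF deriv_at] has_vector_derivative_continuous[OF deriv2]
      has_vector_derivative_continuous[OF deriv3])
  have int3': "(\<lambda>t. norm (u''' t)) integrable_on {x..y}" if "a \<le> x" "y \<le> c" for x y
    using integrable_on_subinterval[OF int3] that by (auto simp: c_def)
  have "norm (F1 b - F1 a) \<le> integral {a..b} (\<lambda>t. k\<^sup>2 * norm (u''' t))"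
  proof (rule norm_diff_le_integral[where F' = "\<lambda>t. ((t - a)\<^sup>2 / 4) *\<^sub>R u''' t"])
    show "continuous_on {a..b} F1" unfolding F1_def by (intro continuous_intros cont a) auto
    show "(F1 has_vector_derivative ((t - a)\<^sup>2 / 4) *\<^sub>R u''' t) (at t)" if "t \<in> {a<..<b}" for t
      unfolding F1_def using that a
      by (auto intro!: derivative_eq_intros deriv_at deriv2 deriv3 simp: field_simps)
    show "norm (((t - a)\<^sup>2 / 4) *\<^sub>R u''' t) \<le> k\<^sup>2 * norm (u''' t)" if "t \<in> {a<..<b}" for t
    proof -
      have "(t - a)\<^sup>2 \<le> k\<^sup>2" using that abc by (intro power_mono) auto
      hence "(t - a)\<^sup>2 / 4 \<le> k\<^sup>2" using zero_le_power2[of "t - a"] by linarith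
      hence "(t - a)\<^sup>2 / 4 * norm (u''' t) \<le> k\<^sup>2 * norm (u''' t)" by (rule mult_right_mono) simp
      thus ?thesis by simp
    qed
  qed (use abc(2,3) in \<open>auto intro!: integrable_on_mult_right int3'\<close>)
  moreover have "norm (F2 c - F2 b) \<le> integral {b..c} (\<lambda>t. k\<^sup>2 * norm (u''' t))"
  proof (rule norm_diff_le_integral[where F' = "\<lambda>t. ((t - a)\<^sup>2 / 4 - (t - b)\<^sup>2) *\<^sub>R u''' t"])
    show "continuous_on {b..c} F2" unfolding F2_def by (intro continuous_intros cont abc) auto
    show "(F2 has_vector_derivative ((t - a)\<^sup>2 / 4 - (t - b)\<^sup>2) *\<^sub>R u''' t) (at t)" if "t \<in> {b<..<c}" for t
      unfolding F2_def using that abc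
      by (auto intro!: derivative_eq_intros deriv_at deriv2 deriv3 simp: field_simps)
    show "norm (((t - a)\<^sup>2 / 4 - (t - b)\<^sup>2) *\<^sub>R u''' t) \<le> k\<^sup>2 * norm (u''' t)" if "t \<in> {b<..<c}" for t
    proof -
      have "t - a \<le> 2 * k" "0 \<le> t - a" "t - b \<le> k" "0 \<le> t - b"
        using that abc k unfolding greaterThanLessThan_iff by linarith+
      hence "(t - a)\<^sup>2 \<le> (2 * k)\<^sup>2" "(t - b)\<^sup>2 \<le> k\<^sup>2" by (simp_all only: power_mono)
      moreover have "(2 * k)\<^sup>2 = 4 * k\<^sup>2" by (simp add: power_mult_distrib)
      moreover have "0 \<le> (t - a)\<^sup>2" "0 \<le> (t - b)\<^sup>2" by simp_all
      ultimately have "\<bar>(t - a)\<^sup>2 / 4 - (t - b)\<^sup>2\<bar> \<le> k\<^sup>2" by linarith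
      thus ?thesis by (auto intro!: mult_right_mono)
    qed
  qed (use abc(2,3) in \<open>auto intro!: integrable_on_mult_right int3'\<close>)
  moreover have "integral {a..b} (\<lambda>t. k\<^sup>2 * norm (u''' t)) + integral {b..c} (\<lambda>t. k\<^sup>2 * norm (u''' t)) =
      integral {a..c} (\<lambda>t. k\<^sup>2 * norm (u''' t))"
    using abc(2,3) by (intro Henstock_Kurzweil_Integration.integral_combine integrable_on_mult_right int3') auto
  ultimately have "norm ((F1 b - F1 a) + (F2 c - F2 b)) \<le> k\<^sup>2 * integral {a..c} (\<lambda>t. norm (u''' t))"
    using norm_triangle_ineq[of "F1 b - F1 a" "F2 c - F2 b"] by simp
  also have "(F1 b - F1 a) + (F2 c - F2 b) =
      k *\<^sub>R (u' c - ((3/2) *\<^sub>R ((u c - u b) /\<^sub>R k) - (1/2) *\<^sub>R ((u b - u a) /\<^sub>R k)))"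
  proof -
    have "(F1 b - F1 a) + (F2 c - F2 b) = k *\<^sub>R u' c - ((3/2) *\<^sub>R (u c - u b) - (1/2) *\<^sub>R (u b - u a))"
      unfolding F1_def F2_def abc by (simp add: algebra_simps power2_eq_square flip: scaleR_add_left)
    also have "\<dots> = k *\<^sub>R (u' c - ((3/2) *\<^sub>R ((u c - u b) /\<^sub>R k) - (1/2) *\<^sub>R ((u b - u a) /\<^sub>R k)))"
      by (simp only: scaleR_right_diff_distrib scaleR_step_cancel)
    finally show ?thesis .
  qed
  finally show ?thesis using k unfolding b_def c_def by (simp add: power2_eq_square)
qed

end

section \<open>Consistency of the interpolation quadrature\<close>

lemma hat_sum_linear_interp:
  fixes \<psi> :: "nat \<Rightarrow> real"
  assumes k: "0 < k" and \<theta>: "0 \<le> \<theta>" "\<theta> \<le> 1" and j: "j < n"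
  shows "(\<Sum>l\<le>n. \<psi> l * hat (((real j + \<theta>) * k - real l * k) / k)) = (1 - \<theta>) * \<psi> j + \<theta> * \<psi> (Suc j)"
proof -
  have arg: "((real j + \<theta>) * k - real l * k) / k = real j + \<theta> - real l" for l
    using k by (simp add: field_simps)
  have "(\<Sum>l\<le>n. \<psi> l * hat (real j + \<theta> - real l)) = (\<Sum>l\<in>{j, Suc j}. \<psi> l * hat (real j + \<theta> - real l))"
  proof (rule sum.mono_neutral_right)
    show "\<forall>l\<in>{..n} - {j, Suc j}. \<psi> l * hat (real j + \<theta> - real l) = 0"
    proof
      fix l assume "l \<in> {..n} - {j, Suc j}"
      hence "l + 1 \<le> j \<or> j + 2 \<le> l" by auto
      hence "real l + 1 \<le> real j \<or> real j + 2 \<le> real l" by linarith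
      hence "1 \<le> \<bar>real j + \<theta> - real l\<bar>" using \<theta> by linarith
      thus "\<psi> l * hat (real j + \<theta> - real l) = 0" by (simp add: hat_def)
    qed
  qed (use j in auto)
  thus ?thesis using \<theta> unfolding arg by (simp add: hat_def)
qed

lemma linear_interp_error:
  fixes \<phi> :: "real \<Rightarrow> real"
  assumes ab: "a \<le> b" and \<theta>: "0 \<le> \<theta>" "\<theta> \<le> 1" and cont: "continuous_on {a..b} \<phi>"
    and deriv: "\<And>t. t \<in> {a<..<b} \<Longrightarrow> (\<phi> has_vector_derivative \<phi>' t) (at t)"
    and bound: "\<And>t. t \<in> {a<..<b} \<Longrightarrow> \<bar>\<phi>' t\<bar> \<le> g t" and g: "g integrable_on {a..b}" "\<And>t. t \<in> {a..b} \<Longrightarrow> 0 \<le> g t"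
  shows "\<bar>\<phi> (a + \<theta> * (b - a)) - ((1 - \<theta>) * \<phi> a + \<theta> * \<phi> b)\<bar> \<le> integral {a..b} g"
proof -
  define s where "s = a + \<theta> * (b - a)"
  have "\<theta> * (b - a) \<le> 1 * (b - a)" using ab \<theta> by (intro mult_right_mono) auto
  moreover have "0 \<le> \<theta> * (b - a)" using ab \<theta> by simp
  ultimately have s: "a \<le> s" "s \<le> b" by (auto simp: s_def)
  have sub: "g integrable_on {x..y}" if "a \<le> x" "y \<le> b" for x y
    using integrable_on_subinterval[OF g(1)] that by auto
  have diff: "\<bar>\<phi> y - \<phi> x\<bar> \<le> integral {a..b} g" if xy: "a \<le> x" "x \<le> y" "y \<le> b" for x y
  proof -
    have "norm (\<phi> y - \<phi> x) \<le> integral {x..y} g"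
      using xy deriv bound
      by (intro norm_diff_le_integral[where F' = \<phi>'] continuous_on_subset[OF cont] sub) auto
    also have "\<dots> \<le> integral {a..b} g" using xy g by (intro integral_subset_le sub) auto
    finally show ?thesis by simp
  qed
  have "\<phi> s - ((1 - \<theta>) * \<phi> a + \<theta> * \<phi> b) = (1 - \<theta>) * (\<phi> s - \<phi> a) - \<theta> * (\<phi> b - \<phi> s)"
    by (simp add: algebra_simps)
  hence "\<bar>\<phi> s - ((1 - \<theta>) * \<phi> a + \<theta> * \<phi> b)\<bar> \<le> \<bar>(1 - \<theta>) * (\<phi> s - \<phi> a)\<bar> + \<bar>\<theta> * (\<phi> b - \<phi> s)\<bar>"
    by (simp only: abs_triangle_ineq4)
  also have "\<dots> \<le> (1 - \<theta>) * integral {a..b} g + \<theta> * integral {a..b} g"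
    using \<theta> diff[of a s] diff[of s b] s by (intro add_mono) (auto simp: abs_mult intro!: mult_left_mono)
  finally show ?thesis unfolding s_def by (simp add: algebra_simps)
qed

text \<open>On the first cell only the integral of |\<phi>'| is available; on later cells \<phi>''
  gains a factor k. The two bounds are added so that one number serves for all s.\<close>

lemma interp_error:
  fixes \<phi> :: "real \<Rightarrow> real"
  assumes k: "0 < k" and n: "0 < n" and s: "0 \<le> s" "s \<le> real n * k"
    and cont: "continuous_on {0..} \<phi>"
    and deriv: "\<And>t. 0 < t \<Longrightarrow> (\<phi> has_vector_derivative \<phi>' t) (at t)"
    and deriv2: "\<And>t. 0 < t \<Longrightarrow> (\<phi>' has_vector_derivative \<phi>'' t) (at t)"
    and g1: "\<And>t. 0 < t \<Longrightarrow> \<bar>\<phi>' t\<bar> \<le> g1 t" "g1 integrable_on {0..k}" "\<And>t. 0 \<le> g1 t"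
    and g2: "\<And>t. 0 < t \<Longrightarrow> \<bar>\<phi>'' t\<bar> \<le> g2 t" "\<And>T. g2 integrable_on {k..T}" "\<And>t. 0 \<le> g2 t"
  shows "\<bar>\<phi> s - (\<Sum>l\<le>n. \<phi> (real l * k) * hat ((s - real l * k) / k))\<bar>
    \<le> integral {0..k} g1 + k * integral {k..real n * k} g2"
proof -
  \<comment> \<open>Capped at n - 1 so that s = nk falls into the last cell, with \<theta> =
    1.\<close>
  define j where "j = min (nat \<lfloor>s / k\<rfloor>) (n - 1)"
  define \<theta> where "\<theta> = s / k - real j"
  have sk: "0 \<le> s / k" "s / k \<le> real n" using s k by (auto simp: field_simps)
  have j: "j < n" using n by (auto simp: j_def)
  have \<theta>: "0 \<le> \<theta>" "\<theta> \<le> 1"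
  proof -
    define m where "m = nat \<lfloor>s / k\<rfloor>"
    have "real m = of_int \<lfloor>s / k\<rfloor>" using sk by (simp add: m_def)
    hence m: "real m \<le> s / k" "s / k < real m + 1" using floor_correct[of "s / k"] by linarith+
    show "0 \<le> \<theta>" "\<theta> \<le> 1"
    proof -
      have "j = m \<or> n \<le> m \<and> real j = real n - 1"
        using n unfolding j_def m_def[symmetric] by (auto simp: min_def)
      hence "real j \<le> s / k \<and> s / k \<le> real j + 1" using m sk by auto
      thus "0 \<le> \<theta>" "\<theta> \<le> 1" by (auto simp: \<theta>_def)
    qed
  qed
  have s_eq: "s = (real j + \<theta>) * k" using k by (simp add: \<theta>_def)
  define a where "a = real j * k"
  have s_eq': "s = a + \<theta> * (real (Suc j) * k - a)" unfolding s_eq a_def by (simp add: algebra_simps)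
  have I: "(\<Sum>l\<le>n. \<phi> (real l * k) * hat ((s - real l * k) / k)) = (1 - \<theta>) * \<phi> a + \<theta> * \<phi> (real (Suc j) * k)"
    unfolding s_eq a_def by (rule hat_sum_linear_interp[OF k \<theta> j])
  have nonneg: "0 \<le> integral {0..k} g1" "0 \<le> k * integral {k..real n * k} g2"
    using g1 g2 k by (auto intro!: mult_nonneg_nonneg integral_nonneg)
  show ?thesis
  proof (cases "j = 0")
    case True
    have "\<bar>\<phi> (0 + \<theta> * (k - 0)) - ((1 - \<theta>) * \<phi> 0 + \<theta> * \<phi> k)\<bar> \<le> integral {0..k} g1"
      using k g1 \<theta> deriv
      by (intro linear_interp_error[where \<phi>' = \<phi>'] continuous_on_subset[OF cont]) auto
    thus ?thesis using True nonneg unfolding I unfolding s_eq a_def by simp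
  next
    case False
    define b where "b = real (Suc j) * k"
    have "1 * k \<le> real j * k" using False k by (intro mult_right_mono) auto
    hence ak: "k \<le> a" by (simp add: a_def)
    have ab: "b = a + k" by (simp add: a_def b_def algebra_simps)
    have bn: "b \<le> real n * k" unfolding b_def using j k by (intro mult_right_mono) auto
    define D where "D = integral {a..b} g2"
    have g2_int: "g2 integrable_on {x..y}" if "k \<le> x" for x y
      using integrable_on_subinterval[OF g2(2)[of y]] that by auto
    have D: "0 \<le> D" unfolding D_def using g2 g2_int[OF ak] by (intro integral_nonneg) auto
    have osc: "\<bar>\<phi>' t - \<phi>' a\<bar> \<le> D" if t: "t \<in> {a<..<b}" for t
    proof -
      have "norm (\<phi>' t - \<phi>' a) \<le> integral {a..t} g2"
        using t ak k g2 deriv2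
        by (intro norm_diff_le_integral[where F' = \<phi>''] g2_int continuous_at_imp_continuous_on ballI
            has_vector_derivative_continuous[OF deriv2]) auto
      also have "\<dots> \<le> D" unfolding D_def using t ak g2 by (intro integral_subset_le g2_int) auto
      finally show ?thesis by simp
    qed
    \<comment> \<open>Subtracting a linear function leaves the interpolation error unchanged and
      turns the derivative into the oscillation of \<phi>'.\<close>
    define G where "G r = \<phi> r - r * \<phi>' a" for r
    have "\<bar>G (a + \<theta> * (b - a)) - ((1 - \<theta>) * G a + \<theta> * G b)\<bar> \<le> integral {a..b} (\<lambda>_. D)"
    proof (rule linear_interp_error[where \<phi>' = "\<lambda>r. \<phi>' r - \<phi>' a"])
      show "continuous_on {a..b} G" unfolding G_def
        using ak k by (intro continuous_intros continuous_on_subset[OF cont]) auto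
      show "(G has_vector_derivative \<phi>' t - \<phi>' a) (at t)" if "t \<in> {a<..<b}" for t
        unfolding G_def using that ak k by (auto intro!: derivative_eq_intros deriv)
    qed (use ab k \<theta> osc D in auto)
    also have "G (a + \<theta> * (b - a)) - ((1 - \<theta>) * G a + \<theta> * G b) = \<phi> s - ((1 - \<theta>) * \<phi> a + \<theta> * \<phi> b)"
      unfolding s_eq' G_def b_def[symmetric] by (simp add: algebra_simps)
    also have "integral {a..b} (\<lambda>_. D) = k * D" using ab k by simp
    also have "k * D \<le> k * integral {k..real n * k} g2"
      unfolding D_def using k ak bn g2 by (intro mult_left_mono integral_subset_le g2_int) auto
    finally show ?thesis unfolding I b_def using nonneg by simp
  qed
qed

lemma kernel_integral_bound:
  fixes \<beta> h :: "real \<Rightarrow> real"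
  assumes \<beta>: "\<beta> absolutely_integrable_on {0<..}" and t: "0 \<le> t" and h: "continuous_on UNIV h"
  shows "(\<lambda>x. \<beta> x * h x) integrable_on {0..t}"
    and "(\<And>x. x \<in> {0..t} \<Longrightarrow> \<bar>h x\<bar> \<le> M) \<Longrightarrow> \<bar>integral {0..t} (\<lambda>x. \<beta> x * h x)\<bar> \<le> M * integral {0<..} (\<lambda>x. \<bar>\<beta> x\<bar>)"
proof -
  obtain B where B: "integrable lborel B" "\<And>x. x \<le> 0 \<Longrightarrow> B x = 0" "AE x in lborel. x \<in> {0<..} \<longrightarrow> \<beta> x = B x"
    using abs_integrable_borel_version[OF \<beta>] by blast
  have "bounded (h ` {0..t})"
    using compact_continuous_image[of "{0..t}" h] h continuous_on_subset by (blast intro: compact_imp_bounded)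
  then obtain C where C: "\<forall>x\<in>{0..t}. \<bar>h x\<bar> \<le> C" by (auto simp: bounded_iff)
  have hm: "h \<in> borel_measurable borel" using h by (rule borel_measurable_continuous_onI)
  show int: "(\<lambda>x. \<beta> x * h x) integrable_on {0..t}"
    using kernel_has_integral[OF B _ _ hm, of "{0..t}" C] C by (auto simp: integrable_on_def)
  assume M: "\<And>x. x \<in> {0..t} \<Longrightarrow> \<bar>h x\<bar> \<le> M"
  have M0: "0 \<le> M" using M[of 0] t by auto
  have abs_int: "(\<lambda>x. \<bar>\<beta> x\<bar>) integrable_on {0<..}"
    using \<beta>[unfolded absolutely_integrable_on_def] by simp
  have sub: "(\<lambda>x. \<bar>\<beta> x\<bar>) integrable_on {0<..t}"
  proof -
    have "\<beta> absolutely_integrable_on {0<..t}" by (rule set_integrable_subset[OF \<beta>]) auto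
    thus ?thesis by (simp add: absolutely_integrable_on_def)
  qed
  have eq: "integral {0..t} (\<lambda>x. \<beta> x * h x) = integral {0<..t} (\<lambda>x. \<beta> x * h x)"
    by (rule integral_spike_set) (auto intro: negligible_subset[of "{0}"])
  have int': "(\<lambda>x. \<beta> x * h x) integrable_on {0<..t}"
    using int by (rule integrable_spike_set) (auto intro: negligible_subset[of "{0}"])
  have "norm (integral {0<..t} (\<lambda>x. \<beta> x * h x)) \<le> integral {0<..t} (\<lambda>x. M * \<bar>\<beta> x\<bar>)"
    using int' sub M mult_left_mono[OF M abs_ge_zero]
    by (intro Henstock_Kurzweil_Integration.integral_norm_bound_integral integrable_on_mult_right)
       (auto simp: abs_mult mult.commute)
  also have "\<dots> = M * integral {0<..t} (\<lambda>x. \<bar>\<beta> x\<bar>)" by simp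
  also have "\<dots> \<le> M * integral {0<..} (\<lambda>x. \<bar>\<beta> x\<bar>)"
    using M0 sub abs_int by (intro mult_left_mono integral_subset_le) auto
  finally show "\<bar>integral {0..t} (\<lambda>x. \<beta> x * h x)\<bar> \<le> M * integral {0<..} (\<lambda>x. \<bar>\<beta> x\<bar>)" by (simp add: eq)
qed

text \<open>Product integration: after reflection each weight integrates \<open>\<beta>\<close>
  against the hat of its node, and outside the original domains the hats vanish within [0,t], so all
  integrals extend to this interval.\<close>

lemma interp_quad_eq_integral:
  fixes \<psi> :: "nat \<Rightarrow> real"
  assumes \<beta>: "\<beta> absolutely_integrable_on {0<..}" and k: "0 < k" and n: "0 < n"
  shows "interp_quad k \<beta> n \<psi> =
    integral {0..real n * k} (\<lambda>x. \<beta> x * (\<Sum>l\<le>n. \<psi> l * hat (((real n * k - x) - real l * k) / k)))"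
proof -
  define t where "t = real n * k"
  define W where "W l = integral {0..t} (\<lambda>x. \<beta> x * hat (((t - x) - real l * k) / k))" for l
  have hat0: "hat (y / k) = 0" if "k \<le> \<bar>y\<bar>" for y
    using that k by (simp add: hat_def)
  have kt: "k \<le> t" using n k mult_right_mono[of 1 "real n" k] by (simp add: t_def)
  have "iq_start k \<beta> n = integral {t - k..t - 0} (\<lambda>x. \<beta> x * hat ((t - x) / k))"
    unfolding iq_start_def t_def[symmetric]
    using integral_reflect_shift[of 0 k "\<lambda>x. \<beta> x * hat ((t - x) / k)" t] by simp
  also have "\<dots> = integral {0..t} (\<lambda>x. \<beta> x * hat ((t - x) / k))"
    using kt by (intro integral_superset_eq) (auto intro!: hat0)
  finally have start: "iq_start k \<beta> n = W 0" by (simp add: W_def)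
  have weight: "iq_weight k \<beta> (n - l) = W l" if l: "l \<in> {1..n}" for l
  proof -
    define d where "d = t - real l * k"
    have d: "real (n - l) * k = d" using l by (simp add: d_def t_def of_nat_diff algebra_simps)
    have d0: "0 \<le> d" using k unfolding d[symmetric] by simp
    have "1 * k \<le> real l * k" using l k by (intro mult_right_mono) auto
    hence dk: "d + k \<le> t" by (simp add: d_def)
    have "iq_weight k \<beta> (n - l) = integral {d - min k d..d - - k} (\<lambda>x. \<beta> x * hat ((d - x) / k))"
      unfolding iq_weight_def d
      using integral_reflect_shift[of "- k" "min k d" "\<lambda>x. \<beta> x * hat ((d - x) / k)" d] by simp
    also have "\<dots> = integral {0..t} (\<lambda>x. \<beta> x * hat ((d - x) / k))"
      using dk d0 k by (intro integral_superset_eq) (auto intro!: hat0 simp: min_def split: if_splits)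
    also have "\<dots> = W l" by (simp add: W_def d_def algebra_simps)
    finally show ?thesis .
  qed
  have hat_cont: "continuous_on UNIV (\<lambda>x. hat (((t - x) - real l * k) / k))" for l
    unfolding hat_def using k by (intro continuous_intros) auto
  have t: "0 \<le> t" using kt k by simp
  have "interp_quad k \<beta> n \<psi> = (\<Sum>l\<in>insert 0 {1..n}. \<psi> l * W l)"
    unfolding interp_quad_def start using weight by (simp add: mult.commute)
  also have "insert 0 {1..n} = {..n}" by auto
  also have "(\<Sum>l\<le>n. \<psi> l * W l) = integral {0..t} (\<lambda>x. \<Sum>l\<le>n. \<psi> l * (\<beta> x * hat (((t - x) - real l * k) / k)))"
    unfolding W_def using kernel_integral_bound(1)[OF \<beta> t hat_cont]
    by (subst Henstock_Kurzweil_Integration.integral_sum) (auto intro!: integrable_on_mult_right)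
  also have "\<dots> = integral {0..t} (\<lambda>x. \<beta> x * (\<Sum>l\<le>n. \<psi> l * hat (((t - x) - real l * k) / k)))"
    by (simp add: sum_distrib_left mult_ac)
  finally show ?thesis by (simp add: t_def)
qed

lemma interp_quad_error:
  fixes \<phi> :: "real \<Rightarrow> real"
  assumes \<beta>: "\<beta> absolutely_integrable_on {0<..}" and k: "0 < k" and n: "0 < n"
    and cont: "continuous_on {0..} \<phi>"
    and M: "\<And>s. s \<in> {0..real n * k} \<Longrightarrow> \<bar>\<phi> s - (\<Sum>l\<le>n. \<phi> (real l * k) * hat ((s - real l * k) / k))\<bar> \<le> M"
  shows "\<bar>integral {0..real n * k} (\<lambda>s. \<beta> (real n * k - s) * \<phi> s) - interp_quad k \<beta> n (\<lambda>l. \<phi> (real l * k))\<bar>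
    \<le> M * integral {0<..} (\<lambda>x. \<bar>\<beta> x\<bar>)"
proof -
  define t where "t = real n * k"
  have t: "0 \<le> t" using k by (simp add: t_def)
  \<comment> \<open>Clamping makes the reflected \<phi> continuous on the whole line without
    changing it on [0,t].\<close>
  define \<Phi> where "\<Phi> x = \<phi> (max 0 (t - x))" for x
  define I where "I x = (\<Sum>l\<le>n. \<phi> (real l * k) * hat (((t - x) - real l * k) / k))" for x
  have \<Phi>: "continuous_on UNIV \<Phi>" unfolding \<Phi>_def
    by (rule continuous_on_compose2[OF cont]) (auto intro!: continuous_intros)
  have I: "continuous_on UNIV I" unfolding I_def hat_def using k by (intro continuous_intros) auto
  have "integral {0..t} (\<lambda>s. \<beta> (t - s) * \<phi> s) = integral {0..t} (\<lambda>x. \<beta> x * \<phi> (t - x))"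
    using integral_reflect_shift[of 0 t "\<lambda>x. \<beta> x * \<phi> (t - x)" t] by simp
  also have "\<dots> = integral {0..t} (\<lambda>x. \<beta> x * \<Phi> x)"
    by (intro Henstock_Kurzweil_Integration.integral_cong) (simp add: \<Phi>_def)
  finally have "integral {0..t} (\<lambda>s. \<beta> (t - s) * \<phi> s) - interp_quad k \<beta> n (\<lambda>l. \<phi> (real l * k)) =
      integral {0..t} (\<lambda>x. \<beta> x * \<Phi> x - \<beta> x * I x)"
    unfolding interp_quad_eq_integral[OF \<beta> k n] t_def[symmetric] I_def[symmetric]
    using kernel_integral_bound(1)[OF \<beta> t \<Phi>] kernel_integral_bound(1)[OF \<beta> t I]
    by (simp add: Henstock_Kurzweil_Integration.integral_diff)
  also have "\<dots> = integral {0..t} (\<lambda>x. \<beta> x * (\<Phi> x - I x))" by (simp add: right_diff_distrib)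
  finally have eq: "integral {0..t} (\<lambda>s. \<beta> (t - s) * \<phi> s) - interp_quad k \<beta> n (\<lambda>l. \<phi> (real l * k)) = \<dots>" .
  have "\<bar>integral {0..t} (\<lambda>x. \<beta> x * (\<Phi> x - I x))\<bar> \<le> M * integral {0<..} (\<lambda>x. \<bar>\<beta> x\<bar>)"
  proof (rule kernel_integral_bound(2)[OF \<beta> t])
    show "continuous_on UNIV (\<lambda>x. \<Phi> x - I x)" by (intro continuous_intros \<Phi> I)
    show "\<bar>\<Phi> x - I x\<bar> \<le> M" if "x \<in> {0..t}" for x
      using M[of "t - x"] that by (simp add: \<Phi>_def I_def t_def)
  qed
  thus ?thesis using eq unfolding t_def by simp
qed

section \<open>Consistency of the convolution quadrature\<close>

lemma continuous_mult_abs_integrable: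
  fixes f h :: "real \<Rightarrow> real"
  assumes "continuous_on {a..b} h" "f absolutely_integrable_on {a..b}"
  shows "(\<lambda>x. h x * f x) absolutely_integrable_on {a..b}"
proof (rule absolutely_integrable_bounded_measurable_product_real[OF _ _ _ assms(2)])
  show "h \<in> borel_measurable (lebesgue_on {a..b})"
    using assms(1) by (intro continuous_imp_measurable_on_sets_lebesgue) auto
  show "bounded (h ` {a..b})"
    using compact_continuous_image[OF assms(1)] by (simp add: compact_imp_bounded)
qed auto

text \<open>The starting weight makes the quadrature exact on constants. Taylor's formula at 0 then
  leaves the error on the ramp starting at 0, times \<phi>'(0), and the errors on the later ramps,
  integrated against \<phi>''. The last cell uses the crude bound 1, the rest the decaying
  bound.\<close>

lemma conv_quad_error:
  fixes \<phi> :: "real \<Rightarrow> real"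
  assumes \<alpha>: "0 < \<alpha>" "\<alpha> < 1" and \<omega>: "cq_weights \<alpha> \<omega>" and k: "0 < k" and n: "0 < n"
    and \<beta>: "\<And>t. 0 < t \<Longrightarrow> \<beta> t = t powr (\<alpha> - 1) / Gamma \<alpha>"
    and cont: "continuous_on {0..} \<phi>" and cont': "continuous_on {0..} \<phi>'"
    and deriv: "\<And>t. 0 < t \<Longrightarrow> (\<phi> has_vector_derivative \<phi>' t) (at t)"
    and deriv2: "\<And>t. 0 < t \<Longrightarrow> (\<phi>' has_vector_derivative \<phi>'' t) (at t)"
    and g: "\<And>t. 0 < t \<Longrightarrow> \<bar>\<phi>'' t\<bar> \<le> g t" "\<And>T. g integrable_on {0..T}" "\<And>t. 0 \<le> g t"
  defines "C \<equiv> (if n = 1 then 1 else 2::real)"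
  shows "\<bar>integral {0..real n * k} (\<lambda>s. \<beta> (real n * k - s) * \<phi> s) - conv_quad k \<alpha> \<beta> \<omega> n (\<lambda>l. \<phi> (real l * k))\<bar>
    \<le> C * (k\<^sup>2 * (real n * k) powr (\<alpha> - 1) * \<bar>\<phi>' 0\<bar> + k powr (\<alpha> + 1) * integral {real (n - 1) * k..real n * k} g
        + k\<^sup>2 * integral {0..real (n - 1) * k} (\<lambda>\<zeta>. (real n * k - \<zeta>) powr (\<alpha> - 1) * g \<zeta>))"
proof -
  define t where "t = real n * k"
  define r where "r = real (n - 1) * k"
  have tr: "t = r + k" "0 \<le> r" "0 < t"
    using n k by (simp_all add: t_def r_def of_nat_diff algebra_simps)
  have C: "1 \<le> C" by (simp add: C_def)
  \<comment> \<open>\<open>K1\<close> and \<open>K2\<close> are the first two iterated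
    antiderivatives of \<open>\<beta>\<close> vanishing at 0; \<open>K2 (t - s)\<close> is the exact
    memory integral of the ramp starting at s.\<close>
  define K1 where "K1 x = x powr \<alpha> / Gamma (1 + \<alpha>)" for x
  define K2 where "K2 x = x powr (1 + \<alpha>) / Gamma (2 + \<alpha>)" for x
  have notin: "\<alpha> \<notin> \<int>\<^sub>\<le>\<^sub>0" "1 + \<alpha> \<notin> \<int>\<^sub>\<le>\<^sub>0" using \<alpha> by (auto elim!: nonpos_Ints_cases)
  have G: "Gamma (1 + \<alpha>) = \<alpha> * Gamma \<alpha>" "Gamma (2 + \<alpha>) = (1 + \<alpha>) * Gamma (1 + \<alpha>)" "0 < Gamma \<alpha>" "0 < Gamma (1 + \<alpha>)"
    using Gamma_plus1[OF notin(1)] Gamma_plus1[OF notin(2)] Gamma_real_pos[of \<alpha>] Gamma_real_pos[of "1 + \<alpha>"] \<alpha>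
    by (simp_all add: add_ac)
  have dK1: "(K1 has_real_derivative \<beta> x) (at x)" if "0 < x" for x
  proof -
    have "(K1 has_real_derivative \<alpha> * x powr (\<alpha> - 1) / Gamma (1 + \<alpha>)) (at x)"
      unfolding K1_def using that by (intro DERIV_cdivide has_real_derivative_powr)
    thus ?thesis using \<alpha> by (simp add: \<beta>[OF that] G(1))
  qed
  have dK2: "(K2 has_real_derivative K1 x) (at x)" if "0 < x" for x
  proof -
    have "(K2 has_real_derivative (1 + \<alpha>) * x powr (1 + \<alpha> - 1) / Gamma (2 + \<alpha>)) (at x)"
      unfolding K2_def using that by (intro DERIV_cdivide has_real_derivative_powr)
    thus ?thesis using \<alpha> by (simp add: K1_def G(2))
  qed
  have cK: "continuous_on {0..t} (\<lambda>s. K1 (t - s))" "continuous_on {0..t} (\<lambda>s. K2 (t - s))" "continuous_on {0..t} K1"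
  proof -
    have cp: "continuous_on {0..t} (\<lambda>s. h s powr a / c)"
      if "continuous_on {0..t} h" "\<And>s. s \<in> {0..t} \<Longrightarrow> 0 \<le> h s" "0 < a" for h :: "real \<Rightarrow> real" and a c
    proof -
      have "continuous_on {0..t} (\<lambda>s. h s powr a)"
        using that by (intro continuous_on_powr' continuous_on_const) auto
      thus ?thesis unfolding divide_inverse by (intro continuous_on_mult continuous_on_const)
    qed
    show "continuous_on {0..t} (\<lambda>s. K1 (t - s))" "continuous_on {0..t} (\<lambda>s. K2 (t - s))" "continuous_on {0..t} K1"
      unfolding K1_def[abs_def] K2_def by (rule cp; use \<alpha> in \<open>auto intro!: continuous_intros\<close>)+
  qed
  have K0: "K1 0 = 0" "K2 0 = 0" using \<alpha> by (simp_all add: K1_def K2_def)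
  have intK1: "integral {0..t} \<beta> = K1 t"
  proof -
    have "(\<beta> has_integral (K1 t - K1 0)) {0..t}"
      using tr cK dK1 by (intro fundamental_theorem_of_calculus_interior)
        (auto simp: has_real_derivative_iff_has_vector_derivative)
    thus ?thesis by (simp add: K0 integral_unique)
  qed

  \<comment> \<open>The hypotheses do not constrain \<phi>'' at 0; the value 0 there makes the
    majorant g valid everywhere.\<close>
  define \<phi>2 where "\<phi>2 s = (if 0 < s then \<phi>'' s else 0)" for s
  have d2: "(\<phi>' has_vector_derivative \<phi>2 s) (at s)" if "0 < s" for s using deriv2[OF that] that by (simp add: \<phi>2_def)
  have \<phi>2g: "\<bar>\<phi>2 s\<bar> \<le> g s" for s using g(1)[of s] g(3)[of s] by (simp add: \<phi>2_def)
  have cont_on: "continuous_on {0..T} \<phi>" "continuous_on {0..T} \<phi>'" for T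
    using cont cont' by (auto intro: continuous_on_subset)
  have "(\<phi>2 has_integral (\<phi>' t - \<phi>' 0)) {0..t}"
    using tr d2 by (intro fundamental_theorem_of_calculus_interior cont_on) auto
  hence \<phi>2_abs: "\<phi>2 absolutely_integrable_on {0..t}"
    using \<phi>2g g(2) by (intro absolutely_integrable_integrable_bound[where g = g]) auto
  have mult_int: "(\<lambda>s. h s * \<phi>2 s) integrable_on {0..t}" if "continuous_on {0..t} h" for h
    using continuous_mult_abs_integrable[OF that \<phi>2_abs] by (simp add: absolutely_integrable_on_def)

  have A: "((\<lambda>s. \<beta> (t - s) * \<phi> s) has_integral
      (K1 t * \<phi> 0 + K2 t * \<phi>' 0 + integral {0..t} (\<lambda>s. K2 (t - s) * \<phi>2 s))) {0..t}"
  proof -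
    define H where "H s = - (K1 (t - s) * \<phi> s) - K2 (t - s) * \<phi>' s" for s
    have "((\<lambda>s. \<beta> (t - s) * \<phi> s - K2 (t - s) * \<phi>2 s) has_integral (H t - H 0)) {0..t}"
    proof (rule fundamental_theorem_of_calculus_interior)
      show "continuous_on {0..t} H" unfolding H_def by (intro continuous_intros cK cont_on)
      fix s assume s: "s \<in> {0<..<t}"
      have ts: "((\<lambda>s. t - s) has_real_derivative - 1) (at s)" by (auto intro!: derivative_eq_intros)
      have "((\<lambda>s. K1 (t - s)) has_real_derivative \<beta> (t - s) * (- 1)) (at s)"
        "((\<lambda>s. K2 (t - s)) has_real_derivative K1 (t - s) * (- 1)) (at s)"
        using s by (simp_all only: DERIV_chain2[OF dK1 ts] DERIV_chain2[OF dK2 ts] greaterThanLessThan_iff diff_gt_0_iff_gt)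
      moreover have "(\<phi> has_real_derivative \<phi>' s) (at s)" "(\<phi>' has_real_derivative \<phi>2 s) (at s)"
        using deriv[of s] d2[of s] s by (auto simp: has_real_derivative_iff_has_vector_derivative)
      ultimately have "(H has_real_derivative (\<beta> (t - s) * \<phi> s - K2 (t - s) * \<phi>2 s)) (at s)"
        unfolding H_def by (auto intro!: derivative_eq_intros)
      thus "(H has_vector_derivative (\<beta> (t - s) * \<phi> s - K2 (t - s) * \<phi>2 s)) (at s)"
        by (simp add: has_real_derivative_iff_has_vector_derivative)
    qed (use tr in auto)
    from has_integral_add[OF this integrable_integral[OF mult_int[OF cK(2)]]]
    show ?thesis by (simp add: H_def K0 add_ac)
  qed
  have B: "((\<lambda>s. max (real p * k - s) 0 * \<phi>2 s) has_integral (\<phi> (real p * k) - \<phi> 0 - real p * k * \<phi>' 0)) {0..t}"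
    if p: "p \<in> {1..n}" for p
  proof -
    define q where "q = real p * k"
    have q: "0 \<le> q" "q \<le> t" using p k by (auto simp: q_def t_def intro!: mult_right_mono)
    have "((\<lambda>s. (q - s) * \<phi>2 s) has_integral (((q - q) * \<phi>' q + \<phi> q) - ((q - 0) * \<phi>' 0 + \<phi> 0))) {0..q}"
    proof (rule fundamental_theorem_of_calculus_interior)
      show "continuous_on {0..q} (\<lambda>s. (q - s) * \<phi>' s + \<phi> s)" by (intro continuous_intros cont_on)
      fix s assume s: "s \<in> {0<..<q}"
      have "(\<phi> has_real_derivative \<phi>' s) (at s)" "(\<phi>' has_real_derivative \<phi>2 s) (at s)"
        using deriv[of s] d2[of s] s by (auto simp: has_real_derivative_iff_has_vector_derivative)
      hence "((\<lambda>s. (q - s) * \<phi>' s + \<phi> s) has_real_derivative ((q - s) * \<phi>2 s)) (at s)"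
        by (auto intro!: derivative_eq_intros)
      thus "((\<lambda>s. (q - s) * \<phi>' s + \<phi> s) has_vector_derivative ((q - s) * \<phi>2 s)) (at s)"
        by (simp add: has_real_derivative_iff_has_vector_derivative)
    qed (use q in auto)
    hence "((\<lambda>s. max (q - s) 0 * \<phi>2 s) has_integral (\<phi> q - \<phi> 0 - q * \<phi>' 0)) {0..q}"
      by (subst has_integral_cong[where g = "\<lambda>s. (q - s) * \<phi>2 s"]) (auto simp: algebra_simps)
    thus ?thesis unfolding q_def[symmetric]
      by (rule has_integral_on_superset) (use q in \<open>auto simp: \<phi>2_def\<close>)
  qed

  \<comment> \<open>The Peano kernel: the quadrature error on the ramp starting at s. Rescaling by x
    = (t - s)/k reduces it to the ramp errors of the weights.\<close>
  define \<kappa> where "\<kappa> s = K2 (t - s) - k powr \<alpha> * (\<Sum>p=1..n. \<omega> (n - p) * max (real p * k - s) 0)" for s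
  have \<kappa>_cont: "continuous_on {0..t} \<kappa>" unfolding \<kappa>_def by (intro continuous_intros cK)
  have "conv_quad k \<alpha> \<beta> \<omega> n (\<lambda>l. \<phi> (real l * k)) =
      K1 t * \<phi> 0 + k powr \<alpha> * (\<Sum>p=1..n. \<omega> (n - p) * (\<phi> (real p * k) - \<phi> 0))"
    unfolding conv_quad_def cq_start_def t_def[symmetric] intK1
    by (simp add: sum_subtractf right_diff_distrib left_diff_distrib sum_distrib_right sum_distrib_left mult_ac)
  also have "(\<Sum>p=1..n. \<omega> (n - p) * (\<phi> (real p * k) - \<phi> 0)) =
      (\<Sum>p=1..n. \<omega> (n - p) * (real p * k)) * \<phi>' 0 +
      (\<Sum>p=1..n. integral {0..t} (\<lambda>s. \<omega> (n - p) * (max (real p * k - s) 0 * \<phi>2 s)))"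
  proof -
    have "\<omega> (n - p) * (\<phi> (real p * k) - \<phi> 0) =
        \<omega> (n - p) * (real p * k) * \<phi>' 0 + integral {0..t} (\<lambda>s. \<omega> (n - p) * (max (real p * k - s) 0 * \<phi>2 s))"
      if "p \<in> {1..n}" for p
    proof -
      have "integral {0..t} (\<lambda>s. \<omega> (n - p) * (max (real p * k - s) 0 * \<phi>2 s)) =
          \<omega> (n - p) * (\<phi> (real p * k) - \<phi> 0 - real p * k * \<phi>' 0)"
        by (rule integral_unique[OF has_integral_mult_right[OF B[OF that]]])
      thus ?thesis by (simp add: algebra_simps)
    qed
    thus ?thesis by (simp add: sum.distrib sum_distrib_right)
  qed
  also have "(\<Sum>p=1..n. integral {0..t} (\<lambda>s. \<omega> (n - p) * (max (real p * k - s) 0 * \<phi>2 s))) =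
      integral {0..t} (\<lambda>s. (\<Sum>p=1..n. \<omega> (n - p) * max (real p * k - s) 0) * \<phi>2 s)"
    using B by (subst Henstock_Kurzweil_Integration.integral_sum[symmetric])
      (auto intro!: integrable_on_mult_right simp: sum_distrib_right mult.assoc)
  finally have cq: "conv_quad k \<alpha> \<beta> \<omega> n (\<lambda>l. \<phi> (real l * k)) = K1 t * \<phi> 0 +
      k powr \<alpha> * ((\<Sum>p=1..n. \<omega> (n - p) * (real p * k)) * \<phi>' 0 +
        integral {0..t} (\<lambda>s. (\<Sum>p=1..n. \<omega> (n - p) * max (real p * k - s) 0) * \<phi>2 s))" .
  have err: "integral {0..t} (\<lambda>s. \<beta> (t - s) * \<phi> s) - conv_quad k \<alpha> \<beta> \<omega> n (\<lambda>l. \<phi> (real l * k)) =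
      \<kappa> 0 * \<phi>' 0 + integral {0..t} (\<lambda>s. \<kappa> s * \<phi>2 s)"
  proof -
    have i1: "(\<lambda>s. K2 (t - s) * \<phi>2 s) integrable_on {0..t}" by (rule mult_int[OF cK(2)])
    have i2: "(\<lambda>s. (\<Sum>p=1..n. \<omega> (n - p) * max (real p * k - s) 0) * \<phi>2 s) integrable_on {0..t}"
      by (rule mult_int) (intro continuous_intros)
    have "integral {0..t} (\<lambda>s. \<kappa> s * \<phi>2 s) = integral {0..t} (\<lambda>s. K2 (t - s) * \<phi>2 s -
        k powr \<alpha> * ((\<Sum>p=1..n. \<omega> (n - p) * max (real p * k - s) 0) * \<phi>2 s))"
      by (simp add: \<kappa>_def algebra_simps)
    also have "\<dots> = integral {0..t} (\<lambda>s. K2 (t - s) * \<phi>2 s) -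
        integral {0..t} (\<lambda>s. k powr \<alpha> * ((\<Sum>p=1..n. \<omega> (n - p) * max (real p * k - s) 0) * \<phi>2 s))"
      by (rule Henstock_Kurzweil_Integration.integral_diff[OF i1 integrable_on_mult_right[OF i2]])
    also have "integral {0..t} (\<lambda>s. k powr \<alpha> * ((\<Sum>p=1..n. \<omega> (n - p) * max (real p * k - s) 0) * \<phi>2 s)) =
        k powr \<alpha> * integral {0..t} (\<lambda>s. (\<Sum>p=1..n. \<omega> (n - p) * max (real p * k - s) 0) * \<phi>2 s)"
      by (rule Henstock_Kurzweil_Integration.integral_mult_right)
    finally have "integral {0..t} (\<lambda>s. \<kappa> s * \<phi>2 s) = integral {0..t} (\<lambda>s. K2 (t - s) * \<phi>2 s) -
        k powr \<alpha> * integral {0..t} (\<lambda>s. (\<Sum>p=1..n. \<omega> (n - p) * max (real p * k - s) 0) * \<phi>2 s)" .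
    moreover have "\<kappa> 0 = K2 t - k powr \<alpha> * (\<Sum>p=1..n. \<omega> (n - p) * (real p * k))"
      using k by (simp add: \<kappa>_def)
    ultimately show ?thesis unfolding integral_unique[OF A] cq by algebra
  qed

  have \<kappa>_eq: "\<kappa> s = k powr (1 + \<alpha>) * (x powr (1 + \<alpha>) / Gamma (2 + \<alpha>) - (\<Sum>j<n. \<omega> j * max (x - real j) 0))"
    if s: "s \<le> t" and x: "x = (t - s) / k" for s x
  proof -
    have ts: "t - s = k * x" "0 \<le> x" using s x k by auto
    have "(\<Sum>p=1..n. \<omega> (n - p) * max (real p * k - s) 0) = (\<Sum>j<n. \<omega> j * max (real (n - j) * k - s) 0)"
      by (rule sum.reindex_bij_witness[where i = "\<lambda>j. n - j" and j = "\<lambda>p. n - p"]) auto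
    also have "\<dots> = (\<Sum>j<n. k * (\<omega> j * max (x - real j) 0))"
    proof (rule sum.cong[OF refl])
      fix j assume "j \<in> {..<n}"
      hence "real (n - j) * k - s = k * (x - real j)"
        using ts(1) by (simp add: of_nat_diff t_def algebra_simps)
      moreover have "max (k * (x - real j)) 0 = k * max (x - real j) 0"
        using k by (simp add: max_def zero_le_mult_iff mult_le_0_iff)
      ultimately show "\<omega> j * max (real (n - j) * k - s) 0 = k * (\<omega> j * max (x - real j) 0)" by simp
    qed
    also have "k powr \<alpha> * \<dots> = k powr (1 + \<alpha>) * (\<Sum>j<n. \<omega> j * max (x - real j) 0)"
      using k by (simp add: sum_distrib_left[symmetric] powr_add)
    finally show ?thesis
      unfolding \<kappa>_def K2_def ts(1) using k ts(2) by (simp add: powr_mult right_diff_distrib)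
  qed
  have \<kappa>_near: "\<bar>\<kappa> s\<bar> \<le> k powr (\<alpha> + 1)" if "s \<in> {r..t}" for s
  proof -
    have x: "0 \<le> (t - s) / k" "(t - s) / k \<le> 1" using that tr k by (auto simp: field_simps)
    have "s \<le> t" using that by simp
    from mult_left_mono[OF cq_kernel_error_start[OF \<alpha> \<omega> x n], of "k powr (1 + \<alpha>)"] \<kappa>_eq[OF this refl]
    have "\<bar>\<kappa> s\<bar> \<le> k powr (1 + \<alpha>) * 1" by (simp add: abs_mult)
    thus ?thesis by (simp add: add.commute)
  qed
  have \<kappa>_far: "\<bar>\<kappa> s\<bar> \<le> 2 * (k\<^sup>2 * (t - s) powr (\<alpha> - 1))" if "s \<in> {0..r}" for s
  proof -
    define x where "x = (t - s) / k"
    have x: "1 \<le> x" "x \<le> real n" using that tr k by (auto simp: x_def t_def field_simps)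
    have "\<bar>\<kappa> s\<bar> = k powr (1 + \<alpha>) * \<bar>x powr (1 + \<alpha>) / Gamma (2 + \<alpha>) - (\<Sum>j<n. \<omega> j * max (x - real j) 0)\<bar>"
      using \<kappa>_eq[OF _ x_def] that tr k by (simp add: abs_mult)
    also have "\<dots> \<le> k powr (1 + \<alpha>) * (2 * x powr (\<alpha> - 1))"
      using cq_kernel_error[OF \<alpha> \<omega> x] by (intro mult_left_mono) auto
    also have "\<dots> = 2 * (k\<^sup>2 * (t - s) powr (\<alpha> - 1))"
    proof -
      have "k powr (1 + \<alpha>) = k\<^sup>2 * k powr (\<alpha> - 1)"
        using k by (simp add: powr_add powr_diff power2_eq_square)
      moreover have "x powr (\<alpha> - 1) = (t - s) powr (\<alpha> - 1) / k powr (\<alpha> - 1)"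
        unfolding x_def by (rule powr_divide)
      ultimately show ?thesis using k by simp
    qed
    finally show ?thesis .
  qed
  \<comment> \<open>For n = 1 the point 0 lies in the last cell, where the constant is 1; this is
    the reason for the case distinction in C.\<close>
  have \<kappa>0: "\<bar>\<kappa> 0\<bar> \<le> C * (k\<^sup>2 * t powr (\<alpha> - 1))"
  proof (cases "n = 1")
    case True
    hence "r = 0" "t = k" by (simp_all add: r_def t_def)
    hence "\<bar>\<kappa> 0\<bar> \<le> k powr (\<alpha> + 1)" using \<kappa>_near[of 0] k by simp
    also have "\<dots> = k\<^sup>2 * k powr (\<alpha> - 1)" using k by (simp add: powr_add powr_diff power2_eq_square)
    finally show ?thesis using True \<open>t = k\<close> by (simp add: C_def)
  qed (use \<kappa>_far[of 0] tr in \<open>auto simp: C_def\<close>)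
  have intg: "(\<lambda>s. h s * g s) integrable_on {a..b}" if "continuous_on {a..b} h" "0 \<le> a" for h a b
  proof -
    have "g integrable_on {a..b}" using integrable_on_subinterval[OF g(2)[of b]] that by auto
    hence "g absolutely_integrable_on {a..b}" using g(3) by (intro nonnegative_absolutely_integrable_1) auto
    from continuous_mult_abs_integrable[OF that(1) this] show ?thesis by (simp add: absolutely_integrable_on_def)
  qed
  have \<kappa>_int: "(\<lambda>s. \<kappa> s * \<phi>2 s) integrable_on {0..t}" by (rule mult_int[OF \<kappa>_cont])
  have split: "integral {0..t} (\<lambda>s. \<kappa> s * \<phi>2 s) = integral {0..r} (\<lambda>s. \<kappa> s * \<phi>2 s) + integral {r..t} (\<lambda>s. \<kappa> s * \<phi>2 s)"
    using tr k \<kappa>_int by (intro Henstock_Kurzweil_Integration.integral_combine[symmetric]) auto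
  have sub: "(\<lambda>s. \<kappa> s * \<phi>2 s) integrable_on {0..r}" "(\<lambda>s. \<kappa> s * \<phi>2 s) integrable_on {r..t}"
    using integrable_on_subinterval[OF \<kappa>_int] tr k by auto
  have far_int: "(\<lambda>s. (t - s) powr (\<alpha> - 1) * g s) integrable_on {0..r}"
    using tr k by (intro intg continuous_intros) auto
  have far: "\<bar>integral {0..r} (\<lambda>s. \<kappa> s * \<phi>2 s)\<bar> \<le> C * (k\<^sup>2 * integral {0..r} (\<lambda>s. (t - s) powr (\<alpha> - 1) * g s))"
  proof (cases "n = 1")
    case True
    thus ?thesis by (simp add: r_def)
  next
    case False
    have "norm (integral {0..r} (\<lambda>s. \<kappa> s * \<phi>2 s)) \<le> integral {0..r} (\<lambda>s. 2 * k\<^sup>2 * ((t - s) powr (\<alpha> - 1) * g s))"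
    proof (rule Henstock_Kurzweil_Integration.integral_norm_bound_integral[OF sub(1) integrable_on_mult_right[OF far_int]])
      fix s assume s: "s \<in> {0..r}"
      have "\<bar>\<kappa> s\<bar> * \<bar>\<phi>2 s\<bar> \<le> 2 * (k\<^sup>2 * (t - s) powr (\<alpha> - 1)) * g s"
        using \<kappa>_far[OF s] \<phi>2g by (intro mult_mono) auto
      thus "norm (\<kappa> s * \<phi>2 s) \<le> 2 * k\<^sup>2 * ((t - s) powr (\<alpha> - 1) * g s)" by (simp add: abs_mult mult.assoc)
    qed
    thus ?thesis using False by (simp add: C_def mult.assoc)
  qed
  have gi: "g integrable_on {r..t}" using integrable_on_subinterval[OF g(2)[of t]] tr by auto
  have near: "\<bar>integral {r..t} (\<lambda>s. \<kappa> s * \<phi>2 s)\<bar> \<le> k powr (\<alpha> + 1) * integral {r..t} g"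
  proof -
    have "norm (integral {r..t} (\<lambda>s. \<kappa> s * \<phi>2 s)) \<le> integral {r..t} (\<lambda>s. k powr (\<alpha> + 1) * g s)"
    proof (rule Henstock_Kurzweil_Integration.integral_norm_bound_integral[OF sub(2) integrable_on_mult_right[OF gi]])
      fix s assume s: "s \<in> {r..t}"
      show "norm (\<kappa> s * \<phi>2 s) \<le> k powr (\<alpha> + 1) * g s"
        unfolding real_norm_def abs_mult using \<kappa>_near[OF s] \<phi>2g by (intro mult_mono) auto
    qed
    thus ?thesis by simp
  qed
  have "0 \<le> k powr (\<alpha> + 1) * integral {r..t} g"
    using g(3) by (intro mult_nonneg_nonneg Henstock_Kurzweil_Integration.integral_nonneg gi) auto
  hence near': "k powr (\<alpha> + 1) * integral {r..t} g \<le> C * (k powr (\<alpha> + 1) * integral {r..t} g)"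
    using mult_right_mono[OF C] by simp
  have "\<bar>\<kappa> 0 * \<phi>' 0\<bar> \<le> C * (k\<^sup>2 * t powr (\<alpha> - 1)) * \<bar>\<phi>' 0\<bar>"
    unfolding abs_mult using \<kappa>0 by (rule mult_right_mono) simp
  with far near near' have "\<bar>\<kappa> 0 * \<phi>' 0 + integral {0..t} (\<lambda>s. \<kappa> s * \<phi>2 s)\<bar> \<le>
      C * (k\<^sup>2 * t powr (\<alpha> - 1)) * \<bar>\<phi>' 0\<bar> + C * (k\<^sup>2 * integral {0..r} (\<lambda>s. (t - s) powr (\<alpha> - 1) * g s)) +
      C * (k powr (\<alpha> + 1) * integral {r..t} g)"
    unfolding split by linarith
  hence "\<bar>\<kappa> 0 * \<phi>' 0 + integral {0..t} (\<lambda>s. \<kappa> s * \<phi>2 s)\<bar> \<le>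
      C * (k\<^sup>2 * t powr (\<alpha> - 1) * \<bar>\<phi>' 0\<bar> + k powr (\<alpha> + 1) * integral {r..t} g
        + k\<^sup>2 * integral {0..r} (\<lambda>s. (t - s) powr (\<alpha> - 1) * g s))"
    by (simp add: distrib_left mult.assoc)
  thus ?thesis unfolding err[symmetric] unfolding t_def r_def .
qed

section \<open>Stability\<close>

text \<open>Dahlquist's G-stability identity for BDF2: an increment of the energy |x|^2 + |2x - y|^2
  plus a dissipated square.\<close>

lemma bdf2_identity:
  fixes x y z :: "'a::real_inner"
  shows "4 * (((3/2) *\<^sub>R x - 2 *\<^sub>R y + (1/2) *\<^sub>R z) \<bullet> x) =
    ((norm x)\<^sup>2 + (norm (2 *\<^sub>R x - y))\<^sup>2) - ((norm y)\<^sup>2 + (norm (2 *\<^sub>R y - z))\<^sup>2) + (norm (x - 2 *\<^sub>R y + z))\<^sup>2"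
  unfolding power2_norm_eq_inner
  by (simp add: inner_simps inner_commute algebra_simps)

text \<open>
  The first step is backward Euler and breaks the telescoping of the BDF2 energy \<open>E\<close> by
  \<open>\<parallel>v\<^sub>1\<parallel>\<^sup>2\<close>, which is absorbed with the bound \<open>\<parallel>v\<^sub>1\<parallel> \<le> k \<parallel>r\<^sub>1\<parallel>\<close> of that step. Using also the second
  half of the energy gains the factor two that the consistency constants need.
\<close>

lemma bdf2_stability:
  fixes v r Q :: "nat \<Rightarrow> 'a::real_inner"
  assumes k: "0 < k" and q: "0 < q" "q < 1" and v0: "v 0 = 0"
    and e1: "bdiff k v 1 + Q 1 = r 1" and e2: "\<And>n. 2 \<le> n \<Longrightarrow> bdiff2 k v n + Q n = r n"
    and Q: "\<And>N. 0 \<le> (\<Sum>n<N. Q n \<bullet> v n)" and N: "1 \<le> N"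
  shows "sqrt (\<Sum>n=1..N. (q ^ n * norm (v n))\<^sup>2) \<le>
    4 * k / (1 - q\<^sup>2) * (5 / 8 * (q * norm (r 1)) + 1 / 2 * (\<Sum>n=2..N. q ^ n * norm (r n)))"
proof -
  define l where "l = q\<^sup>2"
  have l: "0 < l" "l < 1" using q by (auto simp: l_def power_less_one_iff)
  define E where "E n = (norm (v n))\<^sup>2 + (norm (2 *\<^sub>R v n - v (n - 1)))\<^sup>2" for n
  define V where "V M = (\<Sum>n=1..M. l ^ n * (norm (v n))\<^sup>2)" for M
  have E0: "0 \<le> E n" for n by (simp add: E_def)
  have E1: "E 1 = 5 * (norm (v 1))\<^sup>2" by (simp add: E_def v0 power_mult_distrib)
  have step1: "(norm (v 1))\<^sup>2 + k * (Q 1 \<bullet> v 1) = k * (r 1 \<bullet> v 1)"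
    using e1[symmetric] k by (simp add: bdiff_def v0 inner_simps power2_norm_eq_inner field_simps)
  have v1: "norm (v 1) \<le> k * norm (r 1)"
  proof -
    have "0 \<le> Q 1 \<bullet> v 1" using Q[of 2] v0 by (simp add: numeral_2_eq_2)
    hence "0 \<le> k * (Q 1 \<bullet> v 1)" using k by simp
    hence "(norm (v 1))\<^sup>2 \<le> k * (r 1 \<bullet> v 1)" using step1 by linarith
    also have "\<dots> \<le> k * (norm (r 1) * norm (v 1))"
      using k norm_cauchy_schwarz[of "r 1" "v 1"] by (intro mult_left_mono) auto
    finally have "norm (v 1) * norm (v 1) \<le> (k * norm (r 1)) * norm (v 1)" by (simp add: power2_eq_square mult.assoc)
    thus ?thesis using k by (cases "v 1 = 0") auto
  qed
  have step: "(E n - E (n - 1)) / 4 + k * (Q n \<bullet> v n) \<le> k * (r n \<bullet> v n)" if n: "2 \<le> n" for n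
  proof -
    obtain m where m: "n = Suc (Suc m)" using n by (auto simp: numeral_2_eq_2 dest!: le_Suc_ex)
    have cancel: "k *\<^sub>R (c *\<^sub>R (w /\<^sub>R k)) = c *\<^sub>R w" for c and w :: 'a using k by simp
    have "k *\<^sub>R bdiff2 k v n = (3/2) *\<^sub>R (v n - v (n - 1)) - (1/2) *\<^sub>R (v (n - 1) - v (n - 2))"
      unfolding bdiff2_def bdiff_def scaleR_right_diff_distrib[of k] cancel by (simp add: m)
    also have "\<dots> = (3/2) *\<^sub>R v n - 2 *\<^sub>R v (n - 1) + (1/2) *\<^sub>R v (n - 2)"
      by (simp add: algebra_simps flip: scaleR_add_left)
    finally have "k *\<^sub>R bdiff2 k v n = (3/2) *\<^sub>R v n - 2 *\<^sub>R v (n - 1) + (1/2) *\<^sub>R v (n - 2)" .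
    hence "4 * (k * (bdiff2 k v n \<bullet> v n)) = E n - E (n - 1) + (norm (v n - 2 *\<^sub>R v (n - 1) + v (n - 2)))\<^sup>2"
      using bdf2_identity[of "v n" "v (n - 1)" "v (n - 2)"] by (simp add: E_def m flip: inner_scaleR_left)
    moreover have "bdiff2 k v n \<bullet> v n + Q n \<bullet> v n = r n \<bullet> v n"
      unfolding e2[OF n, symmetric] by (simp add: inner_add_left)
    hence "k * (bdiff2 k v n \<bullet> v n) + k * (Q n \<bullet> v n) = k * (r n \<bullet> v n)"
      by (simp only: distrib_left[symmetric])
    moreover have "0 \<le> (norm (v n - 2 *\<^sub>R v (n - 1) + v (n - 2)))\<^sup>2" by simp
    ultimately show ?thesis by argo
  qed
  \<comment> \<open>Abel summation of the energy increments. Telescoping from 0 would call for l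
    E(1)/4 = (5/4) l |v(1)|^2 at the first step, which supplies only l |v(1)|^2; the missing quarter
    is the subtracted term.\<close>
  have energy: "(\<Sum>n=1..M. l ^ n * (k * (r n \<bullet> v n))) \<ge>
      ((1 - l) * (\<Sum>n=1..M. l ^ n * E n) + l ^ Suc M * E M - l * (norm (v 1))\<^sup>2) / 4 + (\<Sum>n=1..M. l ^ n * (k * (Q n \<bullet> v n)))"
    if "1 \<le> M" for M
    using that
  proof (induction M rule: nat_induct_at_least)
    case base
    have "l * ((norm (v 1))\<^sup>2 + k * (Q 1 \<bullet> v 1)) = l * (k * (r 1 \<bullet> v 1))" by (simp only: step1)
    thus ?case by (simp add: E1[unfolded One_nat_def] algebra_simps power2_eq_square)
  next
    case (Suc M)
    have "l ^ Suc M * ((E (Suc M) - E M) / 4 + k * (Q (Suc M) \<bullet> v (Suc M))) \<le> l ^ Suc M * (k * (r (Suc M) \<bullet> v (Suc M)))"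
      using step[of "Suc M"] Suc.hyps l by (intro mult_left_mono) auto
    with Suc.IH show ?case by (simp add: algebra_simps) argo
  qed
  have Qsum: "0 \<le> (\<Sum>n=1..N. l ^ n * (k * (Q n \<bullet> v n)))"
  proof -
    have "0 \<le> k * (\<Sum>n<Suc N. l ^ n * (Q n \<bullet> v n))"
      using k l Abel_sum_nonneg[OF Q, of l "Suc N"] by simp
    also have "\<dots> = (\<Sum>n=1..N. l ^ n * (k * (Q n \<bullet> v n)))"
      unfolding lessThan_Suc_atMost sum_distrib_left atMost_atLeast0
      by (subst sum.atLeast_Suc_atMost) (auto simp: v0 mult.left_commute)
    finally show ?thesis .
  qed
  \<comment> \<open>With a and b the norms at the new and old step, E >= a^2 + (2a - b)^2 >= 3a^2 -
    b^2. As the weights decrease, the b terms cost at most one copy of V, which leaves two.\<close>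
  have EV: "2 * V M + l ^ M * (norm (v M))\<^sup>2 \<le> (\<Sum>n=1..M. l ^ n * E n)" for M
  proof (induction M)
    case 0
    show ?case by (simp add: V_def v0)
  next
    case (Suc M)
    define a b where "a = norm (v (Suc M))" and "b = norm (v M)"
    have "2 * a - b \<le> norm (2 *\<^sub>R v (Suc M) - v M)"
      using norm_triangle_ineq2[of "2 *\<^sub>R v (Suc M)" "v M"] by (simp add: a_def b_def)
    moreover have "b - 2 * a \<le> norm (2 *\<^sub>R v (Suc M) - v M)"
      using norm_triangle_ineq3[of "2 *\<^sub>R v (Suc M)" "v M"] by (simp add: a_def b_def)
    ultimately have "\<bar>2 * a - b\<bar> \<le> norm (2 *\<^sub>R v (Suc M) - v M)" by linarith
    hence "(2 * a - b)\<^sup>2 \<le> (norm (2 *\<^sub>R v (Suc M) - v M))\<^sup>2" by (metis abs_ge_zero power2_abs power_mono)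
    moreover have "3 * a\<^sup>2 - b\<^sup>2 = a\<^sup>2 + (2 * a - b)\<^sup>2 - 2 * (a - b)\<^sup>2"
      by (simp add: power2_eq_square algebra_simps)
    moreover have "0 \<le> (a - b)\<^sup>2" by simp
    moreover have "E (Suc M) = a\<^sup>2 + (norm (2 *\<^sub>R v (Suc M) - v M))\<^sup>2" by (simp add: E_def a_def)
    ultimately have "3 * a\<^sup>2 - b\<^sup>2 \<le> E (Suc M)" by argo
    hence "l ^ Suc M * (3 * a\<^sup>2 - b\<^sup>2) \<le> l ^ Suc M * E (Suc M)" using l by (intro mult_left_mono) auto
    moreover have "l ^ Suc M * b\<^sup>2 \<le> l ^ M * b\<^sup>2" using l by (intro mult_right_mono power_decreasing) auto
    ultimately show ?case using Suc.IH unfolding V_def a_def b_def by (simp add: algebra_simps)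
  qed
  define s where "s = sqrt (V N)"
  have V0: "0 \<le> V N" unfolding V_def using l by (intro sum_nonneg mult_nonneg_nonneg) auto
  have s: "0 \<le> s" "s * s = V N" using V0 by (simp_all add: s_def)
  have ql: "q ^ n * q ^ n = l ^ n" for n by (simp add: l_def power_mult_distrib[symmetric] power2_eq_square)
  have V_eq: "V N = (\<Sum>n=1..N. (q ^ n * norm (v n))\<^sup>2)"
    unfolding V_def ql[symmetric] power2_eq_square by (simp only: mult_ac)
  have vs: "q ^ n * norm (v n) \<le> s" if "n \<in> {1..N}" for n
  proof -
    have "(q ^ n * norm (v n))\<^sup>2 \<le> V N"
      unfolding V_eq using that by (intro member_le_sum) auto
    thus ?thesis unfolding s_def by (rule real_le_rsqrt)
  qed
  have rs: "l ^ n * (norm (r n) * norm (v n)) \<le> (q ^ n * norm (r n)) * s" if "n \<in> {1..N}" for n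
    using mult_left_mono[OF vs[OF that], of "q ^ n * norm (r n)"] q by (simp add: ql[symmetric] mult_ac)
  have one: "l * (norm (v 1))\<^sup>2 \<le> k * (q * norm (r 1) * s)"
  proof -
    have "l * (norm (v 1) * norm (v 1)) \<le> l * ((k * norm (r 1)) * norm (v 1))"
      using v1 l by (intro mult_left_mono mult_right_mono) auto
    also have "\<dots> = k * (l ^ 1 * (norm (r 1) * norm (v 1)))" by simp
    also have "\<dots> \<le> k * (q ^ 1 * norm (r 1) * s)" using rs[of 1] N k by (intro mult_left_mono) auto
    finally show ?thesis by (simp add: power2_eq_square)
  qed
  \<comment> \<open>5/4 = 1 + 1/4: the residual of the first step appears in the sum and once more
    through the missing quarter.\<close>
  define A where "A = 5 / 4 * (q * norm (r 1)) + (\<Sum>n=2..N. q ^ n * norm (r n))"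
  have A: "0 \<le> A" unfolding A_def using q by (intro add_nonneg_nonneg mult_nonneg_nonneg sum_nonneg) auto
  have arith: "P / 4 - w / 4 \<le> R" if "P \<le> S" "0 \<le> T" "(S + T - w) / 4 + U \<le> R" "0 \<le> U" for P S T U R w :: real
    using that by argo
  have "(1 - l) * (2 * V N) \<le> (1 - l) * (\<Sum>n=1..N. l ^ n * E n)"
  proof (rule mult_left_mono)
    have "0 \<le> l ^ N * (norm (v N))\<^sup>2" using l by simp
    thus "2 * V N \<le> (\<Sum>n=1..N. l ^ n * E n)" using EV[of N] by linarith
  qed (use l in simp)
  moreover have "0 \<le> l ^ Suc N * E N" using l E0 by (intro mult_nonneg_nonneg) auto
  ultimately have "(1 - l) * (2 * V N) / 4 - l * (norm (v 1))\<^sup>2 / 4 \<le> (\<Sum>n=1..N. l ^ n * (k * (r n \<bullet> v n)))"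
    using energy[OF N] Qsum by (rule arith)
  also have "\<dots> \<le> (\<Sum>n=1..N. k * ((q ^ n * norm (r n)) * s))"
  proof (rule sum_mono)
    fix n assume n: "n \<in> {1..N}"
    have "l ^ n * (k * (r n \<bullet> v n)) = k * (l ^ n * (r n \<bullet> v n))" by simp
    also have "\<dots> \<le> k * (l ^ n * (norm (r n) * norm (v n)))"
      using k l norm_cauchy_schwarz[of "r n" "v n"] by (intro mult_left_mono) auto
    also have "\<dots> \<le> k * ((q ^ n * norm (r n)) * s)" using rs[OF n] k by (intro mult_left_mono) auto
    finally show "l ^ n * (k * (r n \<bullet> v n)) \<le> k * ((q ^ n * norm (r n)) * s)" .
  qed
  also have "\<dots> = k * s * (\<Sum>n=1..N. q ^ n * norm (r n))" by (simp add: sum_distrib_left mult_ac)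
  also have "(\<Sum>n=1..N. q ^ n * norm (r n)) = q * norm (r 1) + (\<Sum>n=2..N. q ^ n * norm (r n))"
    using N by (subst sum.atLeast_Suc_atMost) (auto simp: numeral_2_eq_2)
  finally have "(1 - l) * (2 * V N) / 4 \<le> k * s * (q * norm (r 1) + (\<Sum>n=2..N. q ^ n * norm (r n))) + k * (q * norm (r 1) * s) / 4"
    using one by linarith
  hence "(1 - l) / 2 * (s * s) \<le> (k * A) * s"
    by (simp add: s(2) A_def algebra_simps)
  hence "(1 - l) / 2 * s \<le> k * A"
    using s(1) k A by (cases "s = 0") auto
  hence "s \<le> 2 * (k * A) / (1 - l)" using l by (simp add: field_simps)
  also have "\<dots> = 4 * k / (1 - q\<^sup>2) * (5 / 8 * (q * norm (r 1)) + 1 / 2 * (\<Sum>n=2..N. q ^ n * norm (r n)))"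
  proof -
    have "5 / 8 * (q * norm (r 1)) + 1 / 2 * (\<Sum>n=2..N. q ^ n * norm (r n)) = A / 2" by (simp add: A_def)
    moreover have "2 * (k * A) / (1 - l) = 4 * k / (1 - l) * (A / 2)" using l by (simp add: divide_simps)
    ultimately show ?thesis by (simp only: l_def)
  qed
  finally show ?thesis unfolding s_def V_eq .
qed

lemma norm_le_by_dense:
  fixes y :: "'a::real_inner"
  assumes D: "closure D = UNIV" and M: "0 \<le> M" and le: "\<And>x. x \<in> D \<Longrightarrow> \<bar>y \<bullet> x\<bar> \<le> M * norm x"
  shows "norm y \<le> M"
proof -
  have "closed {x. \<bar>y \<bullet> x\<bar> \<le> M * norm x}" by (intro closed_Collect_le continuous_intros)
  hence "closure D \<subseteq> {x. \<bar>y \<bullet> x\<bar> \<le> M * norm x}" using le by (intro closure_minimal) auto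
  hence "y \<in> {x. \<bar>y \<bullet> x\<bar> \<le> M * norm x}" unfolding D by blast
  hence "\<bar>y \<bullet> y\<bar> \<le> M * norm y" by simp
  hence "norm y * norm y \<le> M * norm y" by (simp add: power2_norm_eq_inner[symmetric] power2_eq_square)
  thus ?thesis using M by (cases "y = 0") auto
qed

lemma interp_quad_inner: "interp_quad k \<beta> n \<psi> \<bullet> x = interp_quad k \<beta> n (\<lambda>l. \<psi> l \<bullet> x)"
  by (simp add: interp_quad_def inner_add_left inner_sum_left)

lemma conv_quad_inner: "conv_quad k \<alpha> \<beta> \<omega> n \<psi> \<bullet> x = conv_quad k \<alpha> \<beta> \<omega> n (\<lambda>l. \<psi> l \<bullet> x)"
  by (simp add: conv_quad_def inner_add_left inner_sum_left)

lemma interp_quad_add: "interp_quad k \<beta> n (\<lambda>l. \<psi> l + \<eta> l) = interp_quad k \<beta> n \<psi> + interp_quad k \<beta> n \<eta>"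
  by (simp add: interp_quad_def scaleR_add_right sum.distrib algebra_simps)

lemma conv_quad_add: "conv_quad k \<alpha> \<beta> \<omega> n (\<lambda>l. \<psi> l + \<eta> l) = conv_quad k \<alpha> \<beta> \<omega> n \<psi> + conv_quad k \<alpha> \<beta> \<omega> n \<eta>"
  by (simp add: conv_quad_def scaleR_add_right sum.distrib algebra_simps)

lemma bdiff_add: "bdiff k (\<lambda>n. v n + w n) n = bdiff k v n + bdiff k w n"
  by (simp add: bdiff_def algebra_simps)

lemma bdiff2_add: "bdiff2 k (\<lambda>n. v n + w n) n = bdiff2 k v n + bdiff2 k w n"
  by (simp add: bdiff2_def bdiff_add scaleR_add_right algebra_simps)

lemma positive_selfadjoint_add: "positive_selfadjoint D B \<Longrightarrow> x \<in> D \<Longrightarrow> y \<in> D \<Longrightarrow> B (x + y) = B x + B y"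
  by (simp add: positive_selfadjoint_def)

lemma positive_selfadjoint_0: "positive_selfadjoint D B \<Longrightarrow> B 0 = 0"
  unfolding positive_selfadjoint_def by (metis scaleR_zero_left subspace_0)

lemma positive_selfadjoint_sym:
  assumes "positive_selfadjoint D B" "x \<in> D" "y \<in> D"
  shows "B x \<bullet> y = x \<bullet> B y"
  using assms unfolding positive_selfadjoint_def adjoint_graph_def by blast

section \<open>The error estimate\<close>

lemma integral_scaleR_inner:
  fixes f :: "real \<Rightarrow> 'a::real_inner"
  assumes "(\<lambda>s. b s *\<^sub>R f s) integrable_on S"
  shows "integral S (\<lambda>s. b s *\<^sub>R f s) \<bullet> x = integral S (\<lambda>s. b s * (f s \<bullet> x))"
  using integral_linear[OF assms bounded_linear_inner_left[of x]] by (simp add: o_def)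

lemma residual_interp_bound:
  fixes D :: "'a::{real_inner,complete_space} set" and B :: "'a \<Rightarrow> 'a" and u u' u'' :: "real \<Rightarrow> 'a"
  assumes B: "positive_selfadjoint D B" and \<beta>: "\<beta> absolutely_integrable_on {0<..}" and k: "0 < k" and n: "0 < n"
    and u: "\<And>t. 0 \<le> t \<Longrightarrow> u t \<in> D" "continuous_on {0..} u"
    and u': "\<And>t. 0 < t \<Longrightarrow> (u has_vector_derivative u' t) (at t)" "\<And>t. 0 < t \<Longrightarrow> u' t \<in> D"
    and u'': "\<And>t. 0 < t \<Longrightarrow> (u' has_vector_derivative u'' t) (at t)" "\<And>t. 0 < t \<Longrightarrow> u'' t \<in> D"
    and int: "(\<lambda>s. \<beta> (real n * k - s) *\<^sub>R B (u s)) integrable_on {0..real n * k}"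
    and int1: "(\<lambda>t. norm (B (u' t))) integrable_on {0..k}"
    and int2: "\<And>T. (\<lambda>t. norm (B (u'' t))) integrable_on {k..T}"
  shows "norm (integral {0..real n * k} (\<lambda>s. \<beta> (real n * k - s) *\<^sub>R B (u s)) - interp_quad k \<beta> n (\<lambda>l. B (u (real l * k))))
    \<le> integral {0<..} (\<lambda>x. \<bar>\<beta> x\<bar>) *
      (integral {0..k} (\<lambda>t. norm (B (u' t))) + k * integral {k..real n * k} (\<lambda>t. norm (B (u'' t))))"
proof (rule norm_le_by_dense)
  show "closure D = UNIV" using B by (simp add: positive_selfadjoint_def)
  have abs_int: "(\<lambda>x. \<bar>\<beta> x\<bar>) integrable_on {0<..}"
    using \<beta>[unfolded absolutely_integrable_on_def] by simp
  show "0 \<le> integral {0<..} (\<lambda>x. \<bar>\<beta> x\<bar>) *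
      (integral {0..k} (\<lambda>t. norm (B (u' t))) + k * integral {k..real n * k} (\<lambda>t. norm (B (u'' t))))"
    using k abs_int int1 int2
    by (intro mult_nonneg_nonneg add_nonneg_nonneg Henstock_Kurzweil_Integration.integral_nonneg) auto
  fix x assume x: "x \<in> D"
  have sym: "B y \<bullet> x = y \<bullet> B x" if "y \<in> D" for y using positive_selfadjoint_sym[OF B that x] .
  define \<phi> where "\<phi> s = u s \<bullet> B x" for s
  have cont: "continuous_on {0..} \<phi>" unfolding \<phi>_def by (intro continuous_intros u(2))
  have deriv: "(\<phi> has_vector_derivative u' t \<bullet> B x) (at t)" if "0 < t" for t
    unfolding \<phi>_def by (rule bounded_linear.has_vector_derivative[OF bounded_linear_inner_left u'(1)[OF that]])
  have deriv2: "((\<lambda>t. u' t \<bullet> B x) has_vector_derivative u'' t \<bullet> B x) (at t)" if "0 < t" for t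
    by (rule bounded_linear.has_vector_derivative[OF bounded_linear_inner_left u''(1)[OF that]])
  define M where "M = integral {0..k} (\<lambda>t. norm (B (u' t)) * norm x) + k * integral {k..real n * k} (\<lambda>t. norm (B (u'' t)) * norm x)"
  have M: "M = (integral {0..k} (\<lambda>t. norm (B (u' t))) + k * integral {k..real n * k} (\<lambda>t. norm (B (u'' t)))) * norm x"
    by (simp add: M_def algebra_simps)
  have "\<bar>integral {0..real n * k} (\<lambda>s. \<beta> (real n * k - s) * \<phi> s) - interp_quad k \<beta> n (\<lambda>l. \<phi> (real l * k))\<bar>
      \<le> M * integral {0<..} (\<lambda>x. \<bar>\<beta> x\<bar>)"
  proof (rule interp_quad_error[OF \<beta> k n cont])
    fix s assume s: "s \<in> {0..real n * k}"
    show "\<bar>\<phi> s - (\<Sum>l\<le>n. \<phi> (real l * k) * hat ((s - real l * k) / k))\<bar> \<le> M"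
      unfolding M_def
    proof (rule interp_error[OF k n _ _ cont deriv deriv2])
      \<comment> \<open>Symmetry is used backwards here: with the derivatives of u in the domain, B
        returns to them and Cauchy-Schwarz yields the norms in the estimate.\<close>
      show "\<bar>u' t \<bullet> B x\<bar> \<le> norm (B (u' t)) * norm x" "\<bar>u'' t \<bullet> B x\<bar> \<le> norm (B (u'' t)) * norm x" if "0 < t" for t
        using sym[OF u'(2)[OF that]] sym[OF u''(2)[OF that]] Cauchy_Schwarz_ineq2[of "B (u' t)" x]
          Cauchy_Schwarz_ineq2[of "B (u'' t)" x] by simp_all
    qed (use s int1 int2 in \<open>auto intro: integrable_on_mult_left\<close>)
  qed
  moreover have "integral {0..real n * k} (\<lambda>s. \<beta> (real n * k - s) *\<^sub>R B (u s)) \<bullet> x =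
      integral {0..real n * k} (\<lambda>s. \<beta> (real n * k - s) * \<phi> s)"
    unfolding integral_scaleR_inner[OF int]
    by (intro Henstock_Kurzweil_Integration.integral_cong) (simp add: \<phi>_def sym u(1))
  moreover have "interp_quad k \<beta> n (\<lambda>l. B (u (real l * k))) \<bullet> x = interp_quad k \<beta> n (\<lambda>l. \<phi> (real l * k))"
    unfolding interp_quad_inner \<phi>_def using k by (simp add: sym u(1))
  ultimately show "\<bar>(integral {0..real n * k} (\<lambda>s. \<beta> (real n * k - s) *\<^sub>R B (u s)) -
      interp_quad k \<beta> n (\<lambda>l. B (u (real l * k)))) \<bullet> x\<bar> \<le> integral {0<..} (\<lambda>x. \<bar>\<beta> x\<bar>) *
      (integral {0..k} (\<lambda>t. norm (B (u' t))) + k * integral {k..real n * k} (\<lambda>t. norm (B (u'' t)))) * norm x"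
    by (simp add: inner_diff_left M mult_ac)
qed

lemma residual_conv_bound:
  fixes D :: "'a::{real_inner,complete_space} set" and B :: "'a \<Rightarrow> 'a" and u u' u'' :: "real \<Rightarrow> 'a"
  assumes B: "positive_selfadjoint D B" and \<alpha>: "0 < \<alpha>" "\<alpha> < 1" and \<omega>: "cq_weights \<alpha> \<omega>" and k: "0 < k" and n: "0 < n"
    and \<beta>: "\<And>t. 0 < t \<Longrightarrow> \<beta> t = t powr (\<alpha> - 1) / Gamma \<alpha>"
    and u: "\<And>t. 0 \<le> t \<Longrightarrow> u t \<in> D" "continuous_on {0..} u"
    and u': "\<And>t. 0 < t \<Longrightarrow> (u has_vector_derivative u' t) (at t)" "u' 0 \<in> D" "continuous_on {0..} u'"
    and u'': "\<And>t. 0 < t \<Longrightarrow> (u' has_vector_derivative u'' t) (at t)" "\<And>t. 0 < t \<Longrightarrow> u'' t \<in> D"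
    and int: "(\<lambda>s. \<beta> (real n * k - s) *\<^sub>R B (u s)) integrable_on {0..real n * k}"
    and int2: "\<And>T. (\<lambda>t. norm (B (u'' t))) integrable_on {0..T}"
  shows "norm (integral {0..real n * k} (\<lambda>s. \<beta> (real n * k - s) *\<^sub>R B (u s)) - conv_quad k \<alpha> \<beta> \<omega> n (\<lambda>l. B (u (real l * k))))
    \<le> (if n = 1 then 1 else 2) * (k\<^sup>2 * (real n * k) powr (\<alpha> - 1) * norm (B (u' 0)) +
        k powr (\<alpha> + 1) * integral {real (n - 1) * k..real n * k} (\<lambda>t. norm (B (u'' t))) +
        k\<^sup>2 * integral {0..real (n - 1) * k} (\<lambda>t. (real n * k - t) powr (\<alpha> - 1) * norm (B (u'' t))))"
    (is "norm ?\<rho> \<le> ?C * (?a * norm (B (u' 0)) + ?b * ?I + ?c * ?J)")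
proof (rule norm_le_by_dense)
  show "closure D = UNIV" using B by (simp add: positive_selfadjoint_def)
  define g where "g t = norm (B (u'' t))" for t
  have g: "g integrable_on {0..T}" "0 \<le> g t" for T t using int2 by (auto simp: g_def[abs_def])
  have sub: "g integrable_on {a..b}" if "0 \<le> a" for a b
    using integrable_on_subinterval[OF g(1)[of b]] that by auto
  have "0 \<le> ?I" unfolding g_def[symmetric] using sub k g by (intro Henstock_Kurzweil_Integration.integral_nonneg) auto
  moreover have "0 \<le> ?J"
  proof (cases "(\<lambda>t. (real n * k - t) powr (\<alpha> - 1) * norm (B (u'' t))) integrable_on {0..real (n - 1) * k}")
    case True
    thus ?thesis by (intro Henstock_Kurzweil_Integration.integral_nonneg) auto
  qed (simp add: not_integrable_integral)
  ultimately show "0 \<le> ?C * (?a * norm (B (u' 0)) + ?b * ?I + ?c * ?J)" by auto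
  fix x assume x: "x \<in> D"
  have sym: "B y \<bullet> x = y \<bullet> B x" if "y \<in> D" for y using positive_selfadjoint_sym[OF B that x] .
  define \<phi> where "\<phi> s = u s \<bullet> B x" for s
  have cont: "continuous_on {0..} \<phi>" unfolding \<phi>_def by (intro continuous_intros u(2))
  have cont': "continuous_on {0..} (\<lambda>t. u' t \<bullet> B x)" by (intro continuous_intros u'(3))
  have deriv: "(\<phi> has_vector_derivative u' t \<bullet> B x) (at t)" if "0 < t" for t
    unfolding \<phi>_def by (rule bounded_linear.has_vector_derivative[OF bounded_linear_inner_left u'(1)[OF that]])
  have deriv2: "((\<lambda>t. u' t \<bullet> B x) has_vector_derivative u'' t \<bullet> B x) (at t)" if "0 < t" for t
    by (rule bounded_linear.has_vector_derivative[OF bounded_linear_inner_left u''(1)[OF that]])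
  have g_bound: "\<bar>u'' t \<bullet> B x\<bar> \<le> g t * norm x" if "0 < t" for t
    using sym[OF u''(2)[OF that]] Cauchy_Schwarz_ineq2[of "B (u'' t)" x] by (simp add: g_def)
  have "\<bar>integral {0..real n * k} (\<lambda>s. \<beta> (real n * k - s) * \<phi> s) - conv_quad k \<alpha> \<beta> \<omega> n (\<lambda>l. \<phi> (real l * k))\<bar>
    \<le> ?C * (?a * \<bar>u' 0 \<bullet> B x\<bar> + ?b * integral {real (n - 1) * k..real n * k} (\<lambda>t. g t * norm x) +
        ?c * integral {0..real (n - 1) * k} (\<lambda>t. (real n * k - t) powr (\<alpha> - 1) * (g t * norm x)))"
    by (rule conv_quad_error[OF \<alpha> \<omega> k n \<beta> cont cont' deriv deriv2 g_bound])
       (use g in \<open>auto intro: integrable_on_mult_left\<close>)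
  also have "\<dots> \<le> ?C * (?a * (norm (B (u' 0)) * norm x) + ?b * (?I * norm x) + ?c * (?J * norm x))"
  proof (intro mult_left_mono add_mono)
    show "\<bar>u' 0 \<bullet> B x\<bar> \<le> norm (B (u' 0)) * norm x"
      using sym[OF u'(2)] Cauchy_Schwarz_ineq2[of "B (u' 0)" x] by simp
    show "integral {real (n - 1) * k..real n * k} (\<lambda>t. g t * norm x) \<le> ?I * norm x"
      by (simp add: g_def)
    show "integral {0..real (n - 1) * k} (\<lambda>t. (real n * k - t) powr (\<alpha> - 1) * (g t * norm x)) \<le> ?J * norm x"
      by (simp add: g_def mult.assoc[symmetric])
  qed auto
  also have "\<dots> = ?C * (?a * norm (B (u' 0)) + ?b * ?I + ?c * ?J) * norm x" by (simp only: distrib_left distrib_right mult_ac)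
  finally have "\<bar>integral {0..real n * k} (\<lambda>s. \<beta> (real n * k - s) * \<phi> s) - conv_quad k \<alpha> \<beta> \<omega> n (\<lambda>l. \<phi> (real l * k))\<bar>
    \<le> ?C * (?a * norm (B (u' 0)) + ?b * ?I + ?c * ?J) * norm x" .
  moreover have "integral {0..real n * k} (\<lambda>s. \<beta> (real n * k - s) *\<^sub>R B (u s)) \<bullet> x =
      integral {0..real n * k} (\<lambda>s. \<beta> (real n * k - s) * \<phi> s)"
    unfolding integral_scaleR_inner[OF int]
    by (intro Henstock_Kurzweil_Integration.integral_cong) (simp add: \<phi>_def sym u(1))
  moreover have "conv_quad k \<alpha> \<beta> \<omega> n (\<lambda>l. B (u (real l * k))) \<bullet> x = conv_quad k \<alpha> \<beta> \<omega> n (\<lambda>l. \<phi> (real l * k))"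
    unfolding conv_quad_inner \<phi>_def using k by (simp add: sym u(1))
  ultimately show "\<bar>?\<rho> \<bullet> x\<bar> \<le> ?C * (?a * norm (B (u' 0)) + ?b * ?I + ?c * ?J) * norm x"
    by (simp only: inner_diff_left)
qed

text \<open>Square-summability belongs to the conclusion because a divergent sum in
  \<open>normA\<close> is 0 by convention. Bounds on the partial sums uniform in N give both
  claims.\<close>

theorem theorem5p3:
  fixes D1 D2 :: "'a::{real_inner,complete_space} set" and B1 B2 :: "'a \<Rightarrow> 'a"
    and \<beta>1 \<beta>2 :: "real \<Rightarrow> real" and \<alpha> c k :: real and \<omega> :: "nat \<Rightarrow> real"
    and f u u' u'' u''' :: "real \<Rightarrow> 'a" and u0 :: 'a and U :: "nat \<Rightarrow> 'a"
  assumes B1: "positive_selfadjoint D1 B1" and B2: "positive_selfadjoint D2 B2"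
    and kernel1: "memory_kernel \<beta>1" and kernel2: "memory_kernel \<beta>2"
    and \<beta>1_L1: "\<beta>1 absolutely_integrable_on {0<..}"
    and \<alpha>: "0 < \<alpha>" "\<alpha> < 1"
    and \<beta>2: "\<And>t. t > 0 \<Longrightarrow> \<beta>2 t = t powr (\<alpha> - 1) / Gamma \<alpha>"
    and c: "c > 0" and k: "k > 0"
    and \<omega>: "cq_weights \<alpha> \<omega>"
    and u: "evolution_solution D1 B1 \<beta>1 D2 B2 \<beta>2 f u0 u u'"
    and U: "scheme_solution k \<alpha> \<omega> D1 B1 \<beta>1 D2 B2 \<beta>2 f u0 U"
    \<comment> \<open>regularity: the quantities on the right-hand side are defined and finite\<close>
    and u'': "\<And>t. t > 0 \<Longrightarrow> (u' has_vector_derivative u'' t) (at t)"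
    and u''': "\<And>t. t > 0 \<Longrightarrow> (u'' has_vector_derivative u''' t) (at t)"
    and dom_u': "\<And>t. t > 0 \<Longrightarrow> u' t \<in> D1" "u' 0 \<in> D2"
    and dom_u'': "\<And>t. t > 0 \<Longrightarrow> u'' t \<in> D1 \<inter> D2"
    and int_u'': "(\<lambda>\<zeta>. norm (u'' \<zeta>)) integrable_on {0..2 * k}"
    and int_u''': "\<And>T. (\<lambda>\<zeta>. norm (u''' \<zeta>)) integrable_on {k..T}"
    and int_B1u': "(\<lambda>\<zeta>. norm (B1 (u' \<zeta>))) integrable_on {0..k}"
    and int_B1u'': "\<And>T. (\<lambda>\<zeta>. norm (B1 (u'' \<zeta>))) integrable_on {k..T}"
    and int_B2u'': "\<And>T. (\<lambda>\<zeta>. norm (B2 (u'' \<zeta>))) integrable_on {0..T}"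
    and sum_u''': "(\<lambda>n. exp (- c / 2 * real n) *
          integral {real (n - 1) * k..real n * k} (\<lambda>\<zeta>. norm (u''' \<zeta>))) summable_on {2..}"
    and sum_B1: "(\<lambda>n. exp (- c / 2 * real n) *
          (2 * integral {0..k} (\<lambda>\<zeta>. norm (B1 (u' \<zeta>))) +
           k * integral {k..real n * k} (\<lambda>\<zeta>. norm (B1 (u'' \<zeta>))))) summable_on {1..}"
    and sum_B2: "(\<lambda>n. exp (- c / 2 * real n) *
          (k\<^sup>2 * (real n * k) powr (\<alpha> - 1) * norm (B2 (u' 0)) +
           k powr (\<alpha> + 1) * integral {real (n - 1) * k..real n * k} (\<lambda>\<zeta>. norm (B2 (u'' \<zeta>))) +
           k\<^sup>2 * integral {0..real (n - 1) * k}
             (\<lambda>\<zeta>. (real n * k - \<zeta>) powr (\<alpha> - 1) * norm (B2 (u'' \<zeta>))))) summable_on {1..}"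
  shows "(\<lambda>n. exp (- c * real n) * (norm (U n - u (real n * k)))\<^sup>2) summable_on UNIV \<and>
    normA c (\<lambda>n. U n - u (real n * k)) \<le>
      4 * k / (1 - exp (- c)) *
      (8 / c * integral {0..2 * k} (\<lambda>\<zeta>. norm (u'' \<zeta>)) +
       k * (\<Sum>\<^sub>\<infinity>n\<in>{2..}. exp (- c / 2 * real n) *
          integral {real (n - 1) * k..real n * k} (\<lambda>\<zeta>. norm (u''' \<zeta>))) +
       integral {0<..} (\<lambda>t. \<bar>\<beta>1 t\<bar>) *
         (\<Sum>\<^sub>\<infinity>n\<in>{1..}. exp (- c / 2 * real n) *
          (2 * integral {0..k} (\<lambda>\<zeta>. norm (B1 (u' \<zeta>))) +
           k * integral {k..real n * k} (\<lambda>\<zeta>. norm (B1 (u'' \<zeta>))))) +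
       (\<Sum>\<^sub>\<infinity>n\<in>{1..}. exp (- c / 2 * real n) *
          (k\<^sup>2 * (real n * k) powr (\<alpha> - 1) * norm (B2 (u' 0)) +
           k powr (\<alpha> + 1) * integral {real (n - 1) * k..real n * k} (\<lambda>\<zeta>. norm (B2 (u'' \<zeta>))) +
           k\<^sup>2 * integral {0..real (n - 1) * k}
             (\<lambda>\<zeta>. (real n * k - \<zeta>) powr (\<alpha> - 1) * norm (B2 (u'' \<zeta>))))))"
proof -
  define q where "q = exp (- c / 2)"
  have q: "0 < q" "q < 1" using c by (auto simp: q_def)
  have qn: "exp (- c / 2 * real n) = q ^ n" for n
    using exp_of_nat_mult[of n "- c / 2"] by (simp add: q_def mult.commute)
  have q2: "exp (- c) = q\<^sup>2"
    by (simp add: q_def power2_eq_square exp_add[symmetric])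
  have qc: "exp (- c * real n) = (q ^ n)\<^sup>2" for n
    by (simp add: qn[symmetric] power2_eq_square exp_add[symmetric])
  \<comment> \<open>Source of the factor 1/c in front of the u'' integral.\<close>
  have q_c: "q \<le> 2 / c"
  proof -
    have "c / 2 \<le> exp (c / 2)" using exp_ge_add_one_self[of "c / 2"] by linarith
    moreover have "q = 1 / exp (c / 2)" by (simp add: q_def exp_minus inverse_eq_divide)
    moreover have "1 / exp (c / 2) \<le> 1 / (c / 2)"
      using \<open>c / 2 \<le> exp (c / 2)\<close> c by (intro divide_left_mono mult_pos_pos) auto
    ultimately show ?thesis by simp
  qed

  \<comment> \<open>The error equation and positivity of its memory terms\<close>
  define w where "w n = u (real n * k)" for n
  define v where "v n = U n - w n" for n
  have u0: "u 0 = u0" and uD: "\<And>t. 0 \<le> t \<Longrightarrow> u t \<in> D1" "\<And>t. 0 \<le> t \<Longrightarrow> u t \<in> D2"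
    and u': "\<And>t. 0 \<le> t \<Longrightarrow> (u has_vector_derivative u' t) (at t within {0..})"
    and mem: "\<And>t. 0 < t \<Longrightarrow> (\<lambda>s. \<beta>1 (t - s) *\<^sub>R B1 (u s)) integrable_on {0..t}"
      "\<And>t. 0 < t \<Longrightarrow> (\<lambda>s. \<beta>2 (t - s) *\<^sub>R B2 (u s)) integrable_on {0..t}"
    and eq: "\<And>t. 0 < t \<Longrightarrow> u' t + (integral {0..t} (\<lambda>s. \<beta>1 (t - s) *\<^sub>R B1 (u s)) +
                    integral {0..t} (\<lambda>s. \<beta>2 (t - s) *\<^sub>R B2 (u s))) = f t"
    using u unfolding evolution_solution_def by auto
  interpret C1_orbit u u' u'' k
    by unfold_locales (use k u' u'' int_u'' in auto)
  have U0: "U 0 = u0" and UD: "\<And>n. U n \<in> D1" "\<And>n. U n \<in> D2"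
    and U1: "bdiff k U 1 + (interp_quad k \<beta>1 1 (\<lambda>l. B1 (U l)) + conv_quad k \<alpha> \<beta>2 \<omega> 1 (\<lambda>l. B2 (U l))) = f k"
    and Un: "\<And>n. 2 \<le> n \<Longrightarrow> bdiff2 k U n +
        (interp_quad k \<beta>1 n (\<lambda>l. B1 (U l)) + conv_quad k \<alpha> \<beta>2 \<omega> n (\<lambda>l. B2 (U l))) = f (real n * k)"
    using U unfolding scheme_solution_def by auto
  have sub: "subspace D1" "subspace D2" using B1 B2 by (auto simp: positive_selfadjoint_def)
  have wD: "w n \<in> D1" "w n \<in> D2" for n using k uD by (auto simp: w_def)
  have vD: "v n \<in> D1" "v n \<in> D2" for n
    unfolding v_def using UD wD sub by (auto intro: subspace_diff)
  have v0: "v 0 = 0" by (simp add: v_def w_def U0 u0)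
  have Uvw: "U = (\<lambda>n. v n + w n)" by (simp add: v_def)
  have BU: "B1 (U n) = B1 (v n) + B1 (w n)" "B2 (U n) = B2 (v n) + B2 (w n)" for n
    unfolding Uvw using positive_selfadjoint_add[OF B1] positive_selfadjoint_add[OF B2] vD wD by auto

  define Q where "Q n = interp_quad k \<beta>1 n (\<lambda>l. B1 (v l)) + conv_quad k \<alpha> \<beta>2 \<omega> n (\<lambda>l. B2 (v l))" for n
  define W where "W n = interp_quad k \<beta>1 n (\<lambda>l. B1 (w l)) + conv_quad k \<alpha> \<beta>2 \<omega> n (\<lambda>l. B2 (w l))" for n
  define r where "r n = f (real n * k) - (if n = 1 then bdiff k w n else bdiff2 k w n) - W n" for n
  have QW: "interp_quad k \<beta>1 n (\<lambda>l. B1 (U l)) + conv_quad k \<alpha> \<beta>2 \<omega> n (\<lambda>l. B2 (U l)) = Q n + W n" for n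
    by (simp add: Q_def W_def BU interp_quad_add conv_quad_add)
  have e1: "bdiff k v 1 + Q 1 = r 1"
    using U1 unfolding QW unfolding Uvw bdiff_add by (simp add: r_def algebra_simps)
  have e2: "bdiff2 k v n + Q n = r n" if "2 \<le> n" for n
    using Un[OF that] that unfolding QW unfolding Uvw bdiff2_add by (simp add: r_def algebra_simps)
  have Qpos: "0 \<le> (\<Sum>n<N. Q n \<bullet> v n)" for N
  proof -
    \<comment> \<open>The error vanishes at index 0, so the starting weights drop out and the sums
      may include l = 0, the shape required by \<open>positive_weights\<close>.\<close>
    have z: "B1 (v 0) = 0" "B2 (v 0) = 0"
      using positive_selfadjoint_0[OF B1] positive_selfadjoint_0[OF B2] by (simp_all add: v0)
    have sum0: "(\<Sum>l=1..n. g l) = (\<Sum>l\<le>n. g l)" if "g 0 = 0" for g :: "nat \<Rightarrow> 'a" and n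
      using that by (intro sum.mono_neutral_left) (auto simp: not_less_eq_eq)
    have "Q n \<bullet> v n = (\<Sum>l\<le>n. iq_weight k \<beta>1 (n - l) * (B1 (v l) \<bullet> v n)) +
        k powr \<alpha> * (\<Sum>l\<le>n. \<omega> (n - l) * (B2 (v l) \<bullet> v n))" for n
    proof -
      have "Q n = (\<Sum>l\<le>n. iq_weight k \<beta>1 (n - l) *\<^sub>R B1 (v l)) + (k powr \<alpha>) *\<^sub>R (\<Sum>l\<le>n. \<omega> (n - l) *\<^sub>R B2 (v l))"
        unfolding Q_def interp_quad_def conv_quad_def
        using sum0[of "\<lambda>l. iq_weight k \<beta>1 (n - l) *\<^sub>R B1 (v l)" n] sum0[of "\<lambda>l. \<omega> (n - l) *\<^sub>R B2 (v l)" n]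
        by (simp add: z)
      thus ?thesis by (simp add: inner_add_left inner_sum_left)
    qed
    hence "(\<Sum>n<N. Q n \<bullet> v n) = (\<Sum>n<N. \<Sum>l\<le>n. iq_weight k \<beta>1 (n - l) * (B1 (v l) \<bullet> v n)) +
        k powr \<alpha> * (\<Sum>n<N. \<Sum>l\<le>n. \<omega> (n - l) * (B2 (v l) \<bullet> v n))"
      by (simp add: sum.distrib sum_distrib_left)
    also have "\<dots> \<ge> 0"
      using positive_weights_form_nonneg[OF iq_weight_positive[OF _ \<beta>1_L1 k] B1 vD(1)]
        positive_weights_form_nonneg[OF cq_weights_positive[OF \<alpha> \<omega>] B2 vD(2)] kernel1
      by (intro add_nonneg_nonneg mult_nonneg_nonneg) (auto simp: memory_kernel_def)
    finally show ?thesis .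
  qed

  \<comment> \<open>Bounds on the residuals\<close>
  let ?L = "integral {0<..} (\<lambda>t. \<bar>\<beta>1 t\<bar>)"
  let ?J = "integral {0..2 * k} (\<lambda>\<zeta>. norm (u'' \<zeta>))"
  let ?a = "integral {0..k} (\<lambda>\<zeta>. norm (B1 (u' \<zeta>)))"
  let ?b = "\<lambda>n. integral {k..real n * k} (\<lambda>\<zeta>. norm (B1 (u'' \<zeta>)))"
  let ?Z = "\<lambda>n. k\<^sup>2 * (real n * k) powr (\<alpha> - 1) * norm (B2 (u' 0)) +
           k powr (\<alpha> + 1) * integral {real (n - 1) * k..real n * k} (\<lambda>\<zeta>. norm (B2 (u'' \<zeta>))) +
           k\<^sup>2 * integral {0..real (n - 1) * k}
             (\<lambda>\<zeta>. (real n * k - \<zeta>) powr (\<alpha> - 1) * norm (B2 (u'' \<zeta>)))"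
  let ?I = "\<lambda>n. integral {real (n - 1) * k..real n * k} (\<lambda>\<zeta>. norm (u''' \<zeta>))"
  have int_norm_nonneg: "0 \<le> integral S h" if "\<And>t. 0 \<le> h t" for S :: "real set" and h :: "real \<Rightarrow> real"
    using that by (cases "h integrable_on S")
      (auto intro: Henstock_Kurzweil_Integration.integral_nonneg simp: not_integrable_integral)
  have L0: "0 \<le> ?L" by (rule int_norm_nonneg) simp
  have nonneg: "0 \<le> ?J" "0 \<le> ?a" "0 \<le> ?b n" "0 \<le> ?I n" "0 \<le> ?Z n" for n
    using k by (auto intro!: int_norm_nonneg add_nonneg_nonneg mult_nonneg_nonneg)

  have residual: "norm (r n) \<le> d + ?L * (?a + k * ?b n) + (if n = 1 then 1 else 2) * ?Z n"
    if n: "0 < n" and d: "norm (u' (real n * k) - (if n = 1 then bdiff k w n else bdiff2 k w n)) \<le> d" for n d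
  proof -
    have t: "0 < real n * k" using n k by simp
    let ?R0 = "u' (real n * k) - (if n = 1 then bdiff k w n else bdiff2 k w n)"
    let ?R1 = "integral {0..real n * k} (\<lambda>s. \<beta>1 (real n * k - s) *\<^sub>R B1 (u s)) - interp_quad k \<beta>1 n (\<lambda>l. B1 (w l))"
    let ?R2 = "integral {0..real n * k} (\<lambda>s. \<beta>2 (real n * k - s) *\<^sub>R B2 (u s)) - conv_quad k \<alpha> \<beta>2 \<omega> n (\<lambda>l. B2 (w l))"
    have "r n = ?R0 + ?R1 + ?R2"
      unfolding r_def W_def eq[OF t, symmetric] by simp
    hence "norm (r n) \<le> norm ?R0 + norm ?R1 + norm ?R2"
      by (simp only: norm_triangle_mono norm_triangle_ineq order_refl)
    moreover have "norm ?R1 \<le> ?L * (?a + k * ?b n)"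
      unfolding w_def
      by (rule residual_interp_bound[OF B1 \<beta>1_L1 k n])
         (use uD continuous_on_u deriv_at dom_u' u'' dom_u'' mem(1)[OF t] int_B1u' int_B1u'' in auto)
    moreover have "norm ?R2 \<le> (if n = 1 then 1 else 2) * ?Z n"
      unfolding w_def
      by (rule residual_conv_bound[OF B2 \<alpha> \<omega> k n \<beta>2])
         (use uD continuous_on_u continuous_on_u' deriv_at dom_u'(2) u'' dom_u'' mem(2)[OF t] int_B2u'' in auto)
    ultimately show ?thesis using d by linarith
  qed
  \<comment> \<open>Twice \<open>T n\<close> covers the memory part of the residual for n >= 2; the
    2 is compensated by the weight 1/2 in the stability bound.\<close>
  define T where "T n = ?L * (2 * ?a + k * ?b n) + ?Z n" for n
  have T_ge: "?L * (?a + k * ?b n) + ?Z n \<le> T n" "0 \<le> ?L * (?a + k * ?b n)" "0 \<le> T n" for n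
    unfolding T_def using L0 nonneg k
    by (auto intro!: mult_left_mono add_nonneg_nonneg mult_nonneg_nonneg simp del: mult_le_cancel_left)
  have r1: "5 / 8 * (q * norm (r 1)) \<le> 5 / 8 * (q * ?J) + q * T 1"
  proof -
    have "integral {0..k} (\<lambda>t. norm (u'' t)) \<le> ?J"
      using k int_u'' int2_sub by (intro integral_subset_le) auto
    hence "norm (r 1) \<le> ?J + ?L * (?a + k * ?b 1) + (if (1::nat) = 1 then 1 else 2) * ?Z 1"
      using difference_error_1 by (intro residual) (auto simp: bdiff_def w_def)
    hence "norm (r 1) \<le> ?J + T 1" using T_ge(1)[of 1] by simp
    hence "5 / 8 * (q * norm (r 1)) \<le> 5 / 8 * (q * (?J + T 1))" using q by (intro mult_left_mono) auto
    also have "\<dots> = 5 / 8 * (q * ?J) + 5 / 8 * (q * T 1)" by (simp only: distrib_left)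
    also have "5 / 8 * (q * T 1) \<le> q * T 1" using q T_ge(3)[of 1] by simp
    finally show ?thesis by simp
  qed
  \<comment> \<open>The stencil at n = 2 reaches back to 0, where u''' is not controlled, so u'' is
    used; for n >= 3 it spans two cells.\<close>
  define d where "d n = (if n = 2 then ?J else k * (?I (n - 1) + ?I n))" for n :: nat
  have rn: "1 / 2 * (q ^ n * norm (r n)) \<le> 1 / 2 * (q ^ n * d n) + q ^ n * T n" if n: "2 \<le> n" for n
  proof -
    have "norm (u' (real n * k) - bdiff2 k w n) \<le> d n"
    proof (cases "n = 2")
      case True
      thus ?thesis using difference_error_2 by (simp add: d_def bdiff2_def bdiff_def w_def)
    next
      case False
      define a where "a = real (n - 2) * k"
      have "3 \<le> n" using False n by simp
      then obtain m where "n = 3 + m" using le_Suc_ex by blast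
      hence m: "n = Suc (Suc (Suc m))" by simp
      have a: "0 < a" "k \<le> a" using k by (auto simp: a_def m algebra_simps add_pos_nonneg)
      have ak: "real n * k = a + 2 * k" "real (n - 1) * k = a + k" "real (n - 1 - 1) * k = a" "real (n - 2) * k = a"
        by (simp_all add: a_def m algebra_simps)
      have int3: "(\<lambda>t. norm (u''' t)) integrable_on {a..a + 2 * k}"
        using integrable_on_subinterval[OF int_u'''[of "a + 2 * k"]] a by auto
      have "norm (u' (a + 2 * k) - ((3/2) *\<^sub>R ((u (a + 2 * k) - u (a + k)) /\<^sub>R k) - (1/2) *\<^sub>R ((u (a + k) - u a) /\<^sub>R k)))
          \<le> k * integral {a..a + 2 * k} (\<lambda>t. norm (u''' t))"
        by (rule difference_error_3[OF a(1) u''' int3])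
      moreover have "integral {a..a + 2 * k} (\<lambda>t. norm (u''' t)) = ?I (n - 1) + ?I n"
        unfolding ak using k int3 by (intro Henstock_Kurzweil_Integration.integral_combine[symmetric]) auto
      moreover have "bdiff2 k w n = (3/2) *\<^sub>R ((u (a + 2 * k) - u (a + k)) /\<^sub>R k) - (1/2) *\<^sub>R ((u (a + k) - u a) /\<^sub>R k)"
        unfolding bdiff2_def bdiff_def w_def ak ..
      ultimately show ?thesis unfolding d_def using False by (simp only: ak(1) if_False)
    qed
    hence "norm (r n) \<le> d n + ?L * (?a + k * ?b n) + (if n = 1 then 1 else 2) * ?Z n"
      using n by (intro residual) auto
    also have "\<dots> = d n + ?L * (?a + k * ?b n) + 2 * ?Z n" using n by simp
    finally have bound: "norm (r n) \<le> d n + ?L * (?a + k * ?b n) + 2 * ?Z n" .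
    have arith: "x \<le> y + 2 * z" if "x \<le> y + l + 2 * s" "l + s \<le> z" "0 \<le> l" for x y z l s :: real
      using that by linarith
    have "norm (r n) \<le> d n + 2 * T n" by (rule arith[OF bound T_ge(1,2)])
    hence "1 / 2 * (q ^ n * norm (r n)) \<le> 1 / 2 * (q ^ n * (d n + 2 * T n))" using q by (intro mult_left_mono) auto
    also have "\<dots> = 1 / 2 * (q ^ n * d n) + q ^ n * T n" by (simp add: distrib_left)
    finally show ?thesis .
  qed
  have d_sum: "1 / 2 * (\<Sum>n=2..N. q ^ n * d n) \<le> 1 / 2 * (q * ?J) + k * (\<Sum>n=2..N. q ^ n * ?I n)" for N
  proof -
    have J': "q ^ 2 * ?J \<le> q * ?J" using q nonneg(1) by (intro mult_right_mono) (auto simp: power2_eq_square)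
    \<comment> \<open>Each \<open>?I n\<close> is met at n and at n + 1 with weight 1/2. The extra
      term on the left reserves the second half of the last one for the next induction step.\<close>
    have "1 / 2 * (\<Sum>n=2..N. q ^ n * d n) + k / 2 * (q ^ N * ?I N) \<le> 1 / 2 * (q * ?J) + k * (\<Sum>n=2..N. q ^ n * ?I n)"
      if "2 \<le> N"
      using that
    proof (induction N rule: nat_induct_at_least)
      case base
      have "d 2 = ?J" by (simp add: d_def)
      moreover have "0 \<le> k * (q ^ 2 * ?I 2)" using k q nonneg(4)[of 2] by simp
      ultimately show ?case using J' by simp
    next
      case (Suc N)
      have "q ^ Suc N * d (Suc N) = k * (q ^ Suc N * ?I N) + k * (q ^ Suc N * ?I (Suc N))"
        using Suc.hyps by (simp add: d_def algebra_simps)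
      moreover have "k / 2 * (q ^ Suc N * ?I N) \<le> k / 2 * (q ^ N * ?I N)"
        using k q nonneg(4)[of N] by (intro mult_left_mono mult_right_mono power_decreasing) auto
      moreover have "(\<Sum>n=2..Suc N. g n) = (\<Sum>n=2..N. g n) + g (Suc N)" for g :: "nat \<Rightarrow> real"
        using Suc.hyps by simp
      ultimately show ?case using Suc.IH by (simp only: distrib_left)
    qed
    moreover have "0 \<le> k / 2 * (q ^ N * ?I N)" "0 \<le> q * ?J" using k q nonneg by (auto intro!: mult_nonneg_nonneg)
    ultimately show ?thesis by (cases "2 \<le> N") auto
  qed

  \<comment> \<open>Summation over all time steps\<close>
  let ?X3 = "\<lambda>n. exp (- c / 2 * real n) * ?I n"
  let ?X1 = "\<lambda>n. exp (- c / 2 * real n) * (2 * ?a + k * ?b n)"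
  let ?X2 = "\<lambda>n. exp (- c / 2 * real n) * ?Z n"
  let ?R = "8 / c * ?J + k * (\<Sum>\<^sub>\<infinity>n\<in>{2..}. ?X3 n) + ?L * (\<Sum>\<^sub>\<infinity>n\<in>{1..}. ?X1 n) + (\<Sum>\<^sub>\<infinity>n\<in>{1..}. ?X2 n)"
  have fin3: "(\<Sum>n=2..N. q ^ n * ?I n) \<le> (\<Sum>\<^sub>\<infinity>n\<in>{2..}. ?X3 n)" for N
    unfolding qn[symmetric]
  proof (rule finite_sum_le_infsum[OF sum_u'''])
    show "0 \<le> ?X3 n" for n by (intro mult_nonneg_nonneg nonneg(4)) simp
  qed auto
  have fin1: "(\<Sum>n=1..N. q ^ n * (2 * ?a + k * ?b n)) \<le> (\<Sum>\<^sub>\<infinity>n\<in>{1..}. ?X1 n)" for N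
    unfolding qn[symmetric]
  proof (rule finite_sum_le_infsum[OF sum_B1])
    show "0 \<le> ?X1 n" for n
      using k by (intro mult_nonneg_nonneg add_nonneg_nonneg nonneg(2,3)) auto
  qed auto
  have fin2: "(\<Sum>n=1..N. q ^ n * ?Z n) \<le> (\<Sum>\<^sub>\<infinity>n\<in>{1..}. ?X2 n)" for N
    unfolding qn[symmetric]
  proof (rule finite_sum_le_infsum[OF sum_B2])
    show "0 \<le> ?X2 n" for n by (rule mult_nonneg_nonneg[OF exp_ge_zero nonneg(5)])
  qed auto
  have bracket: "5 / 8 * (q * norm (r 1)) + 1 / 2 * (\<Sum>n=2..N. q ^ n * norm (r n)) \<le> ?R" if N: "1 \<le> N" for N
  proof -
    have "1 / 2 * (\<Sum>n=2..N. q ^ n * norm (r n)) = (\<Sum>n=2..N. 1 / 2 * (q ^ n * norm (r n)))"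
      by (simp only: sum_distrib_left)
    also have "\<dots> \<le> (\<Sum>n=2..N. 1 / 2 * (q ^ n * d n) + q ^ n * T n)" by (intro sum_mono rn) auto
    also have "\<dots> = 1 / 2 * (\<Sum>n=2..N. q ^ n * d n) + (\<Sum>n=2..N. q ^ n * T n)"
      by (simp only: sum.distrib sum_distrib_left)
    finally have S: "1 / 2 * (\<Sum>n=2..N. q ^ n * norm (r n)) \<le>
        1 / 2 * (\<Sum>n=2..N. q ^ n * d n) + (\<Sum>n=2..N. q ^ n * T n)" .
    have "q * T 1 + (\<Sum>n=2..N. q ^ n * T n) = (\<Sum>n=1..N. q ^ n * T n)"
      using N by (subst (2) sum.atLeast_Suc_atMost) (auto simp: numeral_2_eq_2)
    also have "\<dots> = ?L * (\<Sum>n=1..N. q ^ n * (2 * ?a + k * ?b n)) + (\<Sum>n=1..N. q ^ n * ?Z n)"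
      unfolding T_def sum_distrib_left sum.distrib[symmetric] by (intro sum.cong refl) (simp only: distrib_left mult.left_commute)
    finally have T_sum: "q * T 1 + (\<Sum>n=2..N. q ^ n * T n) =
        ?L * (\<Sum>n=1..N. q ^ n * (2 * ?a + k * ?b n)) + (\<Sum>n=1..N. q ^ n * ?Z n)" .
    \<comment> \<open>9/8 = 5/8 + 1/2 collects the u'' contributions of n = 1 and n = 2.\<close>
    have "9 / 8 * q \<le> 8 / c" using q_c c by (simp add: field_simps)
    hence "(9 / 8 * q) * ?J \<le> 8 / c * ?J" using nonneg(1) by (rule mult_right_mono)
    hence J: "5 / 8 * (q * ?J) + 1 / 2 * (q * ?J) \<le> 8 / c * ?J" by simp
    have I: "k * (\<Sum>n=2..N. q ^ n * ?I n) \<le> k * (\<Sum>\<^sub>\<infinity>n\<in>{2..}. ?X3 n)"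
      using fin3 k by (intro mult_left_mono) auto
    have X1: "?L * (\<Sum>n=1..N. q ^ n * (2 * ?a + k * ?b n)) \<le> ?L * (\<Sum>\<^sub>\<infinity>n\<in>{1..}. ?X1 n)"
      using fin1 L0 by (rule mult_left_mono)
    have arith: "x1 + x2 \<le> J + kX + LX + X"
      if "x1 \<le> j1 + t1" "x2 \<le> ds + ts" "ds \<le> j2 + ki" "t1 + ts = lx + z" "j1 + j2 \<le> J" "ki \<le> kX" "lx \<le> LX" "z \<le> X"
      for x1 x2 j1 j2 t1 ts ds ki lx z J kX LX X :: real
      using that by linarith
    show ?thesis by (rule arith[OF r1 S d_sum T_sum J I X1 fin2])
  qed
  define R where "R = 4 * k / (1 - exp (- c)) * ?R"
  have partial: "sqrt (\<Sum>n=1..N. (q ^ n * norm (v n))\<^sup>2) \<le> R" if N: "1 \<le> N" for N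
  proof -
    have "sqrt (\<Sum>n=1..N. (q ^ n * norm (v n))\<^sup>2) \<le>
        4 * k / (1 - q\<^sup>2) * (5 / 8 * (q * norm (r 1)) + 1 / 2 * (\<Sum>n=2..N. q ^ n * norm (r n)))"
      by (rule bdf2_stability[OF k q v0 e1 e2 Qpos N])
    also have "\<dots> \<le> 4 * k / (1 - q\<^sup>2) * ?R"
    proof (rule mult_left_mono[OF bracket[OF N]])
      show "0 \<le> 4 * k / (1 - q\<^sup>2)" using q k by (simp add: power_le_one)
    qed
    finally show ?thesis by (simp only: R_def q2)
  qed
  let ?V = "\<lambda>n. exp (- c * real n) * (norm (v n))\<^sup>2"
  have "0 \<le> sqrt (\<Sum>n=1..1. (q ^ n * norm (v n))\<^sup>2)" by (intro real_sqrt_ge_zero sum_nonneg) auto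
  hence R0: "0 \<le> R" using partial[of 1] by linarith
  have finite_bound: "sum ?V F \<le> R\<^sup>2" if F: "finite F" for F
  proof -
    obtain N where N: "F \<subseteq> {..N}" using F finite_nat_iff_bounded_le by blast
    \<comment> \<open>Index 0 contributes 0, and \<open>Suc N\<close> meets the requirement of
      \<open>partial\<close> that the range is nonempty.\<close>
    have "F \<subseteq> insert 0 {1..Suc N}" using N by (force simp: not_less_eq_eq)
    hence "sum ?V F \<le> sum ?V (insert 0 {1..Suc N})"
      by (intro sum_mono2) auto
    also have "\<dots> = (\<Sum>n=1..Suc N. (q ^ n * norm (v n))\<^sup>2)"
      unfolding qc by (subst sum.insert) (auto simp: v0 power_mult_distrib)
    also have "\<dots> \<le> R\<^sup>2"
      using partial[of "Suc N"] by (intro sqrt_le_D) auto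
    finally show ?thesis .
  qed
  have summable: "?V summable_on UNIV"
  proof (rule nonneg_bdd_above_summable_on)
    show "bdd_above (sum ?V ` {F. F \<subseteq> UNIV \<and> finite F})"
      by (rule bdd_aboveI2, rule finite_bound) simp
  qed simp
  have "(\<Sum>\<^sub>\<infinity>n. ?V n) \<le> R\<^sup>2"
    by (rule infsum_le_finite_sums[OF summable]) (rule finite_bound)
  hence "normA c v \<le> R" unfolding normA_def using R0 by (intro real_le_lsqrt) auto
  with summable show ?thesis unfolding R_def v_def w_def by simp
qed

end
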